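(* Let $G$ and $H$ be two archimedean $f$-rings. Then the archimedean $\ell$-group tensor product $G \overline{\otimes} H$ is itself an $f$-ring, under a multiplication satisfying $(a\otimes b)(c\otimes d)=(ac)\otimes(bd)$ for all $a,c\in G$ and $b,d\in H$.
   Context: An $\ell$-group is a lattice-ordered group; all $\ell$-groups here are abelian and written additively. An $\ell$-group $G$ is archimedean if $a,b\in G$, $a,b\ge 0$ and $na\le b$ for all $n\in\mathbb{N}$ imply $a=0$. An $\ell$-homomorphism is a group homomorphism that is also a lattice homomorphism. An $f$-ring is an (associative) lattice-ordered ring (a ring whose additive group is an $\ell$-group and in which products of positive elements are positive) such that $a\wedge b=0$ and $c\ge 0$ imply $(ac)\wedge b=(ca)\wedge b=0$; it need not have a unit. It is archimedean if its additive $\ell$-group is. A biadditive map $\mathfrak{b}:G\times H\to K$ between $\ell$-groups is an $\ell$-bimorphism if for every $0\le a\in G$ the map $h\mapsto \mathfrak{b}(a,h)$ and for every $0\le b\in H$ the map $g\mapsto\mathfrak{b}(g,b)$ are lattice homomorphisms. For archimedean $\ell$-groups $G,H$, the archimedean $\ell$-group tensor product (Martinez; Buskes and van Rooij) is the archimedean $\ell$-group $G\overline{\otimes}H$ together with an $\ell$-bimorphism $\otimes:G\times H\to G\overline{\otimes}H$, $(a,b)\mapsto a\otimes b$, such that for every archimedean $\ell$-group $K$ and every $\ell$-bimorphism $\varphi:G\times H\to K$ there is a unique $\ell$-homomorphism $\Phi:G\overline{\otimes}H\to K$ with $\varphi(a,b)=\Phi(a\otimes b)$ for all $a\in G$, $b\in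 H$. It exists and is unique up to isomorphism. For archimedean $f$-rings $G,H$, $G\overline{\otimes}H$ is the tensor product of their underlying additive $\ell$-groups. *)

theory Defs
  imports "HOL-Algebra.Ring" "HOL-Algebra.Lattice"
begin

section \<open>Abelian lattice-ordered groups and f-rings\<close>

text \<open>
  As with the locale \<^locale>\<open>abelian_group\<close> of the library, an additive group is carried by
  a ring record whose fields \<open>mult\<close> and \<open>one\<close> are not looked at. In particular, f-rings
  need no unit: \<open>one\<close> is never used.
\<close>

record 'a lo_ring = "'a ring" +
  lo_le :: "'a \<Rightarrow> 'a \<Rightarrow> bool" (infixl \<open>\<preceq>\<index>\<close> 50)

definition ord_of :: "('a, 'm) lo_ring_scheme \<Rightarrow> 'a gorder" where
  "ord_of G = \<lparr> carrier = carrier G, eq = (=), le = lo_le G \<rparr>"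

locale l_group = abelian_group G for G :: "('a, 'm) lo_ring_scheme" (structure) +
  assumes lattice_ord: "lattice (ord_of G)"
    and add_left_mono:
      "\<lbrakk> x \<in> carrier G; y \<in> carrier G; z \<in> carrier G; x \<preceq> y \<rbrakk> \<Longrightarrow> z \<oplus> x \<preceq> z \<oplus> y"

locale arch_l_group = l_group +
  assumes archimedean:
    "\<lbrakk> a \<in> carrier G; b \<in> carrier G; \<zero> \<preceq> a; \<zero> \<preceq> b; \<And>n::nat. [n] \<cdot> a \<preceq> b \<rbrakk> \<Longrightarrow> a = \<zero>"

locale l_ring = l_group R for R :: "('a, 'm) lo_ring_scheme" (structure) +
  assumes mult_closed: "\<lbrakk> x \<in> carrier R; y \<in> carrier R \<rbrakk> \<Longrightarrow> x \<otimes> y \<in> carrier R"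
    and mult_assoc:
      "\<lbrakk> x \<in> carrier R; y \<in> carrier R; z \<in> carrier R \<rbrakk> \<Longrightarrow> (x \<otimes> y) \<otimes> z = x \<otimes> (y \<otimes> z)"
    and distr_right:
      "\<lbrakk> x \<in> carrier R; y \<in> carrier R; z \<in> carrier R \<rbrakk> \<Longrightarrow> (x \<oplus> y) \<otimes> z = x \<otimes> z \<oplus> y \<otimes> z"
    and distr_left:
      "\<lbrakk> x \<in> carrier R; y \<in> carrier R; z \<in> carrier R \<rbrakk> \<Longrightarrow> z \<otimes> (x \<oplus> y) = z \<otimes> x \<oplus> z \<otimes> y"
    and mult_nonneg:
      "\<lbrakk> x \<in> carrier R; y \<in> carrier R; \<zero> \<preceq> x; \<zero> \<preceq> y \<rbrakk> \<Longrightarrow> \<zero> \<preceq> x \<otimes> y"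

locale f_ring = l_ring +
  assumes disjoint_mult_right:
      "\<lbrakk> a \<in> carrier R; b \<in> carrier R; c \<in> carrier R; a \<sqinter>\<^bsub>ord_of R\<^esub> b = \<zero>; \<zero> \<preceq> c \<rbrakk>
        \<Longrightarrow> (a \<otimes> c) \<sqinter>\<^bsub>ord_of R\<^esub> b = \<zero>"
    and disjoint_mult_left:
      "\<lbrakk> a \<in> carrier R; b \<in> carrier R; c \<in> carrier R; a \<sqinter>\<^bsub>ord_of R\<^esub> b = \<zero>; \<zero> \<preceq> c \<rbrakk>
        \<Longrightarrow> (c \<otimes> a) \<sqinter>\<^bsub>ord_of R\<^esub> b = \<zero>"

locale arch_f_ring = f_ring R + arch_l_group R for R :: "('a, 'm) lo_ring_scheme" (structure)


section \<open>Homomorphisms and bimorphisms\<close>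

definition lattice_hom :: "('a, 'c) gorder_scheme \<Rightarrow> ('b, 'd) gorder_scheme \<Rightarrow> ('a \<Rightarrow> 'b) \<Rightarrow> bool" where
  "lattice_hom L M f \<longleftrightarrow> f \<in> carrier L \<rightarrow> carrier M \<and> join_pres L M f \<and> meet_pres L M f"

definition l_hom :: "('a, 'm) lo_ring_scheme \<Rightarrow> ('b, 'n) lo_ring_scheme \<Rightarrow> ('a \<Rightarrow> 'b) set" where
  "l_hom G H = {f. f \<in> hom (add_monoid G) (add_monoid H) \<and> lattice_hom (ord_of G) (ord_of H) f}"

definition l_bimorphism ::
  "('a, 'm) lo_ring_scheme \<Rightarrow> ('b, 'n) lo_ring_scheme \<Rightarrow> ('c, 'o) lo_ring_scheme \<Rightarrow> ('a \<Rightarrow> 'b \<Rightarrow> 'c) \<Rightarrow> bool" where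
  "l_bimorphism G H K \<phi> \<longleftrightarrow>
     (\<forall>a\<in>carrier G. (\<lambda>b. \<phi> a b) \<in> hom (add_monoid H) (add_monoid K)) \<and>
     (\<forall>b\<in>carrier H. (\<lambda>a. \<phi> a b) \<in> hom (add_monoid G) (add_monoid K)) \<and>
     (\<forall>a\<in>carrier G. \<zero>\<^bsub>G\<^esub> \<preceq>\<^bsub>G\<^esub> a \<longrightarrow> lattice_hom (ord_of H) (ord_of K) (\<lambda>b. \<phi> a b)) \<and>
     (\<forall>b\<in>carrier H. \<zero>\<^bsub>H\<^esub> \<preceq>\<^bsub>H\<^esub> b \<longrightarrow> lattice_hom (ord_of G) (ord_of K) (\<lambda>a. \<phi> a b))"


section \<open>The archimedean tensor product\<close>

text \<open>
  The universal property of \<open>T\<close>, \<open>t\<close> with respect to all archimedean \<open>\<ell>\<close>-groups whose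
  carriers are subsets of the type \<open>'k\<close>. Functions are total in HOL, so uniqueness of the
  induced homomorphism is stated for its restriction to the carrier of \<open>T\<close>.
\<close>

definition tensor_universal ::
  "'k itself \<Rightarrow> ('a, 'm) lo_ring_scheme \<Rightarrow> ('b, 'n) lo_ring_scheme \<Rightarrow> 't lo_ring \<Rightarrow> ('a \<Rightarrow> 'b \<Rightarrow> 't) \<Rightarrow> bool" where
  "tensor_universal U G H T t \<longleftrightarrow>
     (\<forall>(K :: 'k lo_ring) \<phi>. arch_l_group K \<and> l_bimorphism G H K \<phi> \<longrightarrow>
        (\<exists>!\<Phi>. \<Phi> \<in> extensional (carrier T) \<and> \<Phi> \<in> l_hom T K \<and>
              (\<forall>a\<in>carrier G. \<forall>b\<in>carrier H. \<phi> a b = \<Phi> (t a b))))"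

datatype 'g lword =
    LGen 'g
  | LZero
  | LNeg "'g lword"
  | LAdd "'g lword" "'g lword"
  | LMeet "'g lword" "'g lword"
  | LJoin "'g lword" "'g lword"

text \<open>
  A HOL formula cannot quantify over the \<open>\<ell>\<close>-groups of all types, so the definition tests the
  universal property on the single type \<open>'t + ('a \<times> 'b) lword\<close>. This type has room for a
  copy of \<open>T\<close> itself and for a copy of every \<open>\<ell>\<close>-group generated by the image of a bimorphism
  on \<open>G \<times> H\<close>. Nothing is lost: lemma \<open>tensor_universal_all_types\<close> below derives the
  universal property for \<open>\<ell>\<close>-groups of an arbitrary type, and lemma
  \<open>arch_tensor_product_exists\<close> shows that tensor products exist.
\<close>

definition is_arch_tensor_product ::
  "('a, 'm) lo_ring_scheme \<Rightarrow> ('b, 'n) lo_ring_scheme \<Rightarrow> 't lo_ring \<Rightarrow> ('a \<Rightarrow> 'b \<Rightarrow> 't) \<Rightarrow> bool" where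
  "is_arch_tensor_product G H T t \<longleftrightarrow>
     arch_l_group T \<and> l_bimorphism G H T t \<and>
     tensor_universal TYPE('t + ('a \<times> 'b) lword) G H T t"


section \<open>Independence of the test type, and existence\<close>

lemma ord_of_simps [simp]:
  "carrier (ord_of G) = carrier G" "le (ord_of G) = lo_le G" "eq (ord_of G) = (=)"
  by (simp_all add: ord_of_def)

lemma lattice_ord_ofI:
  assumes refl: "\<And>x. x \<in> carrier G \<Longrightarrow> lo_le G x x"
    and antisym: "\<And>x y. \<lbrakk> x \<in> carrier G; y \<in> carrier G; lo_le G x y; lo_le G y x \<rbrakk> \<Longrightarrow> x = y"
    and trans: "\<And>x y z. \<lbrakk> x \<in> carrier G; y \<in> carrier G; z \<in> carrier G; lo_le G x y; lo_le G y z \<rbrakk> \<Longrightarrow> lo_le G x z"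
    and inf: "\<And>x y. \<lbrakk> x \<in> carrier G; y \<in> carrier G \<rbrakk> \<Longrightarrow>
       \<exists>m\<in>carrier G. lo_le G m x \<and> lo_le G m y \<and> (\<forall>w\<in>carrier G. lo_le G w x \<and> lo_le G w y \<longrightarrow> lo_le G w m)"
    and sup: "\<And>x y. \<lbrakk> x \<in> carrier G; y \<in> carrier G \<rbrakk> \<Longrightarrow>
       \<exists>m\<in>carrier G. lo_le G x m \<and> lo_le G y m \<and> (\<forall>w\<in>carrier G. lo_le G x w \<and> lo_le G y w \<longrightarrow> lo_le G m w)"
  shows "lattice (ord_of G)"
proof (unfold_locales, goal_cases)
  case (9 x y)
  then show ?case using sup[of x y] by (auto simp: least_def Upper_def)
next
  case (10 x y)
  then show ?case using inf[of x y] by (auto simp: greatest_def Lower_def)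
qed (auto intro: refl antisym trans)

context l_group
begin

sublocale lat: lattice "ord_of G"
  rewrites "carrier (ord_of G) = carrier G" and "le (ord_of G) = lo_le G" and "eq (ord_of G) = (=)"
  by (auto simp: lattice_ord)

end

lemma l_group_meet_join_eqI:
  fixes G :: "('a, 'm) lo_ring_scheme"
  assumes "l_group G"
  shows "\<And>x y z. \<lbrakk> z \<in> carrier G; lo_le G z x; lo_le G z y;
      \<And>w. \<lbrakk> w \<in> carrier G; lo_le G w x; lo_le G w y \<rbrakk> \<Longrightarrow> lo_le G w z; x \<in> carrier G; y \<in> carrier G \<rbrakk>
      \<Longrightarrow> x \<sqinter>\<^bsub>ord_of G\<^esub> y = z" 
    and "\<And>x y z. \<lbrakk> z \<in> carrier G; lo_le G x z; lo_le G y z;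
      \<And>w. \<lbrakk> w \<in> carrier G; lo_le G x w; lo_le G y w \<rbrakk> \<Longrightarrow> lo_le G z w; x \<in> carrier G; y \<in> carrier G \<rbrakk>
      \<Longrightarrow> x \<squnion>\<^bsub>ord_of G\<^esub> y = z"
proof -
  interpret l_group G by fact
  show "x \<sqinter>\<^bsub>ord_of G\<^esub> y = z" if "z \<in> carrier G" "lo_le G z x" "lo_le G z y"
    "\<And>w. \<lbrakk> w \<in> carrier G; lo_le G w x; lo_le G w y \<rbrakk> \<Longrightarrow> lo_le G w z" "x \<in> carrier G" "y \<in> carrier G" for x y z
    by (meson lat.le_antisym lat.meet_closed lat.meet_le lat.meet_left lat.meet_right that)
  show "x \<squnion>\<^bsub>ord_of G\<^esub> y = z" if "z \<in> carrier G" "lo_le G x z" "lo_le G y z"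
    "\<And>w. \<lbrakk> w \<in> carrier G; lo_le G x w; lo_le G y w \<rbrakk> \<Longrightarrow> lo_le G z w" "x \<in> carrier G" "y \<in> carrier G" for x y z
    by (meson lat.le_antisym lat.join_closed lat.join_le lat.join_left lat.join_right that)
qed

lemmas l_group_meet_eqI = l_group_meet_join_eqI(1)
lemmas l_group_join_eqI = l_group_meet_join_eqI(2)

lemma l_hom_iff:
  assumes "l_group G" "l_group H"
  shows "f \<in> l_hom G H \<longleftrightarrow>
    (\<forall>x\<in>carrier G. f x \<in> carrier H) \<and>
    (\<forall>x\<in>carrier G. \<forall>y\<in>carrier G. f (x \<oplus>\<^bsub>G\<^esub> y) = f x \<oplus>\<^bsub>H\<^esub> f y \<and>
       f (x \<squnion>\<^bsub>ord_of G\<^esub> y) = f x \<squnion>\<^bsub>ord_of H\<^esub> f y \<and>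
       f (x \<sqinter>\<^bsub>ord_of G\<^esub> y) = f x \<sqinter>\<^bsub>ord_of H\<^esub> f y)"
  using assms[THEN l_group.lattice_ord]
  by (auto simp: l_hom_def lattice_hom_def hom_def join_pres_def meet_pres_def)

lemma l_hom_zero_neg:
  assumes "l_group G" "l_group H" "f \<in> l_hom G H"
  shows "f \<zero>\<^bsub>G\<^esub> = \<zero>\<^bsub>H\<^esub>" "x \<in> carrier G \<Longrightarrow> f (\<ominus>\<^bsub>G\<^esub> x) = \<ominus>\<^bsub>H\<^esub> f x"
proof -
  interpret G: l_group G by fact
  interpret H: l_group H by fact
  interpret group_hom "add_monoid G" "add_monoid H" f
    using assms(3) G.a_group H.a_group by (auto simp: group_hom_def group_hom_axioms_def l_hom_def)
  show "f \<zero>\<^bsub>G\<^esub> = \<zero>\<^bsub>H\<^esub>" using hom_one by simp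
  show "x \<in> carrier G \<Longrightarrow> f (\<ominus>\<^bsub>G\<^esub> x) = \<ominus>\<^bsub>H\<^esub> f x" using hom_inv[of x] by (simp add: a_inv_def)
qed

lemma l_hom_compose:
  assumes "l_group G" "l_group H" "l_group K" "f \<in> l_hom G H" "g \<in> l_hom H K"
  shows "(\<lambda>x. g (f x)) \<in> l_hom G K"
  using assms by (simp add: l_hom_iff)

lemma l_hom_cong:
  assumes "l_group G" "l_group H" "f \<in> l_hom G H" "\<And>x. x \<in> carrier G \<Longrightarrow> g x = f x"
  shows "g \<in> l_hom G H"
proof -
  interpret G: l_group G by fact
  show ?thesis using assms(3,4) by (simp add: l_hom_iff[OF assms(1,2)])
qed

inductive_set l_gen :: "('a, 'm) lo_ring_scheme \<Rightarrow> 'a set \<Rightarrow> 'a set"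
  for G and X where
  gen: "x \<in> X \<Longrightarrow> x \<in> l_gen G X"
| zero: "\<zero>\<^bsub>G\<^esub> \<in> l_gen G X"
| neg: "x \<in> l_gen G X \<Longrightarrow> \<ominus>\<^bsub>G\<^esub> x \<in> l_gen G X"
| add: "\<lbrakk> x \<in> l_gen G X; y \<in> l_gen G X \<rbrakk> \<Longrightarrow> x \<oplus>\<^bsub>G\<^esub> y \<in> l_gen G X"
| meet: "\<lbrakk> x \<in> l_gen G X; y \<in> l_gen G X \<rbrakk> \<Longrightarrow> x \<sqinter>\<^bsub>ord_of G\<^esub> y \<in> l_gen G X"
| join: "\<lbrakk> x \<in> l_gen G X; y \<in> l_gen G X \<rbrakk> \<Longrightarrow> x \<squnion>\<^bsub>ord_of G\<^esub> y \<in> l_gen G X"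

definition l_subgroup :: "'a set \<Rightarrow> ('a, 'm) lo_ring_scheme \<Rightarrow> bool" where
  "l_subgroup S G \<longleftrightarrow> S \<subseteq> carrier G \<and> \<zero>\<^bsub>G\<^esub> \<in> S \<and> (\<forall>x\<in>S. \<ominus>\<^bsub>G\<^esub> x \<in> S) \<and>
     (\<forall>x\<in>S. \<forall>y\<in>S. x \<oplus>\<^bsub>G\<^esub> y \<in> S \<and> x \<sqinter>\<^bsub>ord_of G\<^esub> y \<in> S \<and> x \<squnion>\<^bsub>ord_of G\<^esub> y \<in> S)"

lemma l_subgroup_carrier:
  assumes "l_group G" shows "l_subgroup (carrier G) G"
proof -
  interpret l_group G by fact
  show ?thesis by (simp add: l_subgroup_def)
qed

lemma l_subgroup_l_gen:
  assumes "l_group G" "X \<subseteq> carrier G"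
  shows "l_subgroup (l_gen G X) G"
proof -
  interpret l_group G by fact
  have "x \<in> carrier G" if "x \<in> l_gen G X" for x
    using that by induction (use assms(2) in auto)
  then show ?thesis by (auto simp: l_subgroup_def intro: l_gen.intros)
qed

lemma l_hom_eq_on_l_gen:
  assumes "l_group G" "l_group H" "f \<in> l_hom G H" "g \<in> l_hom G H" "X \<subseteq> carrier G"
    and "\<And>x. x \<in> X \<Longrightarrow> f x = g x" and "x \<in> l_gen G X"
  shows "f x = g x"
proof -
  have c: "y \<in> carrier G" if "y \<in> l_gen G X" for y
    using l_subgroup_l_gen[OF assms(1,5)] that by (auto simp: l_subgroup_def)
  note f = assms(3)[unfolded l_hom_iff[OF assms(1,2)]] l_hom_zero_neg[OF assms(1,2,3)]
  note g = assms(4)[unfolded l_hom_iff[OF assms(1,2)]] l_hom_zero_neg[OF assms(1,2,4)]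
  from assms(7) show ?thesis
    by induction (simp_all add: assms(6) c f g)
qed

text \<open>The sub-\<open>\<ell>\<close>-group \<open>S\<close> of \<open>G\<close>, moved to another type along an injection \<open>f\<close>.\<close>

definition l_copy :: "('a \<Rightarrow> 'c) \<Rightarrow> 'a set \<Rightarrow> ('a, 'm) lo_ring_scheme \<Rightarrow> 'c lo_ring" where
  "l_copy f S G = \<lparr> carrier = f ` S, mult = undefined, one = undefined, zero = f \<zero>\<^bsub>G\<^esub>,
     add = (\<lambda>x y. f (inv_into S f x \<oplus>\<^bsub>G\<^esub> inv_into S f y)),
     lo_le = (\<lambda>x y. inv_into S f x \<preceq>\<^bsub>G\<^esub> inv_into S f y) \<rparr>"

context
  fixes G :: "('a, 'm) lo_ring_scheme" and S and f :: "'a \<Rightarrow> 'c"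
  assumes G: "l_group G" and S: "l_subgroup S G" and inj: "inj_on f S"
begin

interpretation l_group G by (fact G)

lemma l_subgroup_simps:
  "x \<in> S \<Longrightarrow> x \<in> carrier G" "\<zero>\<^bsub>G\<^esub> \<in> S" "x \<in> S \<Longrightarrow> \<ominus>\<^bsub>G\<^esub> x \<in> S"
  "x \<in> S \<Longrightarrow> y \<in> S \<Longrightarrow> x \<oplus>\<^bsub>G\<^esub> y \<in> S"
  "x \<in> S \<Longrightarrow> y \<in> S \<Longrightarrow> x \<sqinter>\<^bsub>ord_of G\<^esub> y \<in> S"
  "x \<in> S \<Longrightarrow> y \<in> S \<Longrightarrow> x \<squnion>\<^bsub>ord_of G\<^esub> y \<in> S"
  using S by (auto simp: l_subgroup_def)

lemma l_copy_simps:
  "carrier (l_copy f S G) = f ` S" "\<zero>\<^bsub>l_copy f S G\<^esub> = f \<zero>\<^bsub>G\<^esub>"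
  "x \<in> S \<Longrightarrow> y \<in> S \<Longrightarrow> f x \<oplus>\<^bsub>l_copy f S G\<^esub> f y = f (x \<oplus>\<^bsub>G\<^esub> y)"
  "x \<in> S \<Longrightarrow> y \<in> S \<Longrightarrow> (f x \<preceq>\<^bsub>l_copy f S G\<^esub> f y) = (x \<preceq>\<^bsub>G\<^esub> y)"
  using inj by (simp_all add: l_copy_def)

lemma l_copy_l_group: "l_group (l_copy f S G)"
proof (intro l_group.intro l_group_axioms.intro)
  show "abelian_group (l_copy f S G)"
  proof (rule abelian_groupI)
    fix x assume "x \<in> carrier (l_copy f S G)"
    then obtain u where u: "u \<in> S" "x = f u" by (auto simp: l_copy_simps)
    then show "\<exists>y\<in>carrier (l_copy f S G). y \<oplus>\<^bsub>l_copy f S G\<^esub> x = \<zero>\<^bsub>l_copy f S G\<^esub>"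
      by (intro bexI[of _ "f (\<ominus>\<^bsub>G\<^esub> u)"]) (auto simp: l_copy_simps l_subgroup_simps l_neg)
  qed (auto simp: l_copy_simps l_subgroup_simps a_ac)
  show "lattice (ord_of (l_copy f S G))"
  proof (rule lattice_ord_ofI)
    fix x y assume "x \<in> carrier (l_copy f S G)" "y \<in> carrier (l_copy f S G)"
    then obtain u v where u: "u \<in> S" "x = f u" "v \<in> S" "y = f v" by (auto simp: l_copy_simps)
    show "\<exists>m\<in>carrier (l_copy f S G). m \<preceq>\<^bsub>l_copy f S G\<^esub> x \<and> m \<preceq>\<^bsub>l_copy f S G\<^esub> y \<and>
      (\<forall>w\<in>carrier (l_copy f S G). w \<preceq>\<^bsub>l_copy f S G\<^esub> x \<and> w \<preceq>\<^bsub>l_copy f S G\<^esub> y \<longrightarrow> w \<preceq>\<^bsub>l_copy f S G\<^esub> m)"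
      by (rule bexI[of _ "f (u \<sqinter>\<^bsub>ord_of G\<^esub> v)"])
        (use u in \<open>auto simp: l_copy_simps l_subgroup_simps lat.meet_left lat.meet_right intro!: lat.meet_le\<close>)
    show "\<exists>m\<in>carrier (l_copy f S G). x \<preceq>\<^bsub>l_copy f S G\<^esub> m \<and> y \<preceq>\<^bsub>l_copy f S G\<^esub> m \<and>
      (\<forall>w\<in>carrier (l_copy f S G). x \<preceq>\<^bsub>l_copy f S G\<^esub> w \<and> y \<preceq>\<^bsub>l_copy f S G\<^esub> w \<longrightarrow> m \<preceq>\<^bsub>l_copy f S G\<^esub> w)"
      by (rule bexI[of _ "f (u \<squnion>\<^bsub>ord_of G\<^esub> v)"])
        (use u in \<open>auto simp: l_copy_simps l_subgroup_simps lat.join_left lat.join_right intro!: lat.join_le\<close>)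
  next
    fix x y assume *: "x \<in> carrier (l_copy f S G)" "y \<in> carrier (l_copy f S G)"
      "x \<preceq>\<^bsub>l_copy f S G\<^esub> y" "y \<preceq>\<^bsub>l_copy f S G\<^esub> x"
    then obtain u v where "u \<in> S" "x = f u" "v \<in> S" "y = f v" by (auto simp: l_copy_simps)
    then show "x = y" using * lat.le_antisym[of u v] by (simp add: l_copy_simps l_subgroup_simps)
  next
    fix x y z assume *: "x \<in> carrier (l_copy f S G)" "y \<in> carrier (l_copy f S G)" "z \<in> carrier (l_copy f S G)"
      "x \<preceq>\<^bsub>l_copy f S G\<^esub> y" "y \<preceq>\<^bsub>l_copy f S G\<^esub> z"
    then obtain u v w where "u \<in> S" "x = f u" "v \<in> S" "y = f v" "w \<in> S" "z = f w"
      by (auto simp: l_copy_simps)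
    then show "x \<preceq>\<^bsub>l_copy f S G\<^esub> z"
      using * lat.le_trans[of u v w] by (simp add: l_copy_simps l_subgroup_simps)
  qed (auto simp: l_copy_simps l_subgroup_simps)
qed (auto simp: l_copy_simps l_subgroup_simps add_left_mono)

lemma l_copy_meet_join:
  assumes "x \<in> S" "y \<in> S"
  shows "f x \<sqinter>\<^bsub>ord_of (l_copy f S G)\<^esub> f y = f (x \<sqinter>\<^bsub>ord_of G\<^esub> y)"
    and "f x \<squnion>\<^bsub>ord_of (l_copy f S G)\<^esub> f y = f (x \<squnion>\<^bsub>ord_of G\<^esub> y)"
proof -
  show "f x \<sqinter>\<^bsub>ord_of (l_copy f S G)\<^esub> f y = f (x \<sqinter>\<^bsub>ord_of G\<^esub> y)"
    by (rule l_group_meet_eqI[OF l_copy_l_group])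
      (use assms in \<open>auto simp: l_copy_simps l_subgroup_simps lat.meet_left lat.meet_right intro!: lat.meet_le\<close>)
  show "f x \<squnion>\<^bsub>ord_of (l_copy f S G)\<^esub> f y = f (x \<squnion>\<^bsub>ord_of G\<^esub> y)"
    by (rule l_group_join_eqI[OF l_copy_l_group])
      (use assms in \<open>auto simp: l_copy_simps l_subgroup_simps lat.join_left lat.join_right intro!: lat.join_le\<close>)
qed

lemma l_copy_incl: "inv_into S f \<in> l_hom (l_copy f S G) G"
  using inj by (auto simp: l_hom_iff[OF l_copy_l_group G] l_copy_simps l_copy_meet_join l_subgroup_simps)

lemma l_copy_arch:
  assumes "arch_l_group G" shows "arch_l_group (l_copy f S G)"
proof (intro arch_l_group.intro arch_l_group_axioms.intro l_copy_l_group)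
  fix x y assume *: "x \<in> carrier (l_copy f S G)" "y \<in> carrier (l_copy f S G)"
    "\<zero>\<^bsub>l_copy f S G\<^esub> \<preceq>\<^bsub>l_copy f S G\<^esub> x" "\<zero>\<^bsub>l_copy f S G\<^esub> \<preceq>\<^bsub>l_copy f S G\<^esub> y"
    and le: "\<And>n::nat. [n] \<cdot>\<^bsub>l_copy f S G\<^esub> x \<preceq>\<^bsub>l_copy f S G\<^esub> y"
  from * obtain u v where u: "u \<in> S" "x = f u" "v \<in> S" "y = f v" by (auto simp: l_copy_simps)
  have n: "[n] \<cdot>\<^bsub>G\<^esub> u \<in> S \<and> [n] \<cdot>\<^bsub>l_copy f S G\<^esub> x = f ([n] \<cdot>\<^bsub>G\<^esub> u)" for n :: nat
    by (induction n) (auto simp: add_pow_def l_copy_simps l_subgroup_simps u)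
  have "u = \<zero>\<^bsub>G\<^esub>"
    using * le n u by (intro arch_l_group.archimedean[OF assms, of u v]) (auto simp: l_subgroup_simps l_copy_simps)
  then show "x = \<zero>\<^bsub>l_copy f S G\<^esub>" by (simp add: u l_copy_simps)
qed

lemma l_copy_hom:
  assumes "l_group T" "\<Psi> \<in> l_hom T G" "\<And>x. x \<in> carrier T \<Longrightarrow> \<Psi> x \<in> S"
  shows "(\<lambda>x. f (\<Psi> x)) \<in> l_hom T (l_copy f S G)"
  using assms by (auto simp: l_hom_iff l_copy_l_group G l_copy_simps l_copy_meet_join)

lemma l_copy_bimorphism:
  assumes "l_bimorphism A B G \<phi>" "\<And>a b. a \<in> carrier A \<Longrightarrow> b \<in> carrier B \<Longrightarrow> \<phi> a b \<in> S"
  shows "l_bimorphism A B (l_copy f S G) (\<lambda>a b. f (\<phi> a b))"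
  using assms l_copy_l_group[THEN l_group.lattice_ord]
  by (auto simp: l_bimorphism_def lattice_hom_def hom_def join_pres_def meet_pres_def l_copy_simps l_copy_meet_join)

end


primrec lword_eval :: "('a, 'm) lo_ring_scheme \<Rightarrow> ('g \<Rightarrow> 'a) \<Rightarrow> 'g lword \<Rightarrow> 'a" where
  "lword_eval G \<gamma> (LGen x) = \<gamma> x"
| "lword_eval G \<gamma> LZero = \<zero>\<^bsub>G\<^esub>"
| "lword_eval G \<gamma> (LNeg u) = \<ominus>\<^bsub>G\<^esub> lword_eval G \<gamma> u"
| "lword_eval G \<gamma> (LAdd u v) = lword_eval G \<gamma> u \<oplus>\<^bsub>G\<^esub> lword_eval G \<gamma> v"
| "lword_eval G \<gamma> (LMeet u v) = lword_eval G \<gamma> u \<sqinter>\<^bsub>ord_of G\<^esub> lword_eval G \<gamma> v"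
| "lword_eval G \<gamma> (LJoin u v) = lword_eval G \<gamma> u \<squnion>\<^bsub>ord_of G\<^esub> lword_eval G \<gamma> v"

lemma l_gen_inj_lword:
  fixes G :: "('a, 'm) lo_ring_scheme" and \<gamma> :: "'g \<Rightarrow> 'a"
  shows "\<exists>f :: 'a \<Rightarrow> 'g lword. inj_on f (l_gen G (\<gamma> ` A))"
proof -
  have "\<exists>u. lword_eval G \<gamma> u = x" if "x \<in> l_gen G (\<gamma> ` A)" for x
    using that
  proof induction
    case (gen x)
    then show ?case by (auto intro: exI[of _ "LGen _"])
  next
    case zero
    show ?case by (rule exI[of _ LZero]) simp
  next
    case (neg x)
    then show ?case by (auto intro: exI[of _ "LNeg _"])
  next
    case (add x y)
    then show ?case by (auto intro: exI[of _ "LAdd _ _"])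
  next
    case (meet x y)
    then show ?case by (auto intro: exI[of _ "LMeet _ _"])
  next
    case (join x y)
    then show ?case by (auto intro: exI[of _ "LJoin _ _"])
  qed
  then have "l_gen G (\<gamma> ` A) \<subseteq> range (lword_eval G \<gamma>)" by (metis rangeI subsetI)
  then have "inj_on (inv_into UNIV (lword_eval G \<gamma>)) (l_gen G (\<gamma> ` A))" by (rule inj_on_inv_into)
  then show ?thesis by blast
qed

text \<open>
  If bimorphisms into groups on a type \<open>'u\<close> with room for all words over \<open>G \<times> H\<close> factor through \<open>T\<close>,
  then so do bimorphisms into groups on any type.
\<close>

lemma tensor_factor:
  fixes G :: "('a, 'm) lo_ring_scheme" and H :: "('b, 'n) lo_ring_scheme" and T :: "'t lo_ring"
    and K :: "'k lo_ring" and e :: "('a \<times> 'b) lword \<Rightarrow> 'u"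
  assumes T: "l_group T" "\<And>a b. a \<in> carrier G \<Longrightarrow> b \<in> carrier H \<Longrightarrow> t a b \<in> carrier T"
    and e: "inj e"
    and univ: "\<And>(K' :: 'u lo_ring) \<phi>'. arch_l_group K' \<Longrightarrow> l_bimorphism G H K' \<phi>' \<Longrightarrow>
       \<exists>\<Phi>. \<Phi> \<in> l_hom T K' \<and> (\<forall>a\<in>carrier G. \<forall>b\<in>carrier H. \<phi>' a b = \<Phi> (t a b))"
    and K: "arch_l_group K" "l_bimorphism G H K \<phi>"
  shows "\<exists>\<Phi>. \<Phi> \<in> extensional (carrier T) \<and> \<Phi> \<in> l_hom T K \<and>
              (\<forall>a\<in>carrier G. \<forall>b\<in>carrier H. \<phi> a b = \<Phi> (t a b))"
proof -
  define A where "A = carrier G \<times> carrier H"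
  define S where "S = l_gen K ((\<lambda>(a, b). \<phi> a b) ` A)"
  have Kl: "l_group K" using K(1) by (simp add: arch_l_group_def)
  have "(\<lambda>(a, b). \<phi> a b) ` A \<subseteq> carrier K"
    using K(2) by (auto simp: A_def l_bimorphism_def hom_def)
  then have S: "l_subgroup S K" unfolding S_def by (rule l_subgroup_l_gen[OF Kl])
  have \<phi>S: "\<phi> a b \<in> S" if "a \<in> carrier G" "b \<in> carrier H" for a b
    using that by (auto simp: S_def A_def intro!: l_gen.gen)
  obtain f0 :: "'k \<Rightarrow> ('a \<times> 'b) lword" where "inj_on f0 S"
    using l_gen_inj_lword[of K] unfolding S_def by blast
  then have f: "inj_on (e \<circ> f0) S" using e by (simp add: comp_inj_on inj_on_subset)
  define f where "f = e \<circ> f0"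
  note f = f[folded f_def]
  obtain \<Phi> where \<Phi>: "\<Phi> \<in> l_hom T (l_copy f S K)"
    "\<And>a b. a \<in> carrier G \<Longrightarrow> b \<in> carrier H \<Longrightarrow> f (\<phi> a b) = \<Phi> (t a b)"
    using univ[OF l_copy_arch[OF Kl S f K(1)] l_copy_bimorphism[OF Kl S f K(2) \<phi>S]] by blast
  let ?\<Psi> = "\<lambda>x. inv_into S f (\<Phi> x)"
  have "?\<Psi> \<in> l_hom T K"
    by (rule l_hom_compose[OF T(1) l_copy_l_group[OF Kl S f] Kl \<Phi>(1) l_copy_incl[OF Kl S f]])
  then have "restrict ?\<Psi> (carrier T) \<in> l_hom T K"
    by (rule l_hom_cong[OF T(1) Kl]) simp
  moreover have "\<phi> a b = ?\<Psi> (t a b)" if "a \<in> carrier G" "b \<in> carrier H" for a b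
    using \<phi>S[OF that] f by (simp flip: \<Phi>(2)[OF that])
  ultimately show ?thesis
    by (intro exI[of _ "restrict ?\<Psi> (carrier T)"]) (simp add: T(2))
qed

lemma ex1_unique: "\<lbrakk> \<exists>!x. P x; P x; P y \<rbrakk> \<Longrightarrow> x = y"
  by blast

lemma tensor_universalD:
  fixes K :: "'k lo_ring"
  assumes "tensor_universal TYPE('k) G H T t" "arch_l_group K" "l_bimorphism G H K \<phi>"
  shows "\<exists>!\<Phi>. \<Phi> \<in> extensional (carrier T) \<and> \<Phi> \<in> l_hom T K \<and>
              (\<forall>a\<in>carrier G. \<forall>b\<in>carrier H. \<phi> a b = \<Phi> (t a b))"
    and "\<exists>\<Phi>. \<Phi> \<in> l_hom T K \<and> (\<forall>a\<in>carrier G. \<forall>b\<in>carrier H. \<phi> a b = \<Phi> (t a b))"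
proof -
  show *: "\<exists>!\<Phi>. \<Phi> \<in> extensional (carrier T) \<and> \<Phi> \<in> l_hom T K \<and>
              (\<forall>a\<in>carrier G. \<forall>b\<in>carrier H. \<phi> a b = \<Phi> (t a b))"
    using assms by (simp add: tensor_universal_def)
  show "\<exists>\<Phi>. \<Phi> \<in> l_hom T K \<and> (\<forall>a\<in>carrier G. \<forall>b\<in>carrier H. \<phi> a b = \<Phi> (t a b))"
    by (rule ex1E[OF *]) (rule exI, elim conjE, rule conjI)
qed

lemma is_arch_tensor_product_gen:
  fixes G :: "('a, 'm) lo_ring_scheme" and H :: "('b, 'n) lo_ring_scheme" and T :: "'t lo_ring"
  assumes "is_arch_tensor_product G H T t"
  shows "l_gen T ((\<lambda>(a, b). t a b) ` (carrier G \<times> carrier H)) = carrier T"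
proof -
  let ?X = "(\<lambda>(a, b). t a b) ` (carrier G \<times> carrier H)"
  let ?i = "Inl :: 't \<Rightarrow> 't + ('a \<times> 'b) lword"
  have ar: "arch_l_group T" and t: "l_bimorphism G H T t"
    and univ: "tensor_universal TYPE('t + ('a \<times> 'b) lword) G H T t"
    using assms by (auto simp: is_arch_tensor_product_def)
  have T: "l_group T" using ar by (simp add: arch_l_group_def)
  interpret T: l_group T by fact
  have X: "?X \<subseteq> carrier T" using t by (auto simp: l_bimorphism_def hom_def)
  define S where "S = l_gen T ?X"
  have S: "l_subgroup S T" unfolding S_def by (rule l_subgroup_l_gen[OF T X])
  have tS: "t a b \<in> S" if "a \<in> carrier G" "b \<in> carrier H" for a b
    using that by (auto simp: S_def intro!: l_gen.gen)
  have i: "inj_on ?i B" for B by simp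
  let ?K = "l_copy ?i S T" and ?K' = "l_copy ?i (carrier T) T"
  note C = l_subgroup_carrier[OF T]
  obtain \<Phi> where \<Phi>: "\<Phi> \<in> l_hom T ?K"
    "\<And>a b. a \<in> carrier G \<Longrightarrow> b \<in> carrier H \<Longrightarrow> Inl (t a b) = \<Phi> (t a b)"
    using tensor_universalD(2)[OF univ l_copy_arch[OF T S i ar] l_copy_bimorphism[OF T S i t tS]] by auto
  define \<Psi> where "\<Psi> x = inv_into S ?i (\<Phi> x)" for x
  have \<Psi>: "\<Psi> \<in> l_hom T T" unfolding \<Psi>_def
    by (rule l_hom_compose[OF T l_copy_l_group[OF T S i] T \<Phi>(1) l_copy_incl[OF T S i]])
  have \<Psi>S: "\<Psi> x \<in> S" if "x \<in> carrier T" for x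
    using \<Phi>(1) that by (auto simp: l_hom_iff[OF T l_copy_l_group[OF T S i]] l_copy_simps[OF T S i] \<Psi>_def
        intro: inv_into_into)
  have \<Psi>c: "\<Psi> x \<in> carrier T" if "x \<in> carrier T" for x
    using \<Psi>S[OF that] S by (auto simp: l_subgroup_def)
  have \<Psi>t: "\<Psi> (t a b) = t a b" if "a \<in> carrier G" "b \<in> carrier H" for a b
    using tS[OF that] unfolding \<Psi>_def by (simp flip: \<Phi>(2)[OF that])
  have "id \<in> l_hom T T" by (simp add: l_hom_iff[OF T T])
  note h1 = l_copy_hom[OF T C i T \<Psi> \<Psi>c] and h2 = l_copy_hom[OF T C i T this]
  have tc: "t a b \<in> carrier T" if "a \<in> carrier G" "b \<in> carrier H" for a b
    using X that by auto
  have K': "arch_l_group ?K'" "l_group ?K'"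
    by (rule l_copy_arch[OF T C i ar] l_copy_l_group[OF T C i])+
  have "restrict (\<lambda>x. ?i (\<Psi> x)) (carrier T) = restrict (\<lambda>x. ?i (id x)) (carrier T)"
  proof -
    have ex1: "\<exists>!\<Theta>. \<Theta> \<in> extensional (carrier T) \<and> \<Theta> \<in> l_hom T ?K' \<and>
              (\<forall>a\<in>carrier G. \<forall>b\<in>carrier H. ?i (t a b) = \<Theta> (t a b))"
      by (rule tensor_universalD(1)[OF univ K'(1) l_copy_bimorphism[OF T C i t tc]])
    have r1: "restrict (\<lambda>x. ?i (\<Psi> x)) (carrier T) \<in> l_hom T ?K'"
      by (rule l_hom_cong[OF T K'(2) h1]) simp_all
    have r2: "restrict (\<lambda>x. ?i (id x)) (carrier T) \<in> l_hom T ?K'"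
      by (rule l_hom_cong[OF T K'(2) h2]) simp_all
    show ?thesis
      by (rule ex1_unique[OF ex1]) (use r1 r2 in \<open>simp_all add: \<Psi>t tc\<close>)
  qed
  then have "\<Psi> x = x" if "x \<in> carrier T" for x
    using that by (metis Inl_inject id_apply restrict_apply')
  then have "carrier T \<subseteq> S" using \<Psi>S by (metis subsetI)
  moreover have "S \<subseteq> carrier T" using S by (auto simp: l_subgroup_def)
  ultimately show ?thesis by (simp add: S_def)
qed

lemma tensor_hom_unique:
  assumes "l_group T" "l_group K"
    and gen: "l_gen T ((\<lambda>(a, b). t a b) ` (carrier G \<times> carrier H)) = carrier T"
    and t: "\<And>a b. a \<in> carrier G \<Longrightarrow> b \<in> carrier H \<Longrightarrow> t a b \<in> carrier T"
    and "\<Phi> \<in> extensional (carrier T)" "\<Psi> \<in> extensional (carrier T)" "\<Phi> \<in> l_hom T K" "\<Psi> \<in> l_hom T K"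
    and "\<And>a b. a \<in> carrier G \<Longrightarrow> b \<in> carrier H \<Longrightarrow> \<Phi> (t a b) = \<Psi> (t a b)"
  shows "\<Phi> = \<Psi>"
proof (rule extensionalityI)
  fix x assume x: "x \<in> carrier T"
  show "\<Phi> x = \<Psi> x"
    by (rule l_hom_eq_on_l_gen[of T K \<Phi> \<Psi> "(\<lambda>(a, b). t a b) ` (carrier G \<times> carrier H)"];
      use assms x in auto)
qed (use assms in auto)

theorem tensor_universal_all_types:
  fixes G :: "('a, 'm) lo_ring_scheme" and H :: "('b, 'n) lo_ring_scheme" and T :: "'t lo_ring"
  assumes tp: "is_arch_tensor_product G H T t"
  shows "tensor_universal TYPE('k) G H T t"
  unfolding tensor_universal_def
proof (intro allI impI, elim conjE)
  fix K :: "'k lo_ring" and \<phi> assume K: "arch_l_group K" "l_bimorphism G H K \<phi>"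
  have T: "l_group T" and K': "l_group K" and t: "l_bimorphism G H T t"
    using tp K(1) by (auto simp: is_arch_tensor_product_def arch_l_group_def)
  have tc: "t a b \<in> carrier T" if "a \<in> carrier G" "b \<in> carrier H" for a b
    using t that by (auto simp: l_bimorphism_def hom_def)
  have univ: "\<exists>\<Phi>. \<Phi> \<in> l_hom T K' \<and> (\<forall>a\<in>carrier G. \<forall>b\<in>carrier H. \<phi>' a b = \<Phi> (t a b))"
    if "arch_l_group K'" "l_bimorphism G H K' \<phi>'" for K' :: "('t + ('a \<times> 'b) lword) lo_ring" and \<phi>'
    using tp that by (intro tensor_universalD(2)) (simp_all add: is_arch_tensor_product_def)
  have inj: "inj (Inr :: _ \<Rightarrow> 't + ('a \<times> 'b) lword)" by simp
  have "\<exists>\<Phi>. \<Phi> \<in> extensional (carrier T) \<and> \<Phi> \<in> l_hom T K \<and>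
        (\<forall>a\<in>carrier G. \<forall>b\<in>carrier H. \<phi> a b = \<Phi> (t a b))"
    by (rule tensor_factor[OF T tc inj univ K])
  then obtain \<Phi> where \<Phi>: "\<Phi> \<in> extensional (carrier T)"
    "\<Phi> \<in> l_hom T K" "\<forall>a\<in>carrier G. \<forall>b\<in>carrier H. \<phi> a b = \<Phi> (t a b)" by blast
  then show "\<exists>!\<Phi>. \<Phi> \<in> extensional (carrier T) \<and> \<Phi> \<in> l_hom T K \<and>
        (\<forall>a\<in>carrier G. \<forall>b\<in>carrier H. \<phi> a b = \<Phi> (t a b))"
  proof (intro ex1I[of _ \<Phi>] conjI)
    fix \<Psi> assume \<Psi>: "\<Psi> \<in> extensional (carrier T) \<and> \<Psi> \<in> l_hom T K \<and>
        (\<forall>a\<in>carrier G. \<forall>b\<in>carrier H. \<phi> a b = \<Psi> (t a b))"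
    have e: "\<Psi> (t a b) = \<Phi> (t a b)" if "a \<in> carrier G" "b \<in> carrier H" for a b
      using \<Phi>(3) \<Psi> that by metis
    show "\<Psi> = \<Phi>"
      by (rule tensor_hom_unique[OF T K' is_arch_tensor_product_gen[OF tp] tc]) (use \<Phi> \<Psi> e in simp_all)
  qed simp_all
qed

definition l_product :: "'i set \<Rightarrow> ('i \<Rightarrow> 'a lo_ring) \<Rightarrow> ('i \<Rightarrow> 'a) lo_ring" where
  "l_product I K = \<lparr> carrier = (\<Pi>\<^sub>E i\<in>I. carrier (K i)), mult = undefined, one = undefined,
     zero = (\<lambda>i\<in>I. \<zero>\<^bsub>K i\<^esub>), add = (\<lambda>x y. \<lambda>i\<in>I. x i \<oplus>\<^bsub>K i\<^esub> y i),
     lo_le = (\<lambda>x y. \<forall>i\<in>I. x i \<preceq>\<^bsub>K i\<^esub> y i) \<rparr>"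

context
  fixes I :: "'i set" and K :: "'i \<Rightarrow> 'a lo_ring"
  assumes K: "\<And>i. i \<in> I \<Longrightarrow> l_group (K i)"
begin

lemma l_product_simps:
  "x \<in> carrier (l_product I K) \<longleftrightarrow> x \<in> extensional I \<and> (\<forall>i\<in>I. x i \<in> carrier (K i))"
  "\<zero>\<^bsub>l_product I K\<^esub> = (\<lambda>i\<in>I. \<zero>\<^bsub>K i\<^esub>)"
  "x \<oplus>\<^bsub>l_product I K\<^esub> y = (\<lambda>i\<in>I. x i \<oplus>\<^bsub>K i\<^esub> y i)"
  "(x \<preceq>\<^bsub>l_product I K\<^esub> y) = (\<forall>i\<in>I. x i \<preceq>\<^bsub>K i\<^esub> y i)"
  by (auto simp: l_product_def PiE_iff)

lemma factor_abelian: "i \<in> I \<Longrightarrow> abelian_group (K i)"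
  using K by (simp add: l_group_def)

lemma factor_lattice: "i \<in> I \<Longrightarrow> lattice (ord_of (K i))"
  using K by (simp add: l_group.lattice_ord)

lemmas factor_simps = factor_abelian[THEN abelian_groupE(1)] factor_abelian[THEN abelian_groupE(2)]
  factor_abelian[THEN abelian_groupE(3)] factor_abelian[THEN abelian_groupE(4)] factor_abelian[THEN abelian_groupE(5)]

lemma factor_lattice_ops:
  assumes "i \<in> I" "x \<in> carrier (K i)" "y \<in> carrier (K i)"
  shows "x \<sqinter>\<^bsub>ord_of (K i)\<^esub> y \<in> carrier (K i)" "x \<sqinter>\<^bsub>ord_of (K i)\<^esub> y \<preceq>\<^bsub>K i\<^esub> x" "x \<sqinter>\<^bsub>ord_of (K i)\<^esub> y \<preceq>\<^bsub>K i\<^esub> y"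
    "\<lbrakk> w \<in> carrier (K i); w \<preceq>\<^bsub>K i\<^esub> x; w \<preceq>\<^bsub>K i\<^esub> y \<rbrakk> \<Longrightarrow> w \<preceq>\<^bsub>K i\<^esub> x \<sqinter>\<^bsub>ord_of (K i)\<^esub> y"
    "x \<squnion>\<^bsub>ord_of (K i)\<^esub> y \<in> carrier (K i)" "x \<preceq>\<^bsub>K i\<^esub> x \<squnion>\<^bsub>ord_of (K i)\<^esub> y" "y \<preceq>\<^bsub>K i\<^esub> x \<squnion>\<^bsub>ord_of (K i)\<^esub> y"
    "\<lbrakk> w \<in> carrier (K i); x \<preceq>\<^bsub>K i\<^esub> w; y \<preceq>\<^bsub>K i\<^esub> w \<rbrakk> \<Longrightarrow> x \<squnion>\<^bsub>ord_of (K i)\<^esub> y \<preceq>\<^bsub>K i\<^esub> w"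
proof -
  interpret l_group "K i" using K assms(1) .
  show "x \<sqinter>\<^bsub>ord_of (K i)\<^esub> y \<in> carrier (K i)" "x \<sqinter>\<^bsub>ord_of (K i)\<^esub> y \<preceq>\<^bsub>K i\<^esub> x" "x \<sqinter>\<^bsub>ord_of (K i)\<^esub> y \<preceq>\<^bsub>K i\<^esub> y"
    "x \<squnion>\<^bsub>ord_of (K i)\<^esub> y \<in> carrier (K i)" "x \<preceq>\<^bsub>K i\<^esub> x \<squnion>\<^bsub>ord_of (K i)\<^esub> y" "y \<preceq>\<^bsub>K i\<^esub> x \<squnion>\<^bsub>ord_of (K i)\<^esub> y"
    using assms by (auto simp: lat.meet_left lat.meet_right lat.join_left lat.join_right)
  show "w \<preceq>\<^bsub>K i\<^esub> x \<sqinter>\<^bsub>ord_of (K i)\<^esub> y" if "w \<in> carrier (K i)" "w \<preceq>\<^bsub>K i\<^esub> x" "w \<preceq>\<^bsub>K i\<^esub> y"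
    using that assms by (intro lat.meet_le)
  show "x \<squnion>\<^bsub>ord_of (K i)\<^esub> y \<preceq>\<^bsub>K i\<^esub> w" if "w \<in> carrier (K i)" "x \<preceq>\<^bsub>K i\<^esub> w" "y \<preceq>\<^bsub>K i\<^esub> w"
    using that assms by (intro lat.join_le)
qed

lemma factor_order:
  assumes "i \<in> I" "x \<in> carrier (K i)"
  shows "x \<preceq>\<^bsub>K i\<^esub> x"
    "\<lbrakk> y \<in> carrier (K i); x \<preceq>\<^bsub>K i\<^esub> y; y \<preceq>\<^bsub>K i\<^esub> x \<rbrakk> \<Longrightarrow> x = y"
    "\<lbrakk> y \<in> carrier (K i); z \<in> carrier (K i); x \<preceq>\<^bsub>K i\<^esub> y; y \<preceq>\<^bsub>K i\<^esub> z \<rbrakk> \<Longrightarrow> x \<preceq>\<^bsub>K i\<^esub> z"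
    "\<lbrakk> y \<in> carrier (K i); z \<in> carrier (K i); x \<preceq>\<^bsub>K i\<^esub> y \<rbrakk> \<Longrightarrow> z \<oplus>\<^bsub>K i\<^esub> x \<preceq>\<^bsub>K i\<^esub> z \<oplus>\<^bsub>K i\<^esub> y"
proof -
  interpret l_group "K i" using K assms(1) .
  show "x \<preceq>\<^bsub>K i\<^esub> x"
    "\<lbrakk> y \<in> carrier (K i); x \<preceq>\<^bsub>K i\<^esub> y; y \<preceq>\<^bsub>K i\<^esub> x \<rbrakk> \<Longrightarrow> x = y"
    "\<lbrakk> y \<in> carrier (K i); z \<in> carrier (K i); x \<preceq>\<^bsub>K i\<^esub> y; y \<preceq>\<^bsub>K i\<^esub> z \<rbrakk> \<Longrightarrow> x \<preceq>\<^bsub>K i\<^esub> z"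
    "\<lbrakk> y \<in> carrier (K i); z \<in> carrier (K i); x \<preceq>\<^bsub>K i\<^esub> y \<rbrakk> \<Longrightarrow> z \<oplus>\<^bsub>K i\<^esub> x \<preceq>\<^bsub>K i\<^esub> z \<oplus>\<^bsub>K i\<^esub> y"
    using assms(2) lat.le_antisym[of x y] lat.le_trans[of x y z] add_left_mono[of x y z] by simp_all
qed

lemma l_product_l_group: "l_group (l_product I K)"
proof (intro l_group.intro l_group_axioms.intro)
  show "abelian_group (l_product I K)"
  proof (rule abelian_groupI)
    fix x assume x: "x \<in> carrier (l_product I K)"
    then have "\<forall>i\<in>I. \<exists>u\<in>carrier (K i). u \<oplus>\<^bsub>K i\<^esub> x i = \<zero>\<^bsub>K i\<^esub>"
      by (simp add: l_product_simps abelian_groupE(6)[OF factor_abelian])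
    then obtain u where "\<forall>i\<in>I. u i \<in> carrier (K i) \<and> u i \<oplus>\<^bsub>K i\<^esub> x i = \<zero>\<^bsub>K i\<^esub>"
      by metis
    then show "\<exists>y\<in>carrier (l_product I K). y \<oplus>\<^bsub>l_product I K\<^esub> x = \<zero>\<^bsub>l_product I K\<^esub>"
      by (intro bexI[of _ "restrict u I"]) (auto simp: l_product_simps fun_eq_iff)
  next
    fix x y z assume "x \<in> carrier (l_product I K)" "y \<in> carrier (l_product I K)" "z \<in> carrier (l_product I K)"
    then show "x \<oplus>\<^bsub>l_product I K\<^esub> y \<oplus>\<^bsub>l_product I K\<^esub> z = x \<oplus>\<^bsub>l_product I K\<^esub> (y \<oplus>\<^bsub>l_product I K\<^esub> z)"
      by (simp add: l_product_simps factor_simps(3) cong: restrict_cong)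
  next
    fix x y assume "x \<in> carrier (l_product I K)" "y \<in> carrier (l_product I K)"
    then show "x \<oplus>\<^bsub>l_product I K\<^esub> y = y \<oplus>\<^bsub>l_product I K\<^esub> x"
      unfolding l_product_simps by (intro restrict_ext factor_simps(4)) simp_all
  next
    fix x assume "x \<in> carrier (l_product I K)"
    then show "\<zero>\<^bsub>l_product I K\<^esub> \<oplus>\<^bsub>l_product I K\<^esub> x = x"
      by (intro extensionalityI[of _ I]) (simp_all add: l_product_simps factor_simps(5))
  qed (simp_all add: l_product_simps factor_simps(1,2))
  show "lattice (ord_of (l_product I K))"
  proof (rule lattice_ord_ofI)
    fix x y assume xy: "x \<in> carrier (l_product I K)" "y \<in> carrier (l_product I K)"
    show "\<exists>m\<in>carrier (l_product I K). m \<preceq>\<^bsub>l_product I K\<^esub> x \<and> m \<preceq>\<^bsub>l_product I K\<^esub> y \<and>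
      (\<forall>w\<in>carrier (l_product I K). w \<preceq>\<^bsub>l_product I K\<^esub> x \<and> w \<preceq>\<^bsub>l_product I K\<^esub> y \<longrightarrow> w \<preceq>\<^bsub>l_product I K\<^esub> m)"
      by (rule bexI[of _ "\<lambda>i\<in>I. x i \<sqinter>\<^bsub>ord_of (K i)\<^esub> y i"]) (use xy in \<open>auto simp: l_product_simps factor_lattice_ops\<close>)
    show "\<exists>m\<in>carrier (l_product I K). x \<preceq>\<^bsub>l_product I K\<^esub> m \<and> y \<preceq>\<^bsub>l_product I K\<^esub> m \<and>
      (\<forall>w\<in>carrier (l_product I K). x \<preceq>\<^bsub>l_product I K\<^esub> w \<and> y \<preceq>\<^bsub>l_product I K\<^esub> w \<longrightarrow> m \<preceq>\<^bsub>l_product I K\<^esub> w)"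
      by (rule bexI[of _ "\<lambda>i\<in>I. x i \<squnion>\<^bsub>ord_of (K i)\<^esub> y i"]) (use xy in \<open>auto simp: l_product_simps factor_lattice_ops\<close>)
  next
    fix x y assume "x \<in> carrier (l_product I K)" "y \<in> carrier (l_product I K)"
      "x \<preceq>\<^bsub>l_product I K\<^esub> y" "y \<preceq>\<^bsub>l_product I K\<^esub> x"
    then show "x = y" by (intro extensionalityI[of _ I]) (auto simp: l_product_simps factor_order(2))
  next
    fix x y z assume "x \<in> carrier (l_product I K)" "y \<in> carrier (l_product I K)" "z \<in> carrier (l_product I K)"
      "x \<preceq>\<^bsub>l_product I K\<^esub> y" "y \<preceq>\<^bsub>l_product I K\<^esub> z"
    then show "x \<preceq>\<^bsub>l_product I K\<^esub> z" by (meson factor_order(3) l_product_simps)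
  qed (simp add: l_product_simps factor_order)
qed (auto simp: l_product_simps factor_order(4))

lemma l_product_meet_join:
  assumes "x \<in> carrier (l_product I K)" "y \<in> carrier (l_product I K)"
  shows "x \<sqinter>\<^bsub>ord_of (l_product I K)\<^esub> y = (\<lambda>i\<in>I. x i \<sqinter>\<^bsub>ord_of (K i)\<^esub> y i)"
    and "x \<squnion>\<^bsub>ord_of (l_product I K)\<^esub> y = (\<lambda>i\<in>I. x i \<squnion>\<^bsub>ord_of (K i)\<^esub> y i)"
proof -
  show "x \<sqinter>\<^bsub>ord_of (l_product I K)\<^esub> y = (\<lambda>i\<in>I. x i \<sqinter>\<^bsub>ord_of (K i)\<^esub> y i)"
    by (rule l_group_meet_eqI[OF l_product_l_group]) (use assms in \<open>auto simp: l_product_simps factor_lattice_ops\<close>)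
  show "x \<squnion>\<^bsub>ord_of (l_product I K)\<^esub> y = (\<lambda>i\<in>I. x i \<squnion>\<^bsub>ord_of (K i)\<^esub> y i)"
    by (rule l_group_join_eqI[OF l_product_l_group]) (use assms in \<open>auto simp: l_product_simps factor_lattice_ops\<close>)
qed

lemma l_product_proj:
  assumes "i \<in> I" shows "(\<lambda>x. x i) \<in> l_hom (l_product I K) (K i)"
  unfolding l_hom_iff[OF l_product_l_group K[OF assms]]
  using assms by (simp add: l_product_meet_join) (simp add: l_product_simps)

lemma l_product_arch:
  assumes "\<And>i. i \<in> I \<Longrightarrow> arch_l_group (K i)" shows "arch_l_group (l_product I K)"
proof (intro arch_l_group.intro arch_l_group_axioms.intro l_product_l_group)
  fix x y assume *: "x \<in> carrier (l_product I K)" "y \<in> carrier (l_product I K)"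
    "\<zero>\<^bsub>l_product I K\<^esub> \<preceq>\<^bsub>l_product I K\<^esub> x" "\<zero>\<^bsub>l_product I K\<^esub> \<preceq>\<^bsub>l_product I K\<^esub> y"
    and le: "\<And>n::nat. [n] \<cdot>\<^bsub>l_product I K\<^esub> x \<preceq>\<^bsub>l_product I K\<^esub> y"
  have n: "[n] \<cdot>\<^bsub>l_product I K\<^esub> x = (\<lambda>i\<in>I. [n] \<cdot>\<^bsub>K i\<^esub> x i)" for n :: nat
    by (induction n) (auto simp: add_pow_def l_product_simps)
  have "x i = \<zero>\<^bsub>K i\<^esub>" if "i \<in> I" for i
    using * le that by (intro arch_l_group.archimedean[OF assms, of i "x i" "y i"])
      (auto simp: l_product_simps n)
  then show "x = \<zero>\<^bsub>l_product I K\<^esub>"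
    using * by (intro extensionalityI[of _ I]) (auto simp: l_product_simps)
qed

lemma l_product_bimorphism:
  assumes "\<And>i. i \<in> I \<Longrightarrow> l_bimorphism G H (K i) (\<phi> i)"
    and "l_group G" "l_group H"
  shows "l_bimorphism G H (l_product I K) (\<lambda>a b. \<lambda>i\<in>I. \<phi> i a b)"
proof -
  have c: "(\<lambda>i\<in>I. \<phi> i a b) \<in> carrier (l_product I K)" if "a \<in> carrier G" "b \<in> carrier H" for a b
  proof -
    have "\<phi> i a b \<in> carrier (K i)" if "i \<in> I" for i
      using assms(1)[OF that] \<open>a \<in> carrier G\<close> \<open>b \<in> carrier H\<close> by (auto simp: l_bimorphism_def hom_def)
    then show ?thesis by (simp add: l_product_simps)
  qed
  have *: "lattice (ord_of (l_product I K))" "lattice (ord_of G)" "lattice (ord_of H)"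
    using l_product_l_group assms(2,3) by (auto intro: l_group.lattice_ord)
  note b = assms(1)[unfolded l_bimorphism_def lattice_hom_def join_pres_def meet_pres_def hom_def]
  show ?thesis
    unfolding l_bimorphism_def lattice_hom_def join_pres_def meet_pres_def hom_def
    using * c b by (auto simp: l_product_meet_join) (auto simp: l_product_simps fun_eq_iff)
qed

end

text \<open>
  The tensor product is the sub-\<open>\<ell>\<close>-group generated by the diagonal image of \<open>G \<times> H\<close> in the
  product of all archimedean \<open>\<ell>\<close>-groups on words over \<open>G \<times> H\<close> that receive a bimorphism.
\<close>

theorem arch_tensor_product_exists:
  fixes G :: "('a, 'm) lo_ring_scheme" and H :: "('b, 'n) lo_ring_scheme"
  assumes "l_group G" "l_group H"
  shows "\<exists>(T :: (('a \<times> 'b) lword lo_ring \<times> ('a \<Rightarrow> 'b \<Rightarrow> ('a \<times> 'b) lword) \<Rightarrow> ('a \<times> 'b) lword) lo_ring) t.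
    is_arch_tensor_product G H T t"
proof -
  define I where "I = {(K :: ('a \<times> 'b) lword lo_ring, \<phi>). arch_l_group K \<and> l_bimorphism G H K \<phi>}"
  define P where "P = l_product I fst"
  define t where "t a b = (\<lambda>i\<in>I. snd i a b)" for a b
  have I: "l_group (fst i)" "arch_l_group (fst i)" "l_bimorphism G H (fst i) (snd i)" if "i \<in> I" for i
    using that by (auto simp: I_def arch_l_group_def)
  have P: "l_group P" and Pa: "arch_l_group P"
    unfolding P_def by (rule l_product_l_group l_product_arch; use I in blast)+
  have t: "l_bimorphism G H P t"
    unfolding P_def t_def by (rule l_product_bimorphism) (use I assms in auto)
  define X where "X = (\<lambda>(a, b). t a b) ` (carrier G \<times> carrier H)"
  have X: "X \<subseteq> carrier P" using t by (auto simp: X_def l_bimorphism_def hom_def)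
  define S where "S = l_gen P X"
  have S: "l_subgroup S P" unfolding S_def by (rule l_subgroup_l_gen[OF P X])
  define T where "T = l_copy id S P"
  have i: "inj_on id S" by simp
  have tS: "t a b \<in> S" if "a \<in> carrier G" "b \<in> carrier H" for a b
    using that by (auto simp: S_def X_def intro!: l_gen.gen)
  have T: "l_group T" "arch_l_group T" and tT: "l_bimorphism G H T t"
    using l_copy_l_group[OF P S i] l_copy_arch[OF P S i Pa] l_copy_bimorphism[OF P S i t tS]
    by (simp_all add: T_def)
  have TS: "carrier T = S" by (simp add: T_def l_copy_simps[OF P S i])
  have incl: "id \<in> l_hom T P"
    by (rule l_hom_cong[OF T(1) P l_copy_incl[OF P S i, folded T_def]])
      (use inv_into_f_f[OF i] in \<open>simp add: TS\<close>)
  have "x \<in> l_gen T X" if "x \<in> S" for x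
  proof -
    note idh = incl[unfolded l_hom_iff[OF T(1) P]] l_hom_zero_neg[OF T(1) P incl]
    have SS: "\<And>x. x \<in> l_gen P X \<Longrightarrow> x \<in> carrier T" by (simp add: TS S_def)
    show ?thesis
      using that[unfolded S_def]
    proof induction
      case (gen x)
      then show ?case by (rule l_gen.gen)
    next
      case zero
      then show ?case using l_gen.zero[of T X] idh by simp
    next
      case (neg x)
      then show ?case using l_gen.neg[of x T X] idh SS by simp
    next
      case (add x y)
      then show ?case using l_gen.add[of x T X y] idh SS by simp
    next
      case (meet x y)
      then show ?case using l_gen.meet[of x T X y] idh SS by simp
    next
      case (join x y)
      then show ?case using l_gen.join[of x T X y] idh SS by simp
    qed
  qed
  moreover have "l_gen T X \<subseteq> carrier T"
  proof -
    have "X \<subseteq> carrier T" using tS by (auto simp: TS X_def)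
    then show ?thesis using l_subgroup_l_gen[OF T(1)] by (simp add: l_subgroup_def)
  qed
  ultimately have gen: "l_gen T X = carrier T" by (auto simp: TS)
  have ex: "\<exists>\<Phi>. \<Phi> \<in> l_hom T K \<and> (\<forall>a\<in>carrier G. \<forall>b\<in>carrier H. \<phi> a b = \<Phi> (t a b))"
    if "arch_l_group K" "l_bimorphism G H K \<phi>" for K :: "('a \<times> 'b) lword lo_ring" and \<phi>
  proof -
    have KI: "(K, \<phi>) \<in> I" using that by (simp add: I_def)
    have "(\<lambda>x. x (K, \<phi>)) \<in> l_hom P K"
      using l_product_proj[of I fst "(K, \<phi>)"] I(1) KI by (simp add: P_def)
    then have "(\<lambda>x. id x (K, \<phi>)) \<in> l_hom T K"
      using T(1) P I(1)[OF KI] incl by (intro l_hom_compose[of T P K id]) auto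
    then show ?thesis using KI by (intro exI[of _ "\<lambda>x. id x (K, \<phi>)"]) (simp add: t_def)
  qed
  have univ: "tensor_universal TYPE('k) G H T t"
    unfolding tensor_universal_def
  proof (intro allI impI, elim conjE)
    fix K :: "'k lo_ring" and \<phi> assume K: "arch_l_group K" "l_bimorphism G H K \<phi>"
    have K': "l_group K" using K by (simp add: arch_l_group_def)
    have tc: "t a b \<in> carrier T" if "a \<in> carrier G" "b \<in> carrier H" for a b
      using tS[OF that] by (simp add: TS)
    have inj: "inj (id :: _ \<Rightarrow> ('a \<times> 'b) lword)" by simp
    have "\<exists>\<Phi>. \<Phi> \<in> extensional (carrier T) \<and> \<Phi> \<in> l_hom T K \<and>
          (\<forall>a\<in>carrier G. \<forall>b\<in>carrier H. \<phi> a b = \<Phi> (t a b))"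
      by (rule tensor_factor[OF T(1) tc inj ex K])
    then obtain \<Phi> where \<Phi>: "\<Phi> \<in> extensional (carrier T)"
      "\<Phi> \<in> l_hom T K" "\<forall>a\<in>carrier G. \<forall>b\<in>carrier H. \<phi> a b = \<Phi> (t a b)" by blast
    then show "\<exists>!\<Phi>. \<Phi> \<in> extensional (carrier T) \<and> \<Phi> \<in> l_hom T K \<and>
          (\<forall>a\<in>carrier G. \<forall>b\<in>carrier H. \<phi> a b = \<Phi> (t a b))"
    proof (intro ex1I[of _ \<Phi>] conjI)
      fix \<Psi> assume \<Psi>: "\<Psi> \<in> extensional (carrier T) \<and> \<Psi> \<in> l_hom T K \<and>
          (\<forall>a\<in>carrier G. \<forall>b\<in>carrier H. \<phi> a b = \<Psi> (t a b))"
      have e: "\<Psi> (t a b) = \<Phi> (t a b)" if "a \<in> carrier G" "b \<in> carrier H" for a b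
        using \<Phi>(3) \<Psi> that by metis
      show "\<Psi> = \<Phi>"
        by (rule tensor_hom_unique[OF T(1) K' gen[unfolded X_def] tc]) (use \<Phi> \<Psi> e in simp_all)
    qed simp_all
  qed
  then show ?thesis using T tT by (auto simp: is_arch_tensor_product_def)
qed

end

theory Submission
  imports Defs
begin

text \<open>
  Call an additive map \<open>f\<close> on an \<open>\<ell>\<close>-group a positive orthomorphism if it is positive and \<open>x \<perp> y\<close>
  implies \<open>f x \<perp> y\<close>, where \<open>x \<perp> y\<close> means \<open>x \<sqinter> y = \<zero>\<close>. In an f-ring all multiplications by a fixed
  positive element are of this kind, and a bilinear multiplication on \<open>T\<close> with this property on both
  sides is what the f-ring axioms ask for. Let \<open>c \<otimes> d\<close> act on \<open>T\<close> by \<open>a \<otimes> b \<mapsto> ac \<otimes> bd\<close>. Once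
  these actions are known to be orthomorphisms, the universal property, applied to the \<open>\<ell>\<close>-group of
  orthomorphisms of \<open>T\<close>, extends the action from pure tensors to all of \<open>T\<close>.

  For this, differences of positive orthomorphisms of an archimedean \<open>\<ell>\<close>-group \<open>A\<close> must again form
  an archimedean \<open>\<ell>\<close>-group, with lattice operations computed pointwise on the positive cone
  (\<open>orth_arch_l_group\<close>, \<open>orth_join_meet\<close>). The point is that \<open>x \<mapsto> (P x - Q x)\<^sup>+\<close> is additive on
  positive elements, which holds because \<open>P - Q\<close> cannot be positive at \<open>x\<close> and negative at \<open>y\<close> at the
  same place (\<open>pos_orth_excess_disj\<close>): where \<open>k x \<le> n y \<le> (k + 1) x\<close>, the values of \<open>P\<close> and of \<open>Q\<close>
  at \<open>k x\<close> and \<open>n y\<close> agree up to \<open>P x\<close> and \<open>Q x\<close>; so \<open>n\<close> times the overlap is bounded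
  independently of \<open>n\<close>, and the overlap vanishes in an archimedean group.

  The second point is that an \<open>\<ell>\<close>-homomorphism \<open>S\<close> of \<open>T\<close> with \<open>S (a \<otimes> b) = \<pi> a \<otimes> b\<close> inherits the
  orthomorphism property from \<open>\<pi>\<close> (\<open>pos_orth_tensor\<close>), although disjoint elements of \<open>T\<close> need not
  come from disjoint elements of the factors. Every \<open>x\<close> in \<open>T\<close> is a lattice-group word in finitely
  many \<open>a\<^sub>i \<otimes> b\<^sub>i\<close>. Where \<open>p A \<le> n \<pi> A \<le> (p + 1) A\<close> for a common bound \<open>A\<close> of the \<open>a\<^sub>i\<close>, the
  maps \<open>n S\<close> and \<open>p\<close> differ by at most \<open>a\<^sub>i \<otimes> b\<^sub>i\<close> on each generator, hence by at most some
  \<open>A \<otimes> B\<close> at \<open>x\<close> (\<open>controlled_ex\<close>). So \<open>n S x\<close> stays below \<open>A \<otimes> B\<close> where \<open>x\<close> vanishes. Where no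
  \<open>p \<le> n\<^sup>2\<close> will do, because \<open>\<pi> A > n A\<close>, it stays below \<open>\<pi> (\<pi> A) \<otimes> B\<close>. Once more the archimedean
  property gives \<open>S x \<perp> y\<close> for \<open>x \<perp> y\<close>.

  "Where" and "at the same place" could be read in the totally ordered quotients by minimal prime
  subgroups. Here they refer to the quotient by the polar of an element \<open>e > \<zero>\<close>: an inequality
  holds near \<open>e\<close> if it holds up to a summand disjoint from \<open>e\<close>. Of two opposite inequalities one
  can be forced by shrinking \<open>e\<close>, which replaces the choice of a prime by finitely many
  decisions.
\<close>

section \<open>Disjointness and truncated differences in abelian \<open>\<ell>\<close>-groups\<close>

definition disj :: "('a, 'm) lo_ring_scheme \<Rightarrow> 'a \<Rightarrow> 'a \<Rightarrow> bool" (infix "\<perp>\<index>" 50) where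
  "x \<perp>\<^bsub>G\<^esub> y \<longleftrightarrow> x \<sqinter>\<^bsub>ord_of G\<^esub> y = \<zero>\<^bsub>G\<^esub>"

text \<open>
  The positive part of \<open>u - v\<close>. Both lattice operations can be expressed by it (\<open>join_eq\<close>,
  \<open>meet_eq\<close>), and it is the least \<open>w \<ge> \<zero>\<close> with \<open>u \<le> v + w\<close>.
\<close>

definition excess :: "('a, 'm) lo_ring_scheme \<Rightarrow> 'a \<Rightarrow> 'a \<Rightarrow> 'a" where
  "excess G u v = (u \<ominus>\<^bsub>G\<^esub> v) \<squnion>\<^bsub>ord_of G\<^esub> \<zero>\<^bsub>G\<^esub>"

text \<open>
  For \<open>e \<ge> \<zero>\<close> this is \<open>u \<le> v\<close> in the quotient by the polar of \<open>e\<close>. The form without absolute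
  values and without quotients makes it visibly stable under addition and under orthomorphisms.
\<close>

definition near :: "('a, 'm) lo_ring_scheme \<Rightarrow> 'a \<Rightarrow> 'a \<Rightarrow> 'a \<Rightarrow> bool" where
  "near G e u v \<longleftrightarrow> (\<exists>w\<in>carrier G. w \<perp>\<^bsub>G\<^esub> e \<and> u \<preceq>\<^bsub>G\<^esub> v \<oplus>\<^bsub>G\<^esub> w)"

context l_group
begin

lemma le_refl [simp]: "x \<in> carrier G \<Longrightarrow> x \<preceq> x"
  by (rule lat.le_refl)

lemma le_trans:
  "\<lbrakk> x \<preceq> y; y \<preceq> z; x \<in> carrier G; y \<in> carrier G; z \<in> carrier G \<rbrakk> \<Longrightarrow> x \<preceq> z"
  by (rule lat.le_trans)

lemma add_le_cancel_left [simp]: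
  assumes "x \<in> carrier G" "y \<in> carrier G" "z \<in> carrier G"
  shows "z \<oplus> x \<preceq> z \<oplus> y \<longleftrightarrow> x \<preceq> y"
proof
  assume "z \<oplus> x \<preceq> z \<oplus> y"
  from add_left_mono[OF _ _ _ this, of "\<ominus> z"] show "x \<preceq> y"
    using assms by (simp add: l_neg flip: a_assoc)
qed (use assms in \<open>simp add: add_left_mono\<close>)

lemma add_le_cancel_right [simp]:
  assumes "x \<in> carrier G" "y \<in> carrier G" "z \<in> carrier G"
  shows "x \<oplus> z \<preceq> y \<oplus> z \<longleftrightarrow> x \<preceq> y"
  using add_le_cancel_left[OF assms] by (simp add: assms a_comm)

lemma add_mono:
  assumes "a \<preceq> b" "c \<preceq> d" "a \<in> carrier G" "b \<in> carrier G" "c \<in> carrier G" "d \<in> carrier G"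
  shows "a \<oplus> c \<preceq> b \<oplus> d"
  using assms by (intro le_trans[of "a \<oplus> c" "b \<oplus> c" "b \<oplus> d"]) simp_all

lemma le_add_nonneg [simp]:
  assumes "x \<in> carrier G" "w \<in> carrier G" "\<zero> \<preceq> w"
  shows "x \<preceq> x \<oplus> w" "x \<preceq> w \<oplus> x"
  using add_mono[of x x \<zero> w] add_mono[of \<zero> w x x] assms by simp_all

lemma add_nonneg [simp]: "\<lbrakk> \<zero> \<preceq> x; \<zero> \<preceq> y; x \<in> carrier G; y \<in> carrier G \<rbrakk> \<Longrightarrow> \<zero> \<preceq> x \<oplus> y"
  using add_mono[of \<zero> x \<zero> y] by simp

lemma add_minus_cancel: "\<lbrakk> x \<in> carrier G; y \<in> carrier G \<rbrakk> \<Longrightarrow> y \<oplus> (x \<ominus> y) = x"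
  by (simp add: minus_eq a_lcomm[of y x] r_neg)

lemma minus_le_iff:
  assumes "u \<in> carrier G" "v \<in> carrier G" "w \<in> carrier G"
  shows "u \<ominus> v \<preceq> w \<longleftrightarrow> u \<preceq> v \<oplus> w"
  using add_le_cancel_left[of "u \<ominus> v" w v] assms by (simp add: add_minus_cancel)

lemma le_minus_iff:
  assumes "u \<in> carrier G" "v \<in> carrier G" "w \<in> carrier G"
  shows "w \<preceq> u \<ominus> v \<longleftrightarrow> v \<oplus> w \<preceq> u"
  using add_le_cancel_left[of w "u \<ominus> v" v] assms by (simp add: add_minus_cancel)

lemma nonneg_le_minus_iff: "\<lbrakk> u \<in> carrier G; v \<in> carrier G \<rbrakk> \<Longrightarrow> \<zero> \<preceq> u \<ominus> v \<longleftrightarrow> v \<preceq> u"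
  using le_minus_iff[of u v \<zero>] by simp

lemma smult_closed [simp]: "x \<in> carrier G \<Longrightarrow> [(n::nat)] \<cdot> x \<in> carrier G"
  by (rule add.nat_pow_closed)

lemma smult_0 [simp]: "[(0::nat)] \<cdot> x = \<zero>"
  by (rule add.nat_pow_0)

lemma smult_Suc: "x \<in> carrier G \<Longrightarrow> [Suc n] \<cdot> x = [n] \<cdot> x \<oplus> x"
  by (rule add.nat_pow_Suc)

lemma smult_add: "\<lbrakk> x \<in> carrier G; y \<in> carrier G \<rbrakk> \<Longrightarrow> [(n::nat)] \<cdot> (x \<oplus> y) = [n] \<cdot> x \<oplus> [n] \<cdot> y"
  by (rule add.nat_pow_distrib)

lemma smult_nonneg [simp]: "\<lbrakk> \<zero> \<preceq> x; x \<in> carrier G \<rbrakk> \<Longrightarrow> \<zero> \<preceq> [(n::nat)] \<cdot> x"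
  by (induction n) (simp_all add: smult_Suc add_nonneg)

lemma smult_mono: "\<lbrakk> x \<preceq> y; x \<in> carrier G; y \<in> carrier G \<rbrakk> \<Longrightarrow> [(n::nat)] \<cdot> x \<preceq> [n] \<cdot> y"
  by (induction n) (simp_all add: smult_Suc add_mono)

lemma smult_smult: "x \<in> carrier G \<Longrightarrow> [(m::nat)] \<cdot> ([(n::nat)] \<cdot> x) = [(m * n)] \<cdot> x"
  by (simp add: add.nat_pow_pow mult.commute)

lemma excess_closed [simp]: "\<lbrakk> u \<in> carrier G; v \<in> carrier G \<rbrakk> \<Longrightarrow> excess G u v \<in> carrier G"
  by (simp add: excess_def)

lemma excess_nonneg [simp]: "\<lbrakk> u \<in> carrier G; v \<in> carrier G \<rbrakk> \<Longrightarrow> \<zero> \<preceq> excess G u v"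
  by (simp add: excess_def lat.join_right)

lemma le_add_excess: "\<lbrakk> u \<in> carrier G; v \<in> carrier G \<rbrakk> \<Longrightarrow> u \<preceq> v \<oplus> excess G u v"
  by (simp add: excess_def lat.join_left flip: minus_le_iff)

lemma excess_least:
  "\<lbrakk> u \<preceq> v \<oplus> w; \<zero> \<preceq> w; u \<in> carrier G; v \<in> carrier G; w \<in> carrier G \<rbrakk> \<Longrightarrow> excess G u v \<preceq> w"
  unfolding excess_def by (rule lat.join_le) (simp_all add: minus_le_iff)

text \<open>
  This equation and \<open>meet_eq\<close> turn statements about lattice homomorphisms into
  statements about \<open>excess\<close>, which are easier to combine with additivity.
\<close>

lemma join_eq:
  assumes u: "u \<in> carrier G" and v: "v \<in> carrier G"
  shows "u \<squnion>\<^bsub>ord_of G\<^esub> v = v \<oplus> excess G u v"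
proof (rule l_group_join_eqI[OF l_group_axioms])
  fix w assume w: "w \<in> carrier G" "u \<preceq> w" "v \<preceq> w"
  have "excess G u v \<preceq> w \<ominus> v"
    by (rule excess_least) (use u v w in \<open>simp_all add: add_minus_cancel nonneg_le_minus_iff\<close>)
  then show "v \<oplus> excess G u v \<preceq> w" using u v w by (simp add: le_minus_iff)
qed (use u v in \<open>simp_all add: le_add_excess le_add_nonneg excess_nonneg\<close>)

lemma add_excess_commute:
  assumes "u \<in> carrier G" "v \<in> carrier G"
  shows "v \<oplus> excess G u v = u \<oplus> excess G v u"
proof -
  have "u \<squnion>\<^bsub>ord_of G\<^esub> v = v \<squnion>\<^bsub>ord_of G\<^esub> u" using join_comm .
  then show ?thesis by (simp add: join_eq assms)
qed

lemma meet_eq: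
  assumes u: "u \<in> carrier G" and v: "v \<in> carrier G"
  shows "u \<sqinter>\<^bsub>ord_of G\<^esub> v = u \<ominus> excess G u v"
proof (rule l_group_meet_eqI[OF l_group_axioms])
  fix w assume w: "w \<in> carrier G" "w \<preceq> u" "w \<preceq> v"
  have "u \<preceq> v \<oplus> (u \<ominus> w)"
    using add_mono[of w v "u \<ominus> w" "u \<ominus> w"] u v w by (simp add: add_minus_cancel)
  then have "excess G u v \<preceq> u \<ominus> w"
    using u v w by (intro excess_least) (simp_all add: nonneg_le_minus_iff)
  then show "w \<preceq> u \<ominus> excess G u v" using u v w by (simp add: le_minus_iff a_comm)
next
  show "u \<ominus> excess G u v \<preceq> v"
    using le_add_excess[OF u v] u v by (simp add: minus_le_iff a_comm)
qed (use u v in \<open>simp_all add: minus_le_iff le_add_nonneg excess_nonneg\<close>)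

lemma meet_add_excess:
  "\<lbrakk> u \<in> carrier G; v \<in> carrier G \<rbrakk> \<Longrightarrow> (u \<sqinter>\<^bsub>ord_of G\<^esub> v) \<oplus> excess G u v = u"
  by (simp add: meet_eq minus_eq a_assoc l_neg)

text \<open>
  Inductions over lattice-group words can skip meets.
\<close>

lemma meet_eq_neg_join:
  assumes u: "u \<in> carrier G" and v: "v \<in> carrier G"
  shows "u \<sqinter>\<^bsub>ord_of G\<^esub> v = \<ominus> (\<ominus> u \<squnion>\<^bsub>ord_of G\<^esub> \<ominus> v)"
proof -
  have "\<ominus> v \<ominus> \<ominus> u = u \<ominus> v" using u v by (simp add: minus_eq a_comm[of "\<ominus> v" u])
  then have "excess G (\<ominus> v) (\<ominus> u) = excess G u v" by (simp add: excess_def)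
  then have "\<ominus> v \<squnion>\<^bsub>ord_of G\<^esub> \<ominus> u = \<ominus> u \<oplus> excess G u v"
    using u v by (simp add: join_eq)
  then have "\<ominus> u \<squnion>\<^bsub>ord_of G\<^esub> \<ominus> v = \<ominus> (u \<ominus> excess G u v)"
    using u v by (simp only: join_comm[of _ "\<ominus> u"]) (simp add: minus_eq minus_add)
  then show ?thesis using u v by (simp add: meet_eq)
qed

lemma disj_commute: "x \<perp> y \<longleftrightarrow> y \<perp> x"
  by (simp add: disj_def meet_comm)

lemma disjI:
  assumes "x \<in> carrier G" "y \<in> carrier G" "\<zero> \<preceq> x" "\<zero> \<preceq> y"
    and "\<And>m. \<lbrakk> m \<in> carrier G; \<zero> \<preceq> m; m \<preceq> x; m \<preceq> y \<rbrakk> \<Longrightarrow> m \<preceq> \<zero>"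
  shows "x \<perp> y"
proof -
  let ?m = "x \<sqinter>\<^bsub>ord_of G\<^esub> y"
  have "\<zero> \<preceq> ?m" by (rule lat.meet_le) (use assms in auto)
  moreover have "?m \<preceq> \<zero>"
    by (rule assms(5)) (use assms calculation in \<open>auto simp: lat.meet_left lat.meet_right\<close>)
  ultimately show ?thesis unfolding disj_def using assms by (intro lat.le_antisym) auto
qed

lemma disj_nonneg:
  assumes "x \<perp> y" "x \<in> carrier G" "y \<in> carrier G"
  shows "\<zero> \<preceq> x" "\<zero> \<preceq> y"
  using assms lat.meet_left[of x y] lat.meet_right[of x y] by (simp_all add: disj_def)

lemma disjD:
  assumes "x \<perp> y" "m \<preceq> x" "m \<preceq> y" "x \<in> carrier G" "y \<in> carrier G" "m \<in> carrier G"
  shows "m \<preceq> \<zero>"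
  using assms lat.meet_le[of m x y] by (simp add: disj_def)

lemma disj_self: "\<lbrakk> x \<perp> x; x \<in> carrier G \<rbrakk> \<Longrightarrow> x = \<zero>"
  using disjD[of x x x] disj_nonneg[of x x] lat.le_antisym[of x \<zero>] by simp

lemma disj_mono:
  assumes "x \<perp> y" "\<zero> \<preceq> x'" "x' \<preceq> x" "x \<in> carrier G" "y \<in> carrier G" "x' \<in> carrier G"
  shows "x' \<perp> y"
proof (rule disjI)
  fix m assume m: "m \<in> carrier G" "m \<preceq> x'" "m \<preceq> y"
  have "m \<preceq> x" using m assms by (intro le_trans[of m x' x]) auto
  then show "m \<preceq> \<zero>" using m assms disjD[of x y m] by blast
qed (use assms disj_nonneg[of x y] in auto)

lemma disj_mono_right:
  "\<lbrakk> x \<perp> y; \<zero> \<preceq> y'; y' \<preceq> y; x \<in> carrier G; y \<in> carrier G; y' \<in> carrier G \<rbrakk> \<Longrightarrow> x \<perp> y'"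
  using disj_mono[of y x y'] by (simp add: disj_commute)

lemma zero_disj: "\<lbrakk> \<zero> \<preceq> e; e \<in> carrier G \<rbrakk> \<Longrightarrow> \<zero> \<perp> e"
  by (rule disjI) auto

text \<open>
  If \<open>m \<le> x + y\<close> and \<open>m \<le> e\<close>, the part of \<open>m\<close> that exceeds \<open>x\<close> lies below both \<open>y\<close> and \<open>e\<close>, so it
  vanishes and \<open>m \<le> x\<close>.
\<close>

lemma disj_add:
  assumes "x \<perp> e" "y \<perp> e" "x \<in> carrier G" "y \<in> carrier G" "e \<in> carrier G"
  shows "x \<oplus> y \<perp> e"
proof (rule disjI)
  fix m assume m: "m \<in> carrier G" "\<zero> \<preceq> m" "m \<preceq> x \<oplus> y" "m \<preceq> e"
  note pos = disj_nonneg[OF assms(1,3,5)] disj_nonneg[OF assms(2,4,5)]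
  have "excess G m x \<preceq> y" by (rule excess_least) (use assms m pos in auto)
  moreover have "excess G m x \<preceq> m" by (rule excess_least) (use assms m pos in \<open>auto simp: le_add_nonneg\<close>)
  then have "excess G m x \<preceq> e" using le_trans[of "excess G m x" m e] assms m by auto
  ultimately have "excess G m x \<preceq> \<zero>" using disjD[OF assms(2)] assms m by auto
  then have "excess G m x = \<zero>" using assms m by (intro lat.le_antisym) (auto simp: excess_nonneg)
  then have "m \<preceq> x" using le_add_excess[of m x] assms m by simp
  then show "m \<preceq> \<zero>" using disjD[OF assms(1)] assms m by auto
qed (use assms disj_nonneg[of x e] disj_nonneg[of y e] in \<open>auto intro: add_nonneg\<close>)

lemma disj_smult:
  assumes "x \<perp> e" "x \<in> carrier G" "e \<in> carrier G"
  shows "[(n::nat)] \<cdot> x \<perp> e"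
  by (induction n) (use assms disj_nonneg[OF assms] in \<open>auto simp: smult_Suc zero_disj disj_add\<close>)

text \<open>
  A common lower bound \<open>m\<close> could be subtracted from both sides of \<open>v + (u - v)\<^sup>+ = u + (v - u)\<^sup>+\<close>,
  contradicting that \<open>(u - v)\<^sup>+\<close> is least.
\<close>

lemma excess_disj:
  assumes u: "u \<in> carrier G" and v: "v \<in> carrier G"
  shows "excess G u v \<perp> excess G v u"
proof (rule disjI)
  fix m assume m: "m \<in> carrier G" "\<zero> \<preceq> m" "m \<preceq> excess G u v" "m \<preceq> excess G v u"
  have "v \<oplus> (excess G u v \<ominus> m) = u \<oplus> (excess G v u \<ominus> m)"
    using add_excess_commute[OF u v] u v m by (simp add: minus_eq flip: a_assoc)
  moreover have "u \<preceq> u \<oplus> (excess G v u \<ominus> m)"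
    using u v m by (intro le_add_nonneg) (auto simp: nonneg_le_minus_iff)
  ultimately have "excess G u v \<preceq> excess G u v \<ominus> m"
    using u v m by (intro excess_least) (auto simp: nonneg_le_minus_iff)
  then have "m \<oplus> excess G u v \<preceq> \<zero> \<oplus> excess G u v" using u v m by (simp add: le_minus_iff)
  then show "m \<preceq> \<zero>" using u v m by (subst (asm) add_le_cancel_right) auto
qed (use u v in \<open>auto simp: excess_nonneg\<close>)

text \<open>
  A difference has only one decomposition into disjoint parts. All later computations of positive
  parts (of multiples, of images under homomorphisms, of sums) go through this.
\<close>

lemma excess_eqI:
  assumes eq: "u \<oplus> q = v \<oplus> p" and "p \<perp> q"
    and c: "u \<in> carrier G" "v \<in> carrier G" "p \<in> carrier G" "q \<in> carrier G"
  shows "excess G u v = p"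
proof (rule lat.le_antisym)
  note pos = disj_nonneg[OF assms(2) c(3,4)]
  have "u \<preceq> u \<oplus> q" using c pos by (simp add: le_add_nonneg)
  then show le: "excess G u v \<preceq> p" using c pos eq by (intro excess_least) auto
  define r where "r = p \<ominus> excess G u v"
  have r: "r \<in> carrier G" "\<zero> \<preceq> r" "p = excess G u v \<oplus> r"
    using c le by (simp_all add: r_def nonneg_le_minus_iff add_minus_cancel)
  have "r \<preceq> p" using r c by (simp add: r(3) le_add_nonneg excess_nonneg)
  moreover have "v \<oplus> p \<preceq> v \<oplus> excess G u v \<oplus> q"
    using le_add_excess[of u v] add_mono[of u "v \<oplus> excess G u v" q q] c by (simp flip: eq)
  then have "v \<oplus> excess G u v \<oplus> r \<preceq> v \<oplus> excess G u v \<oplus> q"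
    using r c by (simp add: a_assoc)
  then have "r \<preceq> q" using c r by simp
  ultimately have "r \<preceq> \<zero>" using disjD[OF assms(2)] c r by auto
  then show "p \<preceq> excess G u v"
    using add_mono[of "excess G u v" "excess G u v" r \<zero>] c r by simp
qed (use c in auto)

lemma excess_zero: "\<lbrakk> u \<preceq> v; u \<in> carrier G; v \<in> carrier G \<rbrakk> \<Longrightarrow> excess G u v = \<zero>"
  by (intro lat.le_antisym excess_least) (auto simp: excess_nonneg)

lemma excess_nonneg_zero: "\<lbrakk> \<zero> \<preceq> u; u \<in> carrier G \<rbrakk> \<Longrightarrow> excess G u \<zero> = u"
  by (rule excess_eqI[of _ \<zero>]) (auto simp: zero_disj disj_commute[of u])

lemma decompose: "x \<in> carrier G \<Longrightarrow> x = excess G x \<zero> \<ominus> excess G \<zero> x"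
  using add_excess_commute[of x \<zero>] by (simp add: minus_eq a_assoc r_neg)

lemma smult_excess:
  assumes "u \<in> carrier G" "v \<in> carrier G"
  shows "excess G ([(n::nat)] \<cdot> u) ([n] \<cdot> v) = [n] \<cdot> excess G u v"
proof (rule excess_eqI)
  show "[n] \<cdot> u \<oplus> [n] \<cdot> excess G v u = [n] \<cdot> v \<oplus> [n] \<cdot> excess G u v"
    using add_excess_commute[OF assms] assms by (simp flip: smult_add)
  show "[n] \<cdot> excess G u v \<perp> [n] \<cdot> excess G v u"
    using excess_disj assms by (intro disj_smult) (auto simp: disj_commute[of "excess G u v"] intro: disj_smult)
qed (use assms in auto)

section \<open>Comparison modulo the polar of an element\<close>

lemma nearI: "\<lbrakk> u \<preceq> v \<oplus> w; w \<perp> e; w \<in> carrier G \<rbrakk> \<Longrightarrow> near G e u v"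
  by (auto simp: near_def)

lemma near_of_le:
  "\<lbrakk> u \<preceq> v; \<zero> \<preceq> e; e \<in> carrier G; u \<in> carrier G; v \<in> carrier G \<rbrakk> \<Longrightarrow> near G e u v"
  by (rule nearI[of _ _ \<zero>]) (auto simp: zero_disj)

lemma near_trans:
  assumes "near G e u v" "near G e v w"
    and c: "e \<in> carrier G" "u \<in> carrier G" "v \<in> carrier G" "w \<in> carrier G"
  shows "near G e u w"
proof -
  obtain p q where p: "p \<in> carrier G" "p \<perp> e" "u \<preceq> v \<oplus> p"
    and q: "q \<in> carrier G" "q \<perp> e" "v \<preceq> w \<oplus> q"
    using assms by (auto simp: near_def)
  have "v \<oplus> p \<preceq> w \<oplus> (q \<oplus> p)"
    using add_mono[of v "w \<oplus> q" p p] p q c by (simp add: a_assoc)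
  then have "u \<preceq> w \<oplus> (q \<oplus> p)" using le_trans[of u "v \<oplus> p"] p q c by auto
  then show ?thesis using p q c by (intro nearI[of _ _ "q \<oplus> p"] disj_add) auto
qed

lemma near_le_trans:
  "\<lbrakk> near G e u v; v \<preceq> w; \<zero> \<preceq> e; e \<in> carrier G; u \<in> carrier G; v \<in> carrier G; w \<in> carrier G \<rbrakk>
    \<Longrightarrow> near G e u w"
  using near_trans[OF _ near_of_le] by blast

lemma le_near_trans:
  "\<lbrakk> u \<preceq> v; near G e v w; \<zero> \<preceq> e; e \<in> carrier G; u \<in> carrier G; v \<in> carrier G; w \<in> carrier G \<rbrakk>
    \<Longrightarrow> near G e u w"
  using near_trans[OF near_of_le] by blast

lemma near_disj_zero:
  "\<lbrakk> x \<perp> e; x \<in> carrier G \<rbrakk> \<Longrightarrow> near G e x \<zero>"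
  by (rule nearI[of _ _ x]) auto

lemma near_add:
  assumes "near G e u v" "near G e u' v'"
    and c: "e \<in> carrier G" "u \<in> carrier G" "v \<in> carrier G" "u' \<in> carrier G" "v' \<in> carrier G"
  shows "near G e (u \<oplus> u') (v \<oplus> v')"
proof -
  obtain p q where p: "p \<in> carrier G" "p \<perp> e" "u \<preceq> v \<oplus> p"
    and q: "q \<in> carrier G" "q \<perp> e" "u' \<preceq> v' \<oplus> q"
    using assms by (auto simp: near_def)
  have "u \<oplus> u' \<preceq> (v \<oplus> p) \<oplus> (v' \<oplus> q)" by (rule add_mono) (use p q c in auto)
  also have "(v \<oplus> p) \<oplus> (v' \<oplus> q) = (v \<oplus> v') \<oplus> (p \<oplus> q)" using p q c by (simp add: a_ac)
  finally show ?thesis using p q c by (intro nearI[of _ _ "p \<oplus> q"] disj_add) auto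
qed

lemma near_smult:
  assumes "near G e u v" "\<zero> \<preceq> e" "e \<in> carrier G" "u \<in> carrier G" "v \<in> carrier G"
  shows "near G e ([(n::nat)] \<cdot> u) ([n] \<cdot> v)"
  by (induction n) (use assms in \<open>auto simp: smult_Suc near_of_le near_add\<close>)

lemma near_cancel:
  assumes "near G e (w \<oplus> u) (w \<oplus> v)" "w \<in> carrier G" "u \<in> carrier G" "v \<in> carrier G"
  shows "near G e u v"
  using assms by (auto simp: near_def a_assoc)

lemma near_mono:
  assumes "near G e u v" "e' \<preceq> e" "\<zero> \<preceq> e'" "e \<in> carrier G" "e' \<in> carrier G"
  shows "near G e' u v"
  using assms by (auto simp: near_def intro: disj_mono_right)

lemma near_neg:
  assumes "near G e u v" "u \<in> carrier G" "v \<in> carrier G"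
  shows "near G e (\<ominus> v) (\<ominus> u)"
proof -
  obtain p where p: "p \<in> carrier G" "p \<perp> e" "u \<preceq> v \<oplus> p" using assms by (auto simp: near_def)
  have "u \<oplus> \<ominus> v \<preceq> u \<oplus> (\<ominus> u \<oplus> p)"
    using p assms minus_le_iff[of u v p] by (simp add: r_neg2 minus_eq del: add_le_cancel_left)
  then have "\<ominus> v \<preceq> \<ominus> u \<oplus> p" using p assms by simp
  then show ?thesis using p by (intro nearI) auto
qed

lemma near_join_least:
  assumes "near G e u w" "near G e v w"
    and c: "e \<in> carrier G" "u \<in> carrier G" "v \<in> carrier G" "w \<in> carrier G"
  shows "near G e (u \<squnion>\<^bsub>ord_of G\<^esub> v) w"
proof -
  obtain p q where p: "p \<in> carrier G" "p \<perp> e" "u \<preceq> w \<oplus> p"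
    and q: "q \<in> carrier G" "q \<perp> e" "v \<preceq> w \<oplus> q"
    using assms by (auto simp: near_def)
  note pos = disj_nonneg(1)[OF p(2,1) c(1)] disj_nonneg(1)[OF q(2,1) c(1)]
  have "w \<oplus> p \<preceq> w \<oplus> (p \<oplus> q)" "w \<oplus> q \<preceq> w \<oplus> (p \<oplus> q)"
    using p q c pos by (simp_all add: le_add_nonneg)
  then have "u \<squnion>\<^bsub>ord_of G\<^esub> v \<preceq> w \<oplus> (p \<oplus> q)"
    using p q c le_trans[of u "w \<oplus> p" "w \<oplus> (p \<oplus> q)"] le_trans[of v "w \<oplus> q" "w \<oplus> (p \<oplus> q)"]
    by (intro lat.join_le) auto
  then show ?thesis using p q c by (intro nearI[of _ _ "p \<oplus> q"] disj_add) auto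
qed

text \<open>
  The next lemmas decide comparisons. If \<open>e\<close> is disjoint from \<open>(u - v)\<^sup>+\<close> then \<open>u \<le> v\<close> near \<open>e\<close>;
  otherwise some nonzero \<open>e' \<le> e\<close> lies below \<open>(u - v)\<^sup>+\<close> (\<open>nonzero_lower_bound\<close>), and near such
  \<open>e'\<close> the opposite inequality \<open>v \<le> u\<close> holds.
\<close>

lemma near_of_disj_excess:
  assumes "e \<perp> excess G u v" "u \<in> carrier G" "v \<in> carrier G"
  shows "near G e u v"
  using assms by (intro nearI[of _ _ "excess G u v"]) (auto simp: disj_commute[of e] le_add_excess)

lemma near_of_le_excess:
  assumes "e \<preceq> excess G u v" "\<zero> \<preceq> e" "e \<in> carrier G" "u \<in> carrier G" "v \<in> carrier G"
  shows "near G e v u"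
proof (rule near_mono)
  show "near G (excess G u v) v u"
    using assms by (intro near_of_disj_excess excess_disj) auto
qed (use assms in auto)

text \<open>
  An inequality cannot hold near an element that lies below the amount by which it fails.
\<close>

lemma below_excess_near_zero:
  assumes "near G e u v" "e \<preceq> excess G u v" "\<zero> \<preceq> e" "e \<in> carrier G" "u \<in> carrier G" "v \<in> carrier G"
  shows "e = \<zero>"
proof -
  obtain p where p: "p \<in> carrier G" "p \<perp> e" "u \<preceq> v \<oplus> p" using assms by (auto simp: near_def)
  have "excess G u v \<preceq> p" using p assms disj_nonneg[of p e] by (intro excess_least) auto
  then have "e \<preceq> p" using le_trans[of e "excess G u v" p] assms p by auto
  then have "e \<perp> e" using p assms disj_mono[of p e e] by auto
  then show ?thesis using assms disj_self by auto
qed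

lemma nonzero_lower_bound:
  assumes "\<zero> \<preceq> e" "e \<noteq> \<zero>" "e \<in> carrier G" "w \<in> carrier G" "\<zero> \<preceq> w" "\<not> e \<perp> w"
  obtains e' where "e' \<in> carrier G" "\<zero> \<preceq> e'" "e' \<noteq> \<zero>" "e' \<preceq> e" "e' \<preceq> w"
  by (rule that[of "e \<sqinter>\<^bsub>ord_of G\<^esub> w"])
    (use assms in \<open>auto simp: disj_def lat.meet_left lat.meet_right intro!: lat.meet_le\<close>)

end

section \<open>Lattice-group homomorphisms and positive orthomorphisms\<close>

locale l_homomorphism = G: l_group G + K: l_group K
  for G :: "('a, 'm) lo_ring_scheme" and K :: "('b, 'n) lo_ring_scheme" +
  fixes f assumes l_hom: "f \<in> l_hom G K"
begin

lemmas l_homE = l_hom[unfolded l_hom_iff[OF G.l_group_axioms K.l_group_axioms]]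

lemma closed [simp]: "x \<in> carrier G \<Longrightarrow> f x \<in> carrier K"
  using l_homE by blast

lemma add: "\<lbrakk> x \<in> carrier G; y \<in> carrier G \<rbrakk> \<Longrightarrow> f (x \<oplus>\<^bsub>G\<^esub> y) = f x \<oplus>\<^bsub>K\<^esub> f y"
  using l_homE by blast

lemma join: "\<lbrakk> x \<in> carrier G; y \<in> carrier G \<rbrakk> \<Longrightarrow> f (x \<squnion>\<^bsub>ord_of G\<^esub> y) = f x \<squnion>\<^bsub>ord_of K\<^esub> f y"
  using l_homE by blast

lemma meet: "\<lbrakk> x \<in> carrier G; y \<in> carrier G \<rbrakk> \<Longrightarrow> f (x \<sqinter>\<^bsub>ord_of G\<^esub> y) = f x \<sqinter>\<^bsub>ord_of K\<^esub> f y"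
  using l_homE by blast

lemma zero [simp]: "f \<zero>\<^bsub>G\<^esub> = \<zero>\<^bsub>K\<^esub>"
  by (rule l_hom_zero_neg(1)[OF G.l_group_axioms K.l_group_axioms l_hom])

lemma neg: "x \<in> carrier G \<Longrightarrow> f (\<ominus>\<^bsub>G\<^esub> x) = \<ominus>\<^bsub>K\<^esub> f x"
  by (rule l_hom_zero_neg(2)[OF G.l_group_axioms K.l_group_axioms l_hom])

lemma minus: "\<lbrakk> x \<in> carrier G; y \<in> carrier G \<rbrakk> \<Longrightarrow> f (x \<ominus>\<^bsub>G\<^esub> y) = f x \<ominus>\<^bsub>K\<^esub> f y"
  by (simp add: G.minus_eq K.minus_eq add neg)

lemma excess: "\<lbrakk> x \<in> carrier G; y \<in> carrier G \<rbrakk> \<Longrightarrow> f (excess G x y) = excess K (f x) (f y)"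
  by (simp add: excess_def join minus)

lemma disj: "\<lbrakk> x \<perp>\<^bsub>G\<^esub> y; x \<in> carrier G; y \<in> carrier G \<rbrakk> \<Longrightarrow> f x \<perp>\<^bsub>K\<^esub> f y"
  by (simp add: disj_def flip: meet)

lemma nonneg: "\<lbrakk> \<zero>\<^bsub>G\<^esub> \<preceq>\<^bsub>G\<^esub> x; x \<in> carrier G \<rbrakk> \<Longrightarrow> \<zero>\<^bsub>K\<^esub> \<preceq>\<^bsub>K\<^esub> f x"
  using excess[of x "\<zero>\<^bsub>G\<^esub>"] K.excess_nonneg[of "f x" "\<zero>\<^bsub>K\<^esub>"] by (simp add: G.excess_nonneg_zero)

lemma mono: "\<lbrakk> x \<preceq>\<^bsub>G\<^esub> y; x \<in> carrier G; y \<in> carrier G \<rbrakk> \<Longrightarrow> f x \<preceq>\<^bsub>K\<^esub> f y"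
  using nonneg[of "y \<ominus>\<^bsub>G\<^esub> x"] by (simp add: G.nonneg_le_minus_iff K.nonneg_le_minus_iff minus)

lemma smult: "x \<in> carrier G \<Longrightarrow> f ([(n::nat)] \<cdot>\<^bsub>G\<^esub> x) = [n] \<cdot>\<^bsub>K\<^esub> f x"
  by (induction n) (simp_all add: G.smult_Suc K.smult_Suc add)

end

lemma l_homomorphismI: "\<lbrakk> l_group G; l_group K; f \<in> l_hom G K \<rbrakk> \<Longrightarrow> l_homomorphism G K f"
  by (simp add: l_homomorphism_def l_homomorphism_axioms_def)

text \<open>
  Such a map sends the disjoint decomposition of \<open>x - y\<close> to one of \<open>f x - f y\<close>, so it commutes with
  \<open>excess\<close> and hence with both lattice operations.
\<close>

lemma l_hom_of_disjoint_preserving: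
  assumes "l_group G" "l_group K"
    and cl: "\<And>x. x \<in> carrier G \<Longrightarrow> f x \<in> carrier K"
    and add: "\<And>x y. \<lbrakk> x \<in> carrier G; y \<in> carrier G \<rbrakk> \<Longrightarrow> f (x \<oplus>\<^bsub>G\<^esub> y) = f x \<oplus>\<^bsub>K\<^esub> f y"
    and disj: "\<And>x y. \<lbrakk> x \<in> carrier G; y \<in> carrier G; x \<perp>\<^bsub>G\<^esub> y \<rbrakk> \<Longrightarrow> f x \<perp>\<^bsub>K\<^esub> f y"
  shows "f \<in> l_hom G K"
proof -
  interpret G: l_group G by fact
  interpret K: l_group K by fact
  have ex: "excess K (f x) (f y) = f (excess G x y)" if "x \<in> carrier G" "y \<in> carrier G" for x y
    by (rule K.excess_eqI[of _ "f (excess G y x)"])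
      (use that G.add_excess_commute[of x y] in \<open>auto simp: cl disj G.excess_disj simp flip: add\<close>)
  have "f (x \<squnion>\<^bsub>ord_of G\<^esub> y) = f x \<squnion>\<^bsub>ord_of K\<^esub> f y" if "x \<in> carrier G" "y \<in> carrier G" for x y
    using that by (simp add: G.join_eq K.join_eq add cl ex)
  moreover have "f (x \<sqinter>\<^bsub>ord_of G\<^esub> y) = f x \<sqinter>\<^bsub>ord_of K\<^esub> f y" if "x \<in> carrier G" "y \<in> carrier G" for x y
  proof -
    have "f (x \<sqinter>\<^bsub>ord_of G\<^esub> y) \<oplus>\<^bsub>K\<^esub> f (excess G x y) = (f x \<sqinter>\<^bsub>ord_of K\<^esub> f y) \<oplus>\<^bsub>K\<^esub> f (excess G x y)"
      using that K.meet_add_excess[of "f x" "f y"] by (simp add: G.meet_add_excess cl ex flip: add)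
    then show ?thesis using that cl by (subst (asm) K.add.right_cancel) auto
  qed
  ultimately show ?thesis using assms by (simp add: l_hom_iff)
qed

text \<open>
  A positive additive map with the last property preserves every polar and so acts on the quotient by
  each of them, which is what \<open>near_pos_orth\<close> expresses.
\<close>

definition pos_orth :: "('a, 'm) lo_ring_scheme \<Rightarrow> ('a \<Rightarrow> 'a) \<Rightarrow> bool" where
  "pos_orth G f \<longleftrightarrow> (\<forall>x\<in>carrier G. f x \<in> carrier G) \<and>
     (\<forall>x\<in>carrier G. \<forall>y\<in>carrier G. f (x \<oplus>\<^bsub>G\<^esub> y) = f x \<oplus>\<^bsub>G\<^esub> f y) \<and>
     (\<forall>x\<in>carrier G. \<zero>\<^bsub>G\<^esub> \<preceq>\<^bsub>G\<^esub> x \<longrightarrow> \<zero>\<^bsub>G\<^esub> \<preceq>\<^bsub>G\<^esub> f x) \<and>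
     (\<forall>x\<in>carrier G. \<forall>y\<in>carrier G. x \<perp>\<^bsub>G\<^esub> y \<longrightarrow> f x \<perp>\<^bsub>G\<^esub> y)"

context l_group
begin

text \<open>
  Applying \<open>f\<close> first to one and then to the other of two disjoint elements keeps them disjoint.
\<close>

lemma pos_orth_l_hom: "pos_orth G f \<Longrightarrow> f \<in> l_hom G G"
  by (rule l_hom_of_disjoint_preserving[OF l_group_axioms l_group_axioms])
    (auto simp: pos_orth_def disj_commute)

lemma pos_orth_l_homomorphism: "pos_orth G f \<Longrightarrow> l_homomorphism G G f"
  by (intro l_homomorphismI l_group_axioms pos_orth_l_hom)

lemma pos_orth_disj: "\<lbrakk> pos_orth G f; x \<perp> y; x \<in> carrier G; y \<in> carrier G \<rbrakk> \<Longrightarrow> f x \<perp> y"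
  by (simp add: pos_orth_def)

lemma pos_orth_zero: "pos_orth G (\<lambda>x. \<zero>)"
  using disj_nonneg(2) by (auto simp: pos_orth_def zero_disj)

lemma pos_orth_id: "pos_orth G (\<lambda>x. x)"
  by (auto simp: pos_orth_def)

lemma pos_orth_add: "pos_orth G f \<Longrightarrow> pos_orth G g \<Longrightarrow> pos_orth G (\<lambda>x. f x \<oplus> g x)"
  by (auto simp: pos_orth_def add_nonneg disj_add a_ac)

lemma pos_orth_compose: "pos_orth G f \<Longrightarrow> pos_orth G g \<Longrightarrow> pos_orth G (\<lambda>x. f (g x))"
  by (auto simp: pos_orth_def)

lemma pos_orth_smult: "pos_orth G f \<Longrightarrow> pos_orth G (\<lambda>x. [(n::nat)] \<cdot> f x)"
  by (auto simp: pos_orth_def smult_add smult_nonneg disj_smult)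

lemma pos_orth_dominated:
  assumes f: "pos_orth G f" and cl: "\<And>x. x \<in> carrier G \<Longrightarrow> g x \<in> carrier G"
    and add: "\<And>x y. \<lbrakk> x \<in> carrier G; y \<in> carrier G \<rbrakk> \<Longrightarrow> g (x \<oplus> y) = g x \<oplus> g y"
    and le: "\<And>x. \<lbrakk> x \<in> carrier G; \<zero> \<preceq> x \<rbrakk> \<Longrightarrow> \<zero> \<preceq> g x \<and> g x \<preceq> f x"
  shows "pos_orth G g"
  unfolding pos_orth_def
proof (intro conjI ballI impI)
  fix x y assume xy: "x \<in> carrier G" "y \<in> carrier G" "x \<perp> y"
  then have "\<zero> \<preceq> x" using disj_nonneg(1) by blast
  then show "g x \<perp> y" using xy le[of x] cl f by (intro disj_mono[of "f x" y "g x"]) (auto simp: pos_orth_def)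
qed (use cl add le in auto)

lemma near_pos_orth:
  assumes "near G e u v" "pos_orth G f" "e \<in> carrier G" "u \<in> carrier G" "v \<in> carrier G"
  shows "near G e (f u) (f v)"
proof -
  interpret f: l_homomorphism G G f using assms by (simp add: pos_orth_l_homomorphism)
  obtain p where p: "p \<in> carrier G" "p \<perp> e" "u \<preceq> v \<oplus> p" using assms by (auto simp: near_def)
  have "f u \<preceq> f v \<oplus> f p" using f.mono[OF p(3)] p assms by (simp add: f.add)
  then show ?thesis using p assms by (intro nearI[of _ _ "f p"]) (auto simp: pos_orth_disj)
qed

end

section \<open>Sign coherence of a difference of orthomorphisms\<close>

text \<open>
  Used to locate an integer \<open>k\<close> between a lower condition \<open>U\<close> and an upper condition \<open>V\<close>, such as
  \<open>k x \<le> n y\<close> and \<open>n y \<le> (k + 1) x\<close>, while the element \<open>e\<close> near which they hold shrinks. Either the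
  upper condition holds, or after shrinking \<open>e\<close> the lower one holds for \<open>k + 1\<close>.
\<close>

lemma bounded_search:
  fixes U V :: "nat \<Rightarrow> 'e \<Rightarrow> bool"
  assumes "ok e" "U 0 e"
    and step: "\<And>k e. \<lbrakk> ok e; U k e; \<not> V k e \<rbrakk> \<Longrightarrow> \<exists>e'. ok e' \<and> U (Suc k) e'"
  shows "\<exists>k\<le>m. \<exists>e'. ok e' \<and> U k e' \<and> (V k e' \<or> k = m)"
proof (induction m)
  case (Suc m)
  then obtain k e' where "k \<le> m" "ok e'" "U k e'" "V k e' \<or> k = m" by blast
  then show ?case using step[of e' k] by (cases "V k e'") (auto intro: le_SucI)
qed (use assms in blast)

context arch_l_group
begin

text \<open>
  To prove \<open>z = \<zero>\<close> it is enough that each \<open>n z\<close> is dominated by a fixed \<open>v\<close> near arbitrarily small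
  elements: the amount \<open>e\<close> by which \<open>n z\<close> exceeds \<open>v\<close> is then zero.
\<close>

lemma archimedean_near:
  assumes c: "z \<in> carrier G" "v \<in> carrier G" and pos: "\<zero> \<preceq> z" "\<zero> \<preceq> v"
    and near: "\<And>n e. \<lbrakk> e \<in> carrier G; \<zero> \<preceq> e; e \<noteq> \<zero>; e \<preceq> [(n::nat)] \<cdot> z \<rbrakk>
      \<Longrightarrow> \<exists>e'\<in>carrier G. \<zero> \<preceq> e' \<and> e' \<noteq> \<zero> \<and> e' \<preceq> e \<and> near G e' ([n] \<cdot> z) v"
  shows "z = \<zero>"
proof (rule archimedean[of z v])
  fix n :: nat
  define e where "e = excess G ([n] \<cdot> z) v"
  have e: "e \<in> carrier G" "\<zero> \<preceq> e" using c by (auto simp: e_def excess_nonneg)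
  have "e = \<zero>"
  proof (rule ccontr)
    assume "e \<noteq> \<zero>"
    moreover have "e \<preceq> [n] \<cdot> z"
      unfolding e_def using c pos by (intro excess_least) (auto simp: le_add_nonneg smult_nonneg)
    ultimately obtain e' where e': "e' \<in> carrier G" "\<zero> \<preceq> e'" "e' \<noteq> \<zero>" "e' \<preceq> e" "near G e' ([n] \<cdot> z) v"
      using near[of e n] e by blast
    then show False using below_excess_near_zero[of e' "[n] \<cdot> z" v] c by (auto simp: e_def)
  qed
  then show "[n] \<cdot> z \<preceq> v" using le_add_excess[of "[n] \<cdot> z" v] c by (simp add: e_def)
qed (use c pos in auto)

text \<open>
  Let \<open>z\<close> be the meet in question, so that near any \<open>e \<le> n z\<close> one has \<open>Q x \<le> P x\<close> and
  \<open>z + P y \<le> Q y\<close>. If \<open>n x \<le> y\<close> near \<open>e\<close>, then \<open>n z \<le> n P x \<le> P y\<close>. Otherwise \<open>y \<le> n x\<close> near a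
  smaller element, and \<open>n y\<close> can be enclosed between \<open>k x\<close> and \<open>(k + 1) x\<close> for some \<open>k \<le> n\<^sup>2\<close>. Since
  \<open>P y\<close> and \<open>Q y\<close> are then known up to \<open>P x / n\<close> and \<open>Q x / n\<close>, the two inequalities can only hold
  together if \<open>n z \<le> Q x\<close>. In both cases \<open>n z \<le> P y + Q x\<close>.
\<close>

lemma pos_orth_excess_disj:
  assumes P: "pos_orth G P" and Q: "pos_orth G Q"
    and x: "x \<in> carrier G" "\<zero> \<preceq> x" and y: "y \<in> carrier G" "\<zero> \<preceq> y"
  shows "excess G (P x) (Q x) \<perp> excess G (Q y) (P y)"
proof -
  interpret P: l_homomorphism G G P using P by (rule pos_orth_l_homomorphism)
  interpret Q: l_homomorphism G G Q using Q by (rule pos_orth_l_homomorphism)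
  define p q where "p = excess G (P x) (Q x)" and "q = excess G (Q y) (P y)"
  define z where "z = p \<sqinter>\<^bsub>ord_of G\<^esub> q"
  have pq: "p \<in> carrier G" "\<zero> \<preceq> p" "q \<in> carrier G" "\<zero> \<preceq> q"
    using x y by (auto simp: p_def q_def excess_nonneg)
  have z: "z \<in> carrier G" "\<zero> \<preceq> z" "z \<preceq> p" "z \<preceq> q"
    using pq by (auto simp: z_def lat.meet_left lat.meet_right intro: lat.meet_le)
  note c = x y pq z
  have "z = \<zero>"
  proof (rule archimedean_near)
    show "P y \<oplus> Q x \<in> carrier G" "\<zero> \<preceq> P y \<oplus> Q x"
      using c by (auto intro!: add_nonneg P.nonneg Q.nonneg)
    fix n :: nat and e assume e: "e \<in> carrier G" "\<zero> \<preceq> e" "e \<noteq> \<zero>" "e \<preceq> [n] \<cdot> z"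
    \<comment> \<open>What is disjoint from one of the two elements \<open>p\<close>, \<open>q\<close> above \<open>z\<close> is negligible near \<open>e\<close>.\<close>
    have disj: "w \<perp> e'" if "w \<perp> r" "z \<preceq> r" "e' \<preceq> e" "\<zero> \<preceq> e'" "r \<in> carrier G" "w \<in> carrier G" "e' \<in> carrier G"
      for w r e'
    proof -
      have "e' \<preceq> [n] \<cdot> r"
        by (rule le_trans[OF le_trans[OF that(3) e(4)] smult_mono[OF that(2)]]) (use that e z in auto)
      moreover have "[n] \<cdot> r \<perp> w" using that by (intro disj_smult) (auto simp: disj_commute[of r])
      ultimately show ?thesis using that disj_mono[of "[n] \<cdot> r" w e'] by (simp add: disj_commute[of w])
    qed
    show "\<exists>e'\<in>carrier G. \<zero> \<preceq> e' \<and> e' \<noteq> \<zero> \<and> e' \<preceq> e \<and> near G e' ([n] \<cdot> z) (P y \<oplus> Q x)"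
    proof (cases "e \<perp> excess G ([n] \<cdot> x) y")
      case True
      then have "near G e ([n] \<cdot> x) y" using c e by (intro near_of_disj_excess) auto
      then have "near G e ([n] \<cdot> P x) (P y)"
        using near_pos_orth[OF _ P, of e "[n] \<cdot> x" y] c e by (simp add: P.smult)
      moreover have "p \<preceq> P x"
        unfolding p_def using c by (intro excess_least) (auto intro!: le_add_nonneg P.nonneg Q.nonneg)
      then have "z \<preceq> P x" using le_trans[of z p "P x"] c by auto
      then have "[n] \<cdot> z \<preceq> [n] \<cdot> P x" using c by (intro smult_mono) auto
      moreover have "P y \<preceq> P y \<oplus> Q x" using c by (auto intro!: le_add_nonneg Q.nonneg)
      ultimately have "near G e ([n] \<cdot> z) (P y \<oplus> Q x)"
        using c e le_near_trans[of "[n] \<cdot> z" "[n] \<cdot> P x" e "P y"] near_le_trans[of e "[n] \<cdot> z" "P y" "P y \<oplus> Q x"]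
        by auto
      then show ?thesis using e by auto
    next
      case False
      obtain e1 where e1: "e1 \<in> carrier G" "\<zero> \<preceq> e1" "e1 \<noteq> \<zero>" "e1 \<preceq> e" "e1 \<preceq> excess G ([n] \<cdot> x) y"
        by (rule nonzero_lower_bound[OF e(2,3,1) _ _ False]) (use c in \<open>auto simp: excess_nonneg\<close>)
      have yx: "near G e1 y ([n] \<cdot> x)" using e1 c by (intro near_of_le_excess) auto
      define ok where "ok e' \<longleftrightarrow> e' \<in> carrier G \<and> \<zero> \<preceq> e' \<and> e' \<noteq> \<zero> \<and> e' \<preceq> e1" for e'
      \<comment> \<open>The bound \<open>n\<^sup>2\<close> suffices because \<open>n y \<le> n (n x)\<close> near \<open>e1\<close>.\<close>
      have "\<exists>k\<le>n * n. \<exists>e'. ok e' \<and> near G e' ([k] \<cdot> x) ([n] \<cdot> y) \<and>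
          (near G e' ([n] \<cdot> y) ([Suc k] \<cdot> x) \<or> k = n * n)"
      proof (rule bounded_search)
        show "ok e1" using e1 by (simp add: ok_def)
        show "near G e1 ([(0::nat)] \<cdot> x) ([n] \<cdot> y)" using e1 c by (auto intro!: near_of_le smult_nonneg)
      next
        fix k e' assume e': "ok e'" "\<not> near G e' ([n] \<cdot> y) ([Suc k] \<cdot> x)"
        then have "\<not> e' \<perp> excess G ([n] \<cdot> y) ([Suc k] \<cdot> x)"
          using near_of_disj_excess c by (auto simp: ok_def)
        then obtain e'' where e'': "e'' \<in> carrier G" "\<zero> \<preceq> e''" "e'' \<noteq> \<zero>" "e'' \<preceq> e'"
            "e'' \<preceq> excess G ([n] \<cdot> y) ([Suc k] \<cdot> x)"
          using nonzero_lower_bound[of e' "excess G ([n] \<cdot> y) ([Suc k] \<cdot> x)"] e' c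
          by (auto simp: ok_def excess_nonneg)
        then have "ok e''" using e' e1 le_trans[of e'' e' e1] by (auto simp: ok_def)
        moreover have "near G e'' ([Suc k] \<cdot> x) ([n] \<cdot> y)" using e'' c by (intro near_of_le_excess) auto
        ultimately show "\<exists>e'. ok e' \<and> near G e' ([Suc k] \<cdot> x) ([n] \<cdot> y)" by blast
      qed
      then obtain k e' where k: "ok e'" "near G e' ([k] \<cdot> x) ([n] \<cdot> y)"
        "near G e' ([n] \<cdot> y) ([Suc k] \<cdot> x) \<or> k = n * n" by blast
      have e': "e' \<in> carrier G" "\<zero> \<preceq> e'" "e' \<noteq> \<zero>" "e' \<preceq> e1" "e' \<preceq> e"
        using k(1) le_trans[of e' e1 e] e1 e by (auto simp: ok_def)
      have up: "near G e' ([n] \<cdot> y) ([Suc k] \<cdot> x)"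
      proof (cases "k = n * n")
        case True
        have "near G e' y ([n] \<cdot> x)" using near_mono[OF yx] e' e1 by auto
        then have "near G e' ([n] \<cdot> y) ([k] \<cdot> x)"
          using near_smult[of e' y "[n] \<cdot> x" n] e' c by (simp add: smult_smult True)
        then show ?thesis
          using e' c by (elim near_le_trans) (auto simp: smult_Suc le_add_nonneg)
      qed (use k in auto)
      have Qx: "near G e' (Q x) (P x)"
        using c e' disj[of "excess G (Q x) (P x)" p e']
        by (intro near_of_disj_excess) (auto simp: p_def excess_disj disj_commute)
      have zy: "near G e' (z \<oplus> P y) (Q y)"
      proof (rule nearI)
        have "z \<oplus> P y \<preceq> P y \<oplus> q" using c by (simp add: a_comm[of "P y"])
        then show "z \<oplus> P y \<preceq> Q y \<oplus> excess G (P y) (Q y)"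
          using add_excess_commute[of "P y" "Q y"] c by (simp add: q_def)
        show "excess G (P y) (Q y) \<perp> e'"
          by (rule disj[of _ q e']) (use c e' in \<open>auto simp: q_def excess_disj\<close>)
      qed (use c in auto)
      (* Near e': n z + k P x \<le> n z + n P y \<le> n Q y \<le> (k + 1) Q x \<le> k P x + Q x; then cancel k P x. *)
      have 1: "near G e' ([n] \<cdot> z \<oplus> [k] \<cdot> P x) ([n] \<cdot> z \<oplus> [n] \<cdot> P y)"
        using near_add[OF near_of_le near_pos_orth[OF k(2) P], of "[n] \<cdot> z" "[n] \<cdot> z"] c e' by (simp add: P.smult)
      have 2: "near G e' ([n] \<cdot> z \<oplus> [n] \<cdot> P y) ([n] \<cdot> Q y)"
        using near_smult[OF zy, of n] c e' by (simp add: smult_add)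
      have 3: "near G e' ([n] \<cdot> Q y) ([k] \<cdot> Q x \<oplus> Q x)"
        using near_pos_orth[OF up Q] c e' by (simp add: Q.smult smult_Suc Q.add)
      have 4: "near G e' ([k] \<cdot> Q x \<oplus> Q x) ([k] \<cdot> P x \<oplus> Q x)"
        using near_add[OF near_smult[OF Qx] near_of_le, of "Q x" "Q x" k] c e' by simp
      have "near G e' ([n] \<cdot> z \<oplus> [k] \<cdot> P x) ([k] \<cdot> P x \<oplus> Q x)"
        by (rule near_trans[OF near_trans[OF near_trans[OF 1 2] 3] 4]) (use c e' in auto)
      then have "near G e' ([n] \<cdot> z) (Q x)"
        using c e' near_cancel[of e' "[k] \<cdot> P x" "[n] \<cdot> z" "Q x"] by (simp add: a_comm[of "[n] \<cdot> z"])
      then have "near G e' ([n] \<cdot> z) (P y \<oplus> Q x)"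
        using c e' by (elim near_le_trans) (auto intro!: le_add_nonneg P.nonneg)
      then show ?thesis using e' by auto
    qed
  qed (use z in auto)
  then show ?thesis by (simp add: disj_def z_def p_def q_def)
qed

text \<open>
  By sign coherence the positive parts at \<open>x\<close> and \<open>y\<close> are disjoint from both negative parts, so their
  sum is the positive part at \<open>x + y\<close>.
\<close>

lemma pos_orth_excess_add:
  assumes P: "pos_orth G P" and Q: "pos_orth G Q"
    and x: "x \<in> carrier G" "\<zero> \<preceq> x" and y: "y \<in> carrier G" "\<zero> \<preceq> y"
  shows "excess G (P (x \<oplus> y)) (Q (x \<oplus> y)) = excess G (P x) (Q x) \<oplus> excess G (P y) (Q y)"
proof -
  interpret P: l_homomorphism G G P using P by (rule pos_orth_l_homomorphism)
  interpret Q: l_homomorphism G G Q using Q by (rule pos_orth_l_homomorphism)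
  let ?p = "\<lambda>x. excess G (P x) (Q x)" and ?q = "\<lambda>x. excess G (Q x) (P x)"
  have eq: "P u \<oplus> ?q u = Q u \<oplus> ?p u" if "u \<in> carrier G" for u
    using add_excess_commute[of "P u" "Q u"] that by simp
  have "P (x \<oplus> y) \<oplus> (?q x \<oplus> ?q y) = (P x \<oplus> ?q x) \<oplus> (P y \<oplus> ?q y)"
    using x y by (simp add: P.add a_ac)
  also have "\<dots> = Q (x \<oplus> y) \<oplus> (?p x \<oplus> ?p y)"
    using x y by (simp add: Q.add a_ac eq)
  finally show ?thesis
  proof (rule excess_eqI)
    have "?p u \<perp> ?q v" if "u \<in> {x, y}" "v \<in> {x, y}" for u v
      using pos_orth_excess_disj[OF P Q] x y that by auto
    then have "?q x \<oplus> ?q y \<perp> ?p x" "?q x \<oplus> ?q y \<perp> ?p y"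
      using x y by (auto intro!: disj_add simp: disj_commute[of "?q _"])
    then show "?p x \<oplus> ?p y \<perp> ?q x \<oplus> ?q y"
      using x y by (intro disj_add) (auto simp: disj_commute[of "?p _"])
  qed (use x y in auto)
qed

text \<open>
  The form used for the tensor product: an inequality \<open>P y \<le> Q y\<close> that holds near some element passes
  down to all \<open>x\<close> between \<open>\<zero>\<close> and \<open>y\<close>.
\<close>

lemma pos_orth_excess_mono:
  assumes P: "pos_orth G P" and Q: "pos_orth G Q"
    and x: "x \<in> carrier G" "\<zero> \<preceq> x" and y: "y \<in> carrier G" "x \<preceq> y"
  shows "excess G (P x) (Q x) \<preceq> excess G (P y) (Q y)"
proof -
  have c: "P u \<in> carrier G" "Q u \<in> carrier G" if "u \<in> carrier G" for u
    using that P Q by (auto simp: pos_orth_def)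
  have "excess G (P (x \<oplus> (y \<ominus> x))) (Q (x \<oplus> (y \<ominus> x))) =
      excess G (P x) (Q x) \<oplus> excess G (P (y \<ominus> x)) (Q (y \<ominus> x))"
    using x y by (intro pos_orth_excess_add P Q) (auto simp: nonneg_le_minus_iff)
  then show ?thesis using x y c by (simp add: add_minus_cancel le_add_nonneg excess_nonneg)
qed

end

section \<open>Orthomorphisms of one factor act on the tensor product\<close>

text \<open>
  The universal property enters only later, to produce maps on \<open>T\<close>. Bounds and comparisons of given
  maps rest on the fact that \<open>T\<close> is generated by pure tensors.
\<close>

locale l_tensor = G: arch_l_group G + H: arch_l_group H + T: arch_l_group T
  for G :: "('a, 'm) lo_ring_scheme" and H :: "('b, 'n) lo_ring_scheme" and T :: "('t, 'o) lo_ring_scheme" +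
  fixes t :: "'a \<Rightarrow> 'b \<Rightarrow> 't"
  assumes bimorphism: "l_bimorphism G H T t"
    and generated: "carrier T \<subseteq> l_gen T ((\<lambda>(a, b). t a b) ` (carrier G \<times> carrier H))"
begin

definition pos_G where "pos_G = {a \<in> carrier G. \<zero>\<^bsub>G\<^esub> \<preceq>\<^bsub>G\<^esub> a}"
definition pos_H where "pos_H = {b \<in> carrier H. \<zero>\<^bsub>H\<^esub> \<preceq>\<^bsub>H\<^esub> b}"

lemma mem_pos [simp]:
  "a \<in> pos_G \<longleftrightarrow> a \<in> carrier G \<and> \<zero>\<^bsub>G\<^esub> \<preceq>\<^bsub>G\<^esub> a"
  "b \<in> pos_H \<longleftrightarrow> b \<in> carrier H \<and> \<zero>\<^bsub>H\<^esub> \<preceq>\<^bsub>H\<^esub> b"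
  by (simp_all add: pos_G_def pos_H_def)

lemma t_hom:
  shows "a \<in> carrier G \<Longrightarrow> (\<lambda>b. t a b) \<in> hom (add_monoid H) (add_monoid T)"
    and "b \<in> carrier H \<Longrightarrow> (\<lambda>a. t a b) \<in> hom (add_monoid G) (add_monoid T)"
    and "a \<in> pos_G \<Longrightarrow> lattice_hom (ord_of H) (ord_of T) (\<lambda>b. t a b)"
    and "b \<in> pos_H \<Longrightarrow> lattice_hom (ord_of G) (ord_of T) (\<lambda>a. t a b)"
  using bimorphism unfolding l_bimorphism_def pos_G_def pos_H_def by blast+

lemma t_closed [simp]: "\<lbrakk> a \<in> carrier G; b \<in> carrier H \<rbrakk> \<Longrightarrow> t a b \<in> carrier T"
  using hom_in_carrier[OF t_hom(1)] by simp

lemma t_add: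
  "\<lbrakk> a \<in> carrier G; a' \<in> carrier G; b \<in> carrier H \<rbrakk> \<Longrightarrow> t (a \<oplus>\<^bsub>G\<^esub> a') b = t a b \<oplus>\<^bsub>T\<^esub> t a' b"
  "\<lbrakk> a \<in> carrier G; b \<in> carrier H; b' \<in> carrier H \<rbrakk> \<Longrightarrow> t a (b \<oplus>\<^bsub>H\<^esub> b') = t a b \<oplus>\<^bsub>T\<^esub> t a b'"
  using hom_mult[OF t_hom(2)] hom_mult[OF t_hom(1)] by simp_all

lemma hom_left: "b \<in> pos_H \<Longrightarrow> l_homomorphism G T (\<lambda>a. t a b)"
  using t_hom(2,4)
  by (simp add: l_homomorphism_def l_homomorphism_axioms_def l_hom_def G.l_group_axioms T.l_group_axioms)

lemma hom_right: "a \<in> pos_G \<Longrightarrow> l_homomorphism H T (\<lambda>b. t a b)"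
  using t_hom(1,3)
  by (simp add: l_homomorphism_def l_homomorphism_axioms_def l_hom_def H.l_group_axioms T.l_group_axioms)

lemma t_nonneg [simp]: "\<lbrakk> a \<in> pos_G; b \<in> pos_H \<rbrakk> \<Longrightarrow> \<zero>\<^bsub>T\<^esub> \<preceq>\<^bsub>T\<^esub> t a b"
  using l_homomorphism.nonneg[OF hom_left, of b a] by simp

lemma t_mono_left: "\<lbrakk> a \<preceq>\<^bsub>G\<^esub> a'; a \<in> carrier G; a' \<in> carrier G; b \<in> pos_H \<rbrakk> \<Longrightarrow> t a b \<preceq>\<^bsub>T\<^esub> t a' b"
  using l_homomorphism.mono[OF hom_left, of b a a'] by simp

lemma t_mono_right: "\<lbrakk> b \<preceq>\<^bsub>H\<^esub> b'; a \<in> pos_G; b \<in> carrier H; b' \<in> carrier H \<rbrakk> \<Longrightarrow> t a b \<preceq>\<^bsub>T\<^esub> t a b'"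
  using l_homomorphism.mono[OF hom_right, of a b b'] by simp

lemma add_pos_G: "\<lbrakk> a \<in> pos_G; a' \<in> pos_G \<rbrakk> \<Longrightarrow> a \<oplus>\<^bsub>G\<^esub> a' \<in> pos_G"
  and add_pos_H: "\<lbrakk> b \<in> pos_H; b' \<in> pos_H \<rbrakk> \<Longrightarrow> b \<oplus>\<^bsub>H\<^esub> b' \<in> pos_H"
  and zero_pos: "\<zero>\<^bsub>G\<^esub> \<in> pos_G" "\<zero>\<^bsub>H\<^esub> \<in> pos_H"
  by (auto simp: pos_G_def pos_H_def G.add_nonneg H.add_nonneg)

lemma t_mono:
  assumes "a \<preceq>\<^bsub>G\<^esub> a'" "b \<preceq>\<^bsub>H\<^esub> b'" "a \<in> carrier G" "a' \<in> pos_G" "b \<in> pos_H" "b' \<in> carrier H"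
  shows "t a b \<preceq>\<^bsub>T\<^esub> t a' b'"
  using T.le_trans[OF t_mono_left[OF assms(1) _ _ assms(5)] t_mono_right[OF assms(2,4)]] assms by simp

text \<open>
  The second arguments may differ: both tensors lie below the ones with \<open>b + b'\<close>.
\<close>

lemma t_disj:
  assumes "v \<perp>\<^bsub>G\<^esub> w" "v \<in> carrier G" "w \<in> carrier G" "b \<in> pos_H" "b' \<in> pos_H"
  shows "t v b \<perp>\<^bsub>T\<^esub> t w b'"
proof -
  let ?b = "b \<oplus>\<^bsub>H\<^esub> b'"
  have pos: "v \<in> pos_G" "w \<in> pos_G" using G.disj_nonneg[OF assms(1-3)] assms by (auto simp: pos_G_def)
  have b: "?b \<in> pos_H" using assms by (simp add: add_pos_H)
  have "t v ?b \<perp>\<^bsub>T\<^esub> t w ?b" using assms l_homomorphism.disj[OF hom_left[OF b]] by simp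
  moreover have "t v b \<preceq>\<^bsub>T\<^esub> t v ?b" "t w b' \<preceq>\<^bsub>T\<^esub> t w ?b"
    using pos assms b by (auto intro!: t_mono_right H.le_add_nonneg)
  ultimately show ?thesis
    using T.disj_mono[of "t v ?b" "t w ?b" "t v b"] T.disj_mono_right[of "t v b" "t w ?b" "t w b'"]
      pos assms b t_nonneg by simp
qed

lemma t_smult: "\<lbrakk> a \<in> carrier G; b \<in> pos_H \<rbrakk> \<Longrightarrow> t ([(n::nat)] \<cdot>\<^bsub>G\<^esub> a) b = [n] \<cdot>\<^bsub>T\<^esub> t a b"
  using l_homomorphism.smult[OF hom_left] by simp

text \<open>
  Tensors of positive elements suffice as generators, because \<open>t\<close> is biadditive and every element is a
  difference of positive ones. As \<open>t a\<close> need not preserve the order unless \<open>a \<ge> \<zero>\<close>, this restriction is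
  what makes agreement and bounds checkable on generators.
\<close>

lemma tensor_induct [consumes 1, case_names gen zero neg add join]:
  assumes "x \<in> carrier T"
    and gen: "\<And>a b. \<lbrakk> a \<in> pos_G; b \<in> pos_H \<rbrakk> \<Longrightarrow> Q (t a b)"
    and zero: "Q \<zero>\<^bsub>T\<^esub>"
    and neg: "\<And>x. \<lbrakk> x \<in> carrier T; Q x \<rbrakk> \<Longrightarrow> Q (\<ominus>\<^bsub>T\<^esub> x)"
    and add: "\<And>x y. \<lbrakk> x \<in> carrier T; y \<in> carrier T; Q x; Q y \<rbrakk> \<Longrightarrow> Q (x \<oplus>\<^bsub>T\<^esub> y)"
    and join: "\<And>x y. \<lbrakk> x \<in> carrier T; y \<in> carrier T; Q x; Q y \<rbrakk> \<Longrightarrow> Q (x \<squnion>\<^bsub>ord_of T\<^esub> y)"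
  shows "Q x"
proof -
  have diff: "Q (x \<ominus>\<^bsub>T\<^esub> y)" if "x \<in> carrier T" "y \<in> carrier T" "Q x" "Q y" for x y
    using that by (simp add: T.minus_eq add neg)
  have left: "Q (t a b)" if a: "a \<in> carrier G" and b: "b \<in> pos_H" for a b
  proof -
    let ?p = "excess G a \<zero>\<^bsub>G\<^esub>" and ?q = "excess G \<zero>\<^bsub>G\<^esub> a"
    have "?p \<in> pos_G" "?q \<in> pos_G" using a by (auto simp: pos_G_def G.excess_nonneg)
    then have "Q (t ?p b \<ominus>\<^bsub>T\<^esub> t ?q b)" using b by (intro diff gen) auto
    also have "t ?p b \<ominus>\<^bsub>T\<^esub> t ?q b = t (?p \<ominus>\<^bsub>G\<^esub> ?q) b"
      using a l_homomorphism.minus[OF hom_left[OF b]] by simp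
    finally show ?thesis using G.decompose[OF a] by simp
  qed
  have all: "Q (t a b)" if a: "a \<in> carrier G" and b: "b \<in> carrier H" for a b
  proof -
    interpret h: group_hom "add_monoid H" "add_monoid T" "\<lambda>b. t a b"
      using t_hom(1)[OF a] H.a_group T.a_group by (simp add: group_hom_def group_hom_axioms_def)
    let ?p = "excess H b \<zero>\<^bsub>H\<^esub>" and ?q = "excess H \<zero>\<^bsub>H\<^esub> b"
    have "?p \<in> pos_H" "?q \<in> pos_H" using b by (auto simp: pos_H_def H.excess_nonneg)
    then have "Q (t a ?p \<ominus>\<^bsub>T\<^esub> t a ?q)" using a by (intro diff left) auto
    also have "t a ?p \<ominus>\<^bsub>T\<^esub> t a ?q = t a (?p \<ominus>\<^bsub>H\<^esub> ?q)"
      using a b h.hom_inv[of ?q] by (simp add: T.minus_eq H.minus_eq t_add a_inv_def)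
    finally show ?thesis using H.decompose[OF b] by simp
  qed
  have "x \<in> l_gen T ((\<lambda>(a, b). t a b) ` (carrier G \<times> carrier H))" using generated assms(1) by blast
  then have "Q x \<and> x \<in> carrier T"
  proof induction
    case (meet x y)
    then have "Q (\<ominus>\<^bsub>T\<^esub> (\<ominus>\<^bsub>T\<^esub> x \<squnion>\<^bsub>ord_of T\<^esub> \<ominus>\<^bsub>T\<^esub> y))" by (simp add: neg join)
    then show ?case using meet by (simp add: T.meet_eq_neg_join)
  qed (auto simp: all zero neg add join)
  then show ?thesis ..
qed

lemma l_hom_eqI:
  assumes "l_group K" "f \<in> l_hom T K" "g \<in> l_hom T K"
    and eq: "\<And>a b. \<lbrakk> a \<in> pos_G; b \<in> pos_H \<rbrakk> \<Longrightarrow> f (t a b) = g (t a b)" and "x \<in> carrier T"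
  shows "f x = g x"
proof -
  interpret f: l_homomorphism T K f by (intro l_homomorphismI T.l_group_axioms assms)
  interpret g: l_homomorphism T K g by (intro l_homomorphismI T.l_group_axioms assms)
  show ?thesis
    using \<open>x \<in> carrier T\<close>
    by (induction rule: tensor_induct) (simp_all add: eq f.neg g.neg f.add g.add f.join g.join)
qed

text \<open>
  Near \<open>e\<close>, the maps \<open>P\<close> and \<open>Q\<close> differ by at most \<open>a \<otimes> b\<close> at each positive generator \<open>a \<otimes> b\<close> with
  \<open>a \<le> A\<close>. The bound on \<open>a\<close> is there because closeness is later obtained by locating \<open>n \<pi> A\<close> between
  multiples of \<open>A\<close>, which controls only the elements below \<open>A\<close>.
\<close>

definition close :: "'a \<Rightarrow> 't \<Rightarrow> ('t \<Rightarrow> 't) \<Rightarrow> ('t \<Rightarrow> 't) \<Rightarrow> bool" where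
  "close A e P Q \<longleftrightarrow> (\<forall>a\<in>pos_G. \<forall>b\<in>pos_H. a \<preceq>\<^bsub>G\<^esub> A \<longrightarrow>
     near T e (P (t a b)) (Q (t a b) \<oplus>\<^bsub>T\<^esub> t a b) \<and> near T e (Q (t a b)) (P (t a b) \<oplus>\<^bsub>T\<^esub> t a b))"

lemma close_sym: "close A e P Q \<Longrightarrow> close A e Q P"
  by (auto simp: close_def)

lemma close_antimono:
  assumes "close A' e P Q" "A \<preceq>\<^bsub>G\<^esub> A'" "A \<in> carrier G" "A' \<in> carrier G"
  shows "close A e P Q"
  unfolding close_def
proof (intro ballI impI)
  fix a b assume ab: "a \<in> pos_G" "b \<in> pos_H" "a \<preceq>\<^bsub>G\<^esub> A"
  then have "a \<preceq>\<^bsub>G\<^esub> A'" using G.le_trans[of a A A'] assms by simp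
  then show "near T e (P (t a b)) (Q (t a b) \<oplus>\<^bsub>T\<^esub> t a b) \<and> near T e (Q (t a b)) (P (t a b) \<oplus>\<^bsub>T\<^esub> t a b)"
    using assms(1) ab unfolding close_def by blast
qed

text \<open>
  Closeness of two \<open>\<ell>\<close>-homomorphisms on generators below \<open>A\<close> makes them differ by at most \<open>A \<otimes> B\<close>
  at \<open>x\<close>. Here \<open>A\<close> and \<open>B\<close> depend on \<open>x\<close> alone and serve all pairs of maps and all \<open>e\<close> at once.
  One inequality is enough, since \<open>close\<close> is symmetric in the two maps.
\<close>

definition controlled :: "'t \<Rightarrow> 'a \<Rightarrow> 'b \<Rightarrow> bool" where
  "controlled x A B \<longleftrightarrow> (\<forall>P\<in>l_hom T T. \<forall>Q\<in>l_hom T T. \<forall>e\<in>carrier T.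
    \<zero>\<^bsub>T\<^esub> \<preceq>\<^bsub>T\<^esub> e \<longrightarrow> close A e P Q \<longrightarrow> near T e (P x) (Q x \<oplus>\<^bsub>T\<^esub> t A B))"

lemma controlledI:
  assumes "\<And>P Q e. \<lbrakk> l_homomorphism T T P; l_homomorphism T T Q; e \<in> carrier T; \<zero>\<^bsub>T\<^esub> \<preceq>\<^bsub>T\<^esub> e; close A e P Q \<rbrakk>
    \<Longrightarrow> near T e (P x) (Q x \<oplus>\<^bsub>T\<^esub> t A B)"
  shows "controlled x A B"
  using assms by (simp add: controlled_def l_homomorphism_def l_homomorphism_axioms_def T.l_group_axioms)

lemma controlledD:
  assumes "controlled x A B" "l_homomorphism T T P" "l_homomorphism T T Q" "e \<in> carrier T" "\<zero>\<^bsub>T\<^esub> \<preceq>\<^bsub>T\<^esub> e"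
    and "close A e P Q"
  shows "near T e (P x) (Q x \<oplus>\<^bsub>T\<^esub> t A B)"
  using assms by (simp add: controlled_def l_homomorphism_def l_homomorphism_axioms_def)

lemma controlled_mono:
  assumes "controlled x A B" "A \<preceq>\<^bsub>G\<^esub> A'" "B \<preceq>\<^bsub>H\<^esub> B'"
    and "A \<in> pos_G" "A' \<in> pos_G" "B \<in> pos_H" "B' \<in> pos_H" "x \<in> carrier T"
  shows "controlled x A' B'"
proof (rule controlledI)
  fix P Q e assume *: "l_homomorphism T T P" "l_homomorphism T T Q" "e \<in> carrier T" "\<zero>\<^bsub>T\<^esub> \<preceq>\<^bsub>T\<^esub> e" "close A' e P Q"
  interpret P: l_homomorphism T T P by (rule *)
  interpret Q: l_homomorphism T T Q by (rule *)
  have "close A e P Q" by (rule close_antimono[OF *(5) assms(2)]) (use assms in auto)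
  then have "near T e (P x) (Q x \<oplus>\<^bsub>T\<^esub> t A B)" by (rule controlledD[OF assms(1) *(1-4)])
  then show "near T e (P x) (Q x \<oplus>\<^bsub>T\<^esub> t A' B')"
    by (rule T.near_le_trans) (use assms * t_mono[of A A' B B'] in auto)
qed

text \<open>
  Induction over lattice-group words: if \<open>P\<close> and \<open>Q\<close> are close at \<open>x\<close> and at \<open>y\<close>, they are close at
  \<open>x + y\<close> with the sum of the errors and at \<open>x \<squnion> y\<close> with a common bound of the errors.
\<close>

lemma controlled_ex:
  assumes "x \<in> carrier T"
  shows "\<exists>A\<in>pos_G. \<exists>B\<in>pos_H. controlled x A B"
proof -
  have common: "\<exists>A\<in>pos_G. \<exists>B\<in>pos_H. controlled x A B \<and> controlled y A B"
    if "x \<in> carrier T" "y \<in> carrier T" "\<exists>A\<in>pos_G. \<exists>B\<in>pos_H. controlled x A B" "\<exists>A\<in>pos_G. \<exists>B\<in>pos_H. controlled y A B" for x y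
  proof -
    note xy = that
    obtain A B A' B' where *: "A \<in> pos_G" "B \<in> pos_H" "controlled x A B" "A' \<in> pos_G" "B' \<in> pos_H" "controlled y A' B'"
      using xy by blast
    show ?thesis
    proof (intro bexI conjI)
      show "controlled x (A \<oplus>\<^bsub>G\<^esub> A') (B \<oplus>\<^bsub>H\<^esub> B')" "controlled y (A \<oplus>\<^bsub>G\<^esub> A') (B \<oplus>\<^bsub>H\<^esub> B')"
        by (rule controlled_mono[OF *(3)] controlled_mono[OF *(6)]; use * that in simp)+
    qed (use * in simp_all)
  qed
  show ?thesis
    using assms
  proof (induction rule: tensor_induct)
    case (gen a b)
    then have "controlled (t a b) a b" by (intro controlledI) (auto simp: close_def)
    then show ?case using gen by blast
  next
    case zero
    have "controlled \<zero>\<^bsub>T\<^esub> \<zero>\<^bsub>G\<^esub> \<zero>\<^bsub>H\<^esub>"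
      by (rule controlledI)
        (simp add: l_homomorphism.zero l_homomorphism.zero[OF hom_left[OF zero_pos(2)]] T.near_of_le)
    then show ?case using zero_pos by blast
  next
    case (neg x)
    then obtain A B where AB: "A \<in> pos_G" "B \<in> pos_H" "controlled x A B" by blast
    have "controlled (\<ominus>\<^bsub>T\<^esub> x) A B"
    proof (rule controlledI)
      fix P Q e assume *: "l_homomorphism T T P" "l_homomorphism T T Q" "e \<in> carrier T" "\<zero>\<^bsub>T\<^esub> \<preceq>\<^bsub>T\<^esub> e" "close A e P Q"
      interpret P: l_homomorphism T T P by (rule *)
      interpret Q: l_homomorphism T T Q by (rule *)
      have "near T e (Q x) (P x \<oplus>\<^bsub>T\<^esub> t A B)" using controlledD[OF AB(3) *(2,1,3,4) close_sym[OF *(5)]] .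
      then have "near T e (\<ominus>\<^bsub>T\<^esub> (P x \<oplus>\<^bsub>T\<^esub> t A B)) (\<ominus>\<^bsub>T\<^esub> Q x)"
        using AB neg by (intro T.near_neg) auto
      then have "near T e (t A B \<oplus>\<^bsub>T\<^esub> \<ominus>\<^bsub>T\<^esub> (P x \<oplus>\<^bsub>T\<^esub> t A B)) (t A B \<oplus>\<^bsub>T\<^esub> \<ominus>\<^bsub>T\<^esub> Q x)"
        using AB neg * by (intro T.near_add[OF T.near_of_le]) auto
      also have "t A B \<oplus>\<^bsub>T\<^esub> \<ominus>\<^bsub>T\<^esub> (P x \<oplus>\<^bsub>T\<^esub> t A B) = P (\<ominus>\<^bsub>T\<^esub> x)"
        using AB neg by (simp add: T.minus_add P.neg T.a_lcomm[of "t A B"] T.r_neg)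
      also have "t A B \<oplus>\<^bsub>T\<^esub> \<ominus>\<^bsub>T\<^esub> Q x = Q (\<ominus>\<^bsub>T\<^esub> x) \<oplus>\<^bsub>T\<^esub> t A B"
        using AB neg by (simp add: T.a_comm Q.neg)
      finally show "near T e (P (\<ominus>\<^bsub>T\<^esub> x)) (Q (\<ominus>\<^bsub>T\<^esub> x) \<oplus>\<^bsub>T\<^esub> t A B)" .
    qed
    then show ?case using AB by blast
  next
    case (add x y)
    then obtain A B A' B' where *: "A \<in> pos_G" "B \<in> pos_H" "controlled x A B" "A' \<in> pos_G" "B' \<in> pos_H" "controlled y A' B'"
      by blast
    define A2 B2 where "A2 = A \<oplus>\<^bsub>G\<^esub> A'" and "B2 = B \<oplus>\<^bsub>H\<^esub> B'"
    have 2: "A2 \<in> pos_G" "B2 \<in> pos_H" "A \<preceq>\<^bsub>G\<^esub> A2" "A' \<preceq>\<^bsub>G\<^esub> A2" "B \<preceq>\<^bsub>H\<^esub> B2" "B' \<preceq>\<^bsub>H\<^esub> B2"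
      using * by (auto simp: A2_def B2_def add_pos_G add_pos_H G.le_add_nonneg H.le_add_nonneg)
    have "controlled (x \<oplus>\<^bsub>T\<^esub> y) A2 B2"
    proof (rule controlledI)
      fix P Q e assume PQ: "l_homomorphism T T P" "l_homomorphism T T Q" "e \<in> carrier T" "\<zero>\<^bsub>T\<^esub> \<preceq>\<^bsub>T\<^esub> e" "close A2 e P Q"
      interpret P: l_homomorphism T T P by (rule PQ)
      interpret Q: l_homomorphism T T Q by (rule PQ)
      have "close A e P Q" "close A' e P Q" using close_antimono[OF PQ(5)] * 2 by auto
      then have "near T e (P x) (Q x \<oplus>\<^bsub>T\<^esub> t A B)" "near T e (P y) (Q y \<oplus>\<^bsub>T\<^esub> t A' B')"
        using controlledD[OF *(3) PQ(1-4)] controlledD[OF *(6) PQ(1-4)] by auto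
      then have "near T e (P x \<oplus>\<^bsub>T\<^esub> P y) ((Q x \<oplus>\<^bsub>T\<^esub> t A B) \<oplus>\<^bsub>T\<^esub> (Q y \<oplus>\<^bsub>T\<^esub> t A' B'))"
        using add * PQ by (intro T.near_add) auto
      also have "P x \<oplus>\<^bsub>T\<^esub> P y = P (x \<oplus>\<^bsub>T\<^esub> y)" using add by (simp add: P.add)
      also have "(Q x \<oplus>\<^bsub>T\<^esub> t A B) \<oplus>\<^bsub>T\<^esub> (Q y \<oplus>\<^bsub>T\<^esub> t A' B') = Q (x \<oplus>\<^bsub>T\<^esub> y) \<oplus>\<^bsub>T\<^esub> (t A B \<oplus>\<^bsub>T\<^esub> t A' B')"
        using add * by (simp add: Q.add T.a_ac)
      finally show "near T e (P (x \<oplus>\<^bsub>T\<^esub> y)) (Q (x \<oplus>\<^bsub>T\<^esub> y) \<oplus>\<^bsub>T\<^esub> t A2 B2)"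
      proof (rule T.near_le_trans)
        have "t A B \<oplus>\<^bsub>T\<^esub> t A' B' \<preceq>\<^bsub>T\<^esub> t A B2 \<oplus>\<^bsub>T\<^esub> t A' B2"
          using * 2 by (intro T.add_mono t_mono_right) auto
        then show "Q (x \<oplus>\<^bsub>T\<^esub> y) \<oplus>\<^bsub>T\<^esub> (t A B \<oplus>\<^bsub>T\<^esub> t A' B') \<preceq>\<^bsub>T\<^esub> Q (x \<oplus>\<^bsub>T\<^esub> y) \<oplus>\<^bsub>T\<^esub> t A2 B2"
          using * 2 add by (simp add: A2_def t_add)
      qed (use add * 2 PQ in auto)
    qed
    then show ?case using 2 by blast
  next
    case (join x y)
    obtain A B where AB: "A \<in> pos_G" "B \<in> pos_H" "controlled x A B" "controlled y A B"
      using common[OF join] by blast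
    have "controlled (x \<squnion>\<^bsub>ord_of T\<^esub> y) A B"
    proof (rule controlledI)
      fix P Q e assume *: "l_homomorphism T T P" "l_homomorphism T T Q" "e \<in> carrier T" "\<zero>\<^bsub>T\<^esub> \<preceq>\<^bsub>T\<^esub> e" "close A e P Q"
      interpret P: l_homomorphism T T P by (rule *)
      interpret Q: l_homomorphism T T Q by (rule *)
      let ?j = "Q x \<squnion>\<^bsub>ord_of T\<^esub> Q y"
      have "near T e (P x) (Q x \<oplus>\<^bsub>T\<^esub> t A B)" "near T e (P y) (Q y \<oplus>\<^bsub>T\<^esub> t A B)" using controlledD[OF AB(3) *] controlledD[OF AB(4) *] by auto
      then have "near T e (P x) (?j \<oplus>\<^bsub>T\<^esub> t A B)" "near T e (P y) (?j \<oplus>\<^bsub>T\<^esub> t A B)"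
        using AB * join by (auto elim!: T.near_le_trans simp: T.lat.join_left T.lat.join_right)
      then have "near T e (P x \<squnion>\<^bsub>ord_of T\<^esub> P y) (?j \<oplus>\<^bsub>T\<^esub> t A B)"
        using AB * join by (intro T.near_join_least) auto
      then show "near T e (P (x \<squnion>\<^bsub>ord_of T\<^esub> y)) (Q (x \<squnion>\<^bsub>ord_of T\<^esub> y) \<oplus>\<^bsub>T\<^esub> t A B)"
        using join by (simp add: P.join Q.join)
    qed
    then show ?case using AB by blast
  qed
qed

text \<open>
  The identity and the zero map are close at all positive generators and near every element; comparing
  them at \<open>x\<close> shows that \<open>x\<close> itself is bounded by \<open>A \<otimes> B\<close>.
\<close>

lemma le_of_controlled:
  assumes x: "x \<in> carrier T" and A: "A \<in> pos_G" and B: "B \<in> pos_H"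
    and good: "controlled x A B"
  shows "x \<preceq>\<^bsub>T\<^esub> t A B"
proof -
  define e where "e = excess T x (t A B)"
  have e: "e \<in> carrier T" "\<zero>\<^bsub>T\<^esub> \<preceq>\<^bsub>T\<^esub> e" using assms by (auto simp: e_def T.excess_nonneg)
  have "near T e (t a b) (\<zero>\<^bsub>T\<^esub> \<oplus>\<^bsub>T\<^esub> t a b)" "near T e \<zero>\<^bsub>T\<^esub> (t a b \<oplus>\<^bsub>T\<^esub> t a b)"
    if "a \<in> pos_G" "b \<in> pos_H" for a b
    using that e t_nonneg[OF that] by (auto intro!: T.near_of_le T.add_nonneg)
  then have "close A e (\<lambda>x. x) (\<lambda>x. \<zero>\<^bsub>T\<^esub>)"
    by (auto simp: close_def)
  then have "near T e x (\<zero>\<^bsub>T\<^esub> \<oplus>\<^bsub>T\<^esub> t A B)" 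
    using controlledD[OF good] T.pos_orth_l_homomorphism[OF T.pos_orth_id]
      T.pos_orth_l_homomorphism[OF T.pos_orth_zero] e by blast
  then have "e = \<zero>\<^bsub>T\<^esub>"
    using T.below_excess_near_zero[of e x "t A B"] e assms by (simp add: e_def)
  then show ?thesis using T.le_add_excess[of x "t A B"] assms by (simp add: e_def)
qed

lemma le_t:
  assumes "x \<in> carrier T"
  obtains A B where "A \<in> pos_G" "B \<in> pos_H" "x \<preceq>\<^bsub>T\<^esub> t A B"
  using controlled_ex[OF assms] le_of_controlled[OF assms] that by blast

text \<open>
  For \<open>x \<perp> y\<close> put \<open>z = S x \<sqinter> y\<close> and let \<open>A\<close>, \<open>B\<close> control \<open>x\<close>. Near any \<open>e \<le> n z \<le> n y\<close> the element
  \<open>x\<close> vanishes. If \<open>e\<close> meets some \<open>(\<pi> A - n A)\<^sup>+ \<otimes> b\<close>, then near a smaller element \<open>n A \<le> \<pi> A\<close> in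
  effect, so that \<open>n S x \<le> n \<pi> A \<otimes> B \<le> \<pi>\<^sup>2 A \<otimes> B\<close>. Otherwise \<open>n \<pi> A\<close> can be enclosed between
  \<open>k A\<close> and \<open>(k + 1) A\<close> for some \<open>k \<le> n\<^sup>2\<close>; the maps \<open>n S\<close> and \<open>k\<close> are then close up to \<open>A\<close>, and
  \<open>n S x \<le> k x + A \<otimes> B = A \<otimes> B\<close>. So \<open>n z\<close> is bounded by \<open>v = A \<otimes> B + \<pi>\<^sup>2 A \<otimes> B\<close> for all \<open>n\<close>.
\<close>

lemma pos_orth_tensor:
  assumes \<pi>: "pos_orth G \<pi>" and S: "S \<in> l_hom T T"
    and St: "\<And>a b. \<lbrakk> a \<in> pos_G; b \<in> pos_H \<rbrakk> \<Longrightarrow> S (t a b) = t (\<pi> a) b"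
  shows "pos_orth T S"
proof -
  interpret S: l_homomorphism T T S by (intro l_homomorphismI T.l_group_axioms S)
  interpret \<pi>: l_homomorphism G G \<pi> using \<pi> by (rule G.pos_orth_l_homomorphism)
  have "S x \<perp>\<^bsub>T\<^esub> y" if x: "x \<in> carrier T" and y: "y \<in> carrier T" and xy: "x \<perp>\<^bsub>T\<^esub> y" for x y
  proof -
    note pos = T.disj_nonneg[OF xy x y]
    define z where "z = S x \<sqinter>\<^bsub>ord_of T\<^esub> y"
    have z: "z \<in> carrier T" "\<zero>\<^bsub>T\<^esub> \<preceq>\<^bsub>T\<^esub> z" "z \<preceq>\<^bsub>T\<^esub> S x" "z \<preceq>\<^bsub>T\<^esub> y"
      using x y pos S.nonneg[of x] by (auto simp: z_def T.lat.meet_left T.lat.meet_right intro: T.lat.meet_le)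
    obtain A B where A: "A \<in> pos_G" and B: "B \<in> pos_H"
      and good: "controlled x A B"
      using controlled_ex[OF x] by blast
    have xAB: "x \<preceq>\<^bsub>T\<^esub> t A B" by (rule le_of_controlled[OF x A B good])
    have piA: "\<pi> A \<in> pos_G" "\<pi> (\<pi> A) \<in> pos_G"
      using A \<pi>.nonneg by (auto simp: pos_G_def)
    define v where "v = t A B \<oplus>\<^bsub>T\<^esub> t (\<pi> (\<pi> A)) B"
    have v: "v \<in> carrier T" "t A B \<preceq>\<^bsub>T\<^esub> v" "t (\<pi> (\<pi> A)) B \<preceq>\<^bsub>T\<^esub> v"
      using A B piA by (auto simp: v_def intro!: T.le_add_nonneg t_nonneg)
    have "z = \<zero>\<^bsub>T\<^esub>"
    proof (rule T.archimedean_near)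
      show "v \<in> carrier T" "\<zero>\<^bsub>T\<^esub> \<preceq>\<^bsub>T\<^esub> v"
        using A B piA by (auto simp: v_def intro!: T.add_nonneg t_nonneg)
      fix n :: nat and e assume e: "e \<in> carrier T" "\<zero>\<^bsub>T\<^esub> \<preceq>\<^bsub>T\<^esub> e" "e \<noteq> \<zero>\<^bsub>T\<^esub>" "e \<preceq>\<^bsub>T\<^esub> [n] \<cdot>\<^bsub>T\<^esub> z"
      let ?up = "excess G (\<pi> A) ([n] \<cdot>\<^bsub>G\<^esub> A)"
      have up: "?up \<in> pos_G" using A by (simp add: pos_G_def G.excess_nonneg)
      have zS: "[n] \<cdot>\<^bsub>T\<^esub> z \<preceq>\<^bsub>T\<^esub> [n] \<cdot>\<^bsub>T\<^esub> S x" using z x by (intro T.smult_mono) auto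
      show "\<exists>e'\<in>carrier T. \<zero>\<^bsub>T\<^esub> \<preceq>\<^bsub>T\<^esub> e' \<and> e' \<noteq> \<zero>\<^bsub>T\<^esub> \<and> e' \<preceq>\<^bsub>T\<^esub> e \<and> near T e' ([n] \<cdot>\<^bsub>T\<^esub> z) v"
      proof (cases "\<forall>b\<in>pos_H. e \<perp>\<^bsub>T\<^esub> t ?up b")
        case False
        then obtain b where b: "b \<in> pos_H" "\<not> e \<perp>\<^bsub>T\<^esub> t ?up b" by blast
        obtain e' where e': "e' \<in> carrier T" "\<zero>\<^bsub>T\<^esub> \<preceq>\<^bsub>T\<^esub> e'" "e' \<noteq> \<zero>\<^bsub>T\<^esub>" "e' \<preceq>\<^bsub>T\<^esub> e" "e' \<preceq>\<^bsub>T\<^esub> t ?up b"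
          by (rule T.nonzero_lower_bound[OF e(2,3,1) _ _ b(2)]) (use up b t_nonneg in auto)
        (* (n \<pi> A - \<pi> (\<pi> A))^+ is the image under \<pi> of (n A - \<pi> A)^+, which is disjoint from ?up. *)
        let ?w = "excess G ([n] \<cdot>\<^bsub>G\<^esub> \<pi> A) (\<pi> (\<pi> A))"
        have "?w = \<pi> (excess G ([n] \<cdot>\<^bsub>G\<^esub> A) (\<pi> A))" using A by (simp add: \<pi>.excess \<pi>.smult)
        then have "?w \<perp>\<^bsub>G\<^esub> ?up"
          using A G.pos_orth_disj[OF \<pi> G.excess_disj] by simp
        then have "t ?w B \<perp>\<^bsub>T\<^esub> t ?up b" using A B b by (intro t_disj) auto
        then have w: "t ?w B \<perp>\<^bsub>T\<^esub> e'"
          using e' A B b up by (elim T.disj_mono_right) auto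
        have "t ([n] \<cdot>\<^bsub>G\<^esub> \<pi> A) B \<preceq>\<^bsub>T\<^esub> t (\<pi> (\<pi> A) \<oplus>\<^bsub>G\<^esub> ?w) B"
          using A B by (intro t_mono_left G.le_add_excess) auto
        then have "near T e' ([n] \<cdot>\<^bsub>T\<^esub> t (\<pi> A) B) (t (\<pi> (\<pi> A)) B)"
          using A B w by (intro T.nearI[of _ _ "t ?w B"]) (auto simp: t_smult t_add)
        moreover have "S x \<preceq>\<^bsub>T\<^esub> t (\<pi> A) B" using S.mono[OF xAB] x A B by (simp add: St)
        then have "[n] \<cdot>\<^bsub>T\<^esub> S x \<preceq>\<^bsub>T\<^esub> [n] \<cdot>\<^bsub>T\<^esub> t (\<pi> A) B" using x A B by (intro T.smult_mono) auto
        then have "[n] \<cdot>\<^bsub>T\<^esub> z \<preceq>\<^bsub>T\<^esub> [n] \<cdot>\<^bsub>T\<^esub> t (\<pi> A) B"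
          by (rule T.le_trans[OF zS]) (use x z A B in auto)
        ultimately have "near T e' ([n] \<cdot>\<^bsub>T\<^esub> z) (t (\<pi> (\<pi> A)) B)"
          using e' z A B by (elim T.le_near_trans[rotated]) auto
        then have "near T e' ([n] \<cdot>\<^bsub>T\<^esub> z) v"
          by (rule T.near_le_trans) (use v e' z A B in auto)
        then show ?thesis using e' by auto
      next
        case True
        define ok where "ok e' \<longleftrightarrow> e' \<in> carrier T \<and> \<zero>\<^bsub>T\<^esub> \<preceq>\<^bsub>T\<^esub> e' \<and> e' \<noteq> \<zero>\<^bsub>T\<^esub> \<and> e' \<preceq>\<^bsub>T\<^esub> e" for e'
        (* Obstructions to k A \<le> n \<pi> A and to n \<pi> A \<le> (k + 1) A. An inequality in G counts as valid near e'
           if all tensors of its obstruction with elements of H are disjoint from e'. *)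
        define lo hi where "lo k = excess G ([k] \<cdot>\<^bsub>G\<^esub> A) ([n] \<cdot>\<^bsub>G\<^esub> \<pi> A)"
          and "hi k = excess G ([n] \<cdot>\<^bsub>G\<^esub> \<pi> A) ([Suc k] \<cdot>\<^bsub>G\<^esub> A)" for k :: nat
        have lohi: "lo k \<in> pos_G" "hi k \<in> pos_G" for k
          using A by (auto simp: lo_def hi_def pos_G_def G.excess_nonneg)
        have "\<exists>k\<le>n * n. \<exists>e'. ok e' \<and> (\<forall>b\<in>pos_H. t (lo k) b \<perp>\<^bsub>T\<^esub> e') \<and>
          ((\<forall>b\<in>pos_H. t (hi k) b \<perp>\<^bsub>T\<^esub> e') \<or> k = n * n)"
        proof (rule bounded_search)
          show "ok e" using e by (simp add: ok_def)
          have "lo 0 = \<zero>\<^bsub>G\<^esub>" using A piA by (simp add: lo_def G.excess_zero G.smult_nonneg)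
          then show "\<forall>b\<in>pos_H. t (lo 0) b \<perp>\<^bsub>T\<^esub> e"
            using l_homomorphism.zero[OF hom_left] e by (simp add: T.zero_disj)
        next
          fix k e' assume e': "ok e'" "\<not> (\<forall>b\<in>pos_H. t (hi k) b \<perp>\<^bsub>T\<^esub> e')"
          then obtain b where b: "b \<in> pos_H" "\<not> e' \<perp>\<^bsub>T\<^esub> t (hi k) b" by (auto simp: T.disj_commute[of e'])
          obtain e'' where e'': "e'' \<in> carrier T" "\<zero>\<^bsub>T\<^esub> \<preceq>\<^bsub>T\<^esub> e''" "e'' \<noteq> \<zero>\<^bsub>T\<^esub>" "e'' \<preceq>\<^bsub>T\<^esub> e'" "e'' \<preceq>\<^bsub>T\<^esub> t (hi k) b"
            using T.nonzero_lower_bound[of e' "t (hi k) b"] e' b lohi t_nonneg by (auto simp: ok_def)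
          have "ok e''" using e' e'' e T.le_trans[of e'' e' e] by (auto simp: ok_def)
          moreover have "t (lo (Suc k)) b' \<perp>\<^bsub>T\<^esub> e''" if b': "b' \<in> pos_H" for b'
          proof -
            have "lo (Suc k) \<perp>\<^bsub>G\<^esub> hi k" using A by (simp add: lo_def hi_def G.excess_disj)
            then have "t (lo (Suc k)) b' \<perp>\<^bsub>T\<^esub> t (hi k) b" using lohi b b' by (intro t_disj) auto
            then show ?thesis using e'' lohi b b' by (elim T.disj_mono_right) auto
          qed
          ultimately show "\<exists>e'. ok e' \<and> (\<forall>b\<in>pos_H. t (lo (Suc k)) b \<perp>\<^bsub>T\<^esub> e')" by blast
        qed
        then obtain k e' where k: "ok e'" "\<forall>b\<in>pos_H. t (lo k) b \<perp>\<^bsub>T\<^esub> e'"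
          "(\<forall>b\<in>pos_H. t (hi k) b \<perp>\<^bsub>T\<^esub> e') \<or> k = n * n" by blast
        have e': "e' \<in> carrier T" "\<zero>\<^bsub>T\<^esub> \<preceq>\<^bsub>T\<^esub> e'" "e' \<noteq> \<zero>\<^bsub>T\<^esub>" "e' \<preceq>\<^bsub>T\<^esub> e"
          using k(1) by (auto simp: ok_def)
        have hi: "t (hi k) b \<perp>\<^bsub>T\<^esub> e'" if b: "b \<in> pos_H" for b
        proof (cases "k = n * n")
          case eq: True
          have nup: "[n] \<cdot>\<^bsub>G\<^esub> ?up = excess G ([n] \<cdot>\<^bsub>G\<^esub> \<pi> A) ([k] \<cdot>\<^bsub>G\<^esub> A)"
            using A by (simp add: eq G.smult_smult flip: G.smult_excess)
          have "[n] \<cdot>\<^bsub>G\<^esub> \<pi> A \<preceq>\<^bsub>G\<^esub> [k] \<cdot>\<^bsub>G\<^esub> A \<oplus>\<^bsub>G\<^esub> [n] \<cdot>\<^bsub>G\<^esub> ?up"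
            unfolding nup using A by (intro G.le_add_excess) auto
          moreover have "[k] \<cdot>\<^bsub>G\<^esub> A \<oplus>\<^bsub>G\<^esub> [n] \<cdot>\<^bsub>G\<^esub> ?up \<preceq>\<^bsub>G\<^esub> [Suc k] \<cdot>\<^bsub>G\<^esub> A \<oplus>\<^bsub>G\<^esub> [n] \<cdot>\<^bsub>G\<^esub> ?up"
            using A by (simp add: G.smult_Suc G.le_add_nonneg)
          ultimately have "[n] \<cdot>\<^bsub>G\<^esub> \<pi> A \<preceq>\<^bsub>G\<^esub> [Suc k] \<cdot>\<^bsub>G\<^esub> A \<oplus>\<^bsub>G\<^esub> [n] \<cdot>\<^bsub>G\<^esub> ?up"
            by (rule G.le_trans) (use A up in auto)
          then have "hi k \<preceq>\<^bsub>G\<^esub> [n] \<cdot>\<^bsub>G\<^esub> ?up"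
            unfolding hi_def using A up by (intro G.excess_least) (auto intro!: G.smult_nonneg)
          then have "t (hi k) b \<preceq>\<^bsub>T\<^esub> [n] \<cdot>\<^bsub>T\<^esub> t ?up b"
            using t_mono_left[of "hi k" "[n] \<cdot>\<^bsub>G\<^esub> ?up" b] lohi up b A by (simp add: t_smult)
          moreover have "t ?up b \<perp>\<^bsub>T\<^esub> e" using True b by (simp add: T.disj_commute[of "t _ _"])
          then have "[n] \<cdot>\<^bsub>T\<^esub> t ?up b \<perp>\<^bsub>T\<^esub> e'"
            using e e' up b T.disj_mono_right[of "t ?up b" e e'] by (intro T.disj_smult) auto
          ultimately show ?thesis
            using lohi up b e' T.disj_mono[of "[n] \<cdot>\<^bsub>T\<^esub> t ?up b" e' "t (hi k) b"] by simp
        qed (use k b in auto)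
        define P Q where "P u = [n] \<cdot>\<^bsub>T\<^esub> S u" and "Q u = [k] \<cdot>\<^bsub>T\<^esub> u" for u
        have smult_hom: "(\<lambda>u. [(m::nat)] \<cdot>\<^bsub>T\<^esub> u) \<in> l_hom T T" for m
          using T.pos_orth_l_hom[OF T.pos_orth_smult[OF T.pos_orth_id]] .
        have PQ: "l_homomorphism T T P" "l_homomorphism T T Q"
          unfolding P_def Q_def l_homomorphism_def l_homomorphism_axioms_def
          using smult_hom l_hom_compose[OF T.l_group_axioms T.l_group_axioms T.l_group_axioms S smult_hom]
            T.l_group_axioms by auto
        have "near T e' (P (t a b)) (Q (t a b) \<oplus>\<^bsub>T\<^esub> t a b) \<and> near T e' (Q (t a b)) (P (t a b) \<oplus>\<^bsub>T\<^esub> t a b)"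
          if a: "a \<in> pos_G" "a \<preceq>\<^bsub>G\<^esub> A" and b: "b \<in> pos_H" for a b
        proof
          note id = G.pos_orth_id and n\<pi> = G.pos_orth_smult[OF \<pi>, of n]
          let ?hi = "excess G ([n] \<cdot>\<^bsub>G\<^esub> \<pi> a) ([Suc k] \<cdot>\<^bsub>G\<^esub> a)"
            and ?lo = "excess G ([k] \<cdot>\<^bsub>G\<^esub> a) ([n] \<cdot>\<^bsub>G\<^esub> \<pi> a)"
          have "?hi \<preceq>\<^bsub>G\<^esub> hi k" "?lo \<preceq>\<^bsub>G\<^esub> lo k"
            unfolding hi_def lo_def
            using a A G.pos_orth_excess_mono[OF n\<pi> G.pos_orth_smult[OF id, of "Suc k"]]
              G.pos_orth_excess_mono[OF G.pos_orth_smult[OF id, of k] n\<pi>] by auto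
          moreover have hl: "?hi \<in> pos_G" "?lo \<in> pos_G" using a by (auto simp: pos_G_def G.excess_nonneg)
          ultimately have le: "t ?hi b \<preceq>\<^bsub>T\<^esub> t (hi k) b" "t ?lo b \<preceq>\<^bsub>T\<^esub> t (lo k) b"
            using lohi b by (auto intro!: t_mono_left)
          have dj: "t ?hi b \<perp>\<^bsub>T\<^esub> e'" "t ?lo b \<perp>\<^bsub>T\<^esub> e'"
            using T.disj_mono[OF hi[OF b] t_nonneg[OF hl(1) b] le(1)]
              T.disj_mono[OF bspec[OF k(2) b] t_nonneg[OF hl(2) b] le(2)] e' lohi hl b by auto
          have "t ([n] \<cdot>\<^bsub>G\<^esub> \<pi> a) b \<preceq>\<^bsub>T\<^esub> t ([Suc k] \<cdot>\<^bsub>G\<^esub> a \<oplus>\<^bsub>G\<^esub> ?hi) b"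
            using a b by (intro t_mono_left G.le_add_excess) auto
          moreover have "t ([Suc k] \<cdot>\<^bsub>G\<^esub> a \<oplus>\<^bsub>G\<^esub> ?hi) b = (Q (t a b) \<oplus>\<^bsub>T\<^esub> t a b) \<oplus>\<^bsub>T\<^esub> t ?hi b"
            using a b by (simp add: t_add t_smult Q_def T.smult_Suc)
          moreover have "t ([n] \<cdot>\<^bsub>G\<^esub> \<pi> a) b = P (t a b)"
            using a b by (simp add: t_smult P_def St)
          ultimately show "near T e' (P (t a b)) (Q (t a b) \<oplus>\<^bsub>T\<^esub> t a b)"
            using dj hl b by (intro T.nearI[of _ _ "t ?hi b"]) auto
          have "t ([k] \<cdot>\<^bsub>G\<^esub> a) b \<preceq>\<^bsub>T\<^esub> t ([n] \<cdot>\<^bsub>G\<^esub> \<pi> a \<oplus>\<^bsub>G\<^esub> ?lo) b"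
            using a b by (intro t_mono_left G.le_add_excess) auto
          moreover have "t ([n] \<cdot>\<^bsub>G\<^esub> \<pi> a \<oplus>\<^bsub>G\<^esub> ?lo) b = P (t a b) \<oplus>\<^bsub>T\<^esub> t ?lo b"
            using a b by (simp add: t_add t_smult P_def St)
          moreover have "t ([k] \<cdot>\<^bsub>G\<^esub> a) b = Q (t a b)"
            using a b by (simp add: t_smult Q_def)
          ultimately have "near T e' (Q (t a b)) (P (t a b))"
            using dj hl b by (intro T.nearI[of _ _ "t ?lo b"]) auto
          then show "near T e' (Q (t a b)) (P (t a b) \<oplus>\<^bsub>T\<^esub> t a b)"
            by (rule T.near_le_trans)
              (use a b e' t_nonneg in \<open>auto simp: P_def Q_def T.le_add_nonneg\<close>)
        qed
        then have "close A e' P Q" by (simp add: close_def)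
        then have 1: "near T e' ([n] \<cdot>\<^bsub>T\<^esub> S x) ([k] \<cdot>\<^bsub>T\<^esub> x \<oplus>\<^bsub>T\<^esub> t A B)"
          using controlledD[OF good PQ] e' by (simp add: P_def Q_def)
        have "e' \<preceq>\<^bsub>T\<^esub> [n] \<cdot>\<^bsub>T\<^esub> y"
          by (rule T.le_trans[OF T.le_trans[OF e'(4) e(4)] T.smult_mono[OF z(4)]]) (use e' e z y in auto)
        moreover have "x \<perp>\<^bsub>T\<^esub> [n] \<cdot>\<^bsub>T\<^esub> y"
          using T.disj_smult[of y x n] x y xy by (simp add: T.disj_commute[of x])
        ultimately have "x \<perp>\<^bsub>T\<^esub> e'" using x y e' T.disj_mono_right[of x "[n] \<cdot>\<^bsub>T\<^esub> y" e'] by simp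
        then have "near T e' ([k] \<cdot>\<^bsub>T\<^esub> x) \<zero>\<^bsub>T\<^esub>"
          using x e' by (intro T.near_disj_zero T.disj_smult) auto
        then have "near T e' ([k] \<cdot>\<^bsub>T\<^esub> x \<oplus>\<^bsub>T\<^esub> t A B) (\<zero>\<^bsub>T\<^esub> \<oplus>\<^bsub>T\<^esub> t A B)"
          using x e' A B by (intro T.near_add[OF _ T.near_of_le]) auto
        then have 2: "near T e' ([k] \<cdot>\<^bsub>T\<^esub> x \<oplus>\<^bsub>T\<^esub> t A B) v"
          by (rule T.near_le_trans) (use v e' x A B in auto)
        have "near T e' ([n] \<cdot>\<^bsub>T\<^esub> S x) v"
          by (rule T.near_trans[OF 1 2]) (use v e' x A B in auto)
        then have "near T e' ([n] \<cdot>\<^bsub>T\<^esub> z) v"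
          by (rule T.le_near_trans[OF zS]) (use v e' x z in auto)
        then show ?thesis using e' by auto
      qed
    qed (use z in auto)
    then show ?thesis by (simp add: z_def disj_def)
  qed
  then show ?thesis by (auto simp: pos_orth_def S.add S.nonneg)
qed

end

section \<open>The archimedean \<open>\<ell>\<close>-group of orthomorphisms\<close>

text \<open>
  Differences of positive orthomorphisms, restricted to the carrier so that equality of elements is
  equality on the group. Positivity is tested on the positive cone.
\<close>

definition orth_group :: "('a, 'm) lo_ring_scheme \<Rightarrow> ('a \<Rightarrow> 'a) lo_ring" where
  "orth_group G = \<lparr> carrier = {f \<in> extensional (carrier G).
       \<exists>P Q. pos_orth G P \<and> pos_orth G Q \<and> (\<forall>x\<in>carrier G. f x = P x \<ominus>\<^bsub>G\<^esub> Q x)},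
     mult = undefined, one = undefined, zero = (\<lambda>x\<in>carrier G. \<zero>\<^bsub>G\<^esub>),
     add = (\<lambda>f g. \<lambda>x\<in>carrier G. f x \<oplus>\<^bsub>G\<^esub> g x),
     lo_le = (\<lambda>f g. \<forall>x\<in>carrier G. \<zero>\<^bsub>G\<^esub> \<preceq>\<^bsub>G\<^esub> x \<longrightarrow> f x \<preceq>\<^bsub>G\<^esub> g x) \<rparr>"

context l_group
begin

lemma eq_minus_iff:
  assumes "a \<in> carrier G" "b \<in> carrier G" "c \<in> carrier G"
  shows "a = b \<ominus> c \<longleftrightarrow> c \<oplus> a = b"
  using assms add_minus_cancel[of b c] add.right_cancel[of c a "b \<ominus> c"] by (auto simp: a_comm[of c])

lemma minus_eq_minus_iff:
  assumes c: "a \<in> carrier G" "b \<in> carrier G" "c \<in> carrier G" "d \<in> carrier G"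
  shows "a \<ominus> b = c \<ominus> d \<longleftrightarrow> a \<oplus> d = c \<oplus> b"
proof -
  have "a \<ominus> b = c \<ominus> d \<longleftrightarrow> d \<oplus> (a \<ominus> b) = c" using c by (intro eq_minus_iff) auto
  also have "d \<oplus> (a \<ominus> b) = (d \<oplus> a) \<ominus> b" using c by (simp add: minus_eq a_assoc)
  also have "(d \<oplus> a) \<ominus> b = c \<longleftrightarrow> b \<oplus> c = d \<oplus> a" using c eq_minus_iff[of c "d \<oplus> a" b] by auto
  finally show ?thesis using c by (auto simp: a_comm)
qed

lemma minus_minus_minus:
  assumes "a \<in> carrier G" "b \<in> carrier G" "c \<in> carrier G" "d \<in> carrier G"
  shows "(a \<ominus> b) \<ominus> (c \<ominus> d) = (a \<ominus> c) \<ominus> (b \<ominus> d)" "(a \<ominus> b) \<oplus> (c \<ominus> d) = (a \<oplus> c) \<ominus> (b \<oplus> d)"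
  using assms by (simp_all add: minus_eq minus_add a_ac)

lemma additive_minus:
  assumes "\<And>x. x \<in> carrier G \<Longrightarrow> f x \<in> carrier G"
    and "\<And>x y. \<lbrakk> x \<in> carrier G; y \<in> carrier G \<rbrakk> \<Longrightarrow> f (x \<oplus> y) = f x \<oplus> f y"
    and "x \<in> carrier G" "y \<in> carrier G"
  shows "f (x \<ominus> y) = f x \<ominus> f y"
  using assms(1,3,4) assms(2)[of y "x \<ominus> y"] by (simp add: eq_minus_iff add_minus_cancel)

lemma additive_eqI:
  assumes f: "\<And>x. x \<in> carrier G \<Longrightarrow> f x \<in> carrier G"
      "\<And>x y. \<lbrakk> x \<in> carrier G; y \<in> carrier G \<rbrakk> \<Longrightarrow> f (x \<oplus> y) = f x \<oplus> f y"
    and g: "\<And>x. x \<in> carrier G \<Longrightarrow> g x \<in> carrier G"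
      "\<And>x y. \<lbrakk> x \<in> carrier G; y \<in> carrier G \<rbrakk> \<Longrightarrow> g (x \<oplus> y) = g x \<oplus> g y"
    and eq: "\<And>x. \<lbrakk> x \<in> carrier G; \<zero> \<preceq> x \<rbrakk> \<Longrightarrow> f x = g x" and x: "x \<in> carrier G"
  shows "f x = g x"
proof -
  let ?p = "excess G x \<zero>" and ?q = "excess G \<zero> x"
  have "f (?p \<ominus> ?q) = g (?p \<ominus> ?q)"
    using x by (simp add: additive_minus[of f, OF f] additive_minus[of g, OF g] eq)
  then show ?thesis using decompose[OF x] by simp
qed

text \<open>
  The extension is \<open>x \<mapsto> h (x\<^sup>+) - h (x\<^sup>-)\<close>.
\<close>

lemma additive_extension:
  assumes cl: "\<And>x. \<lbrakk> x \<in> carrier G; \<zero> \<preceq> x \<rbrakk> \<Longrightarrow> h x \<in> carrier G"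
    and add: "\<And>x y. \<lbrakk> x \<in> carrier G; \<zero> \<preceq> x; y \<in> carrier G; \<zero> \<preceq> y \<rbrakk> \<Longrightarrow> h (x \<oplus> y) = h x \<oplus> h y"
  obtains f where "\<And>x. x \<in> carrier G \<Longrightarrow> f x \<in> carrier G"
    and "\<And>x y. \<lbrakk> x \<in> carrier G; y \<in> carrier G \<rbrakk> \<Longrightarrow> f (x \<oplus> y) = f x \<oplus> f y"
    and "\<And>x. \<lbrakk> x \<in> carrier G; \<zero> \<preceq> x \<rbrakk> \<Longrightarrow> f x = h x"
proof (rule that[of "\<lambda>x. h (excess G x \<zero>) \<ominus> h (excess G \<zero> x)"])
  let ?p = "\<lambda>x. excess G x \<zero>" and ?q = "\<lambda>x. excess G \<zero> x"
  have h0: "h \<zero> = \<zero>"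
    using add[of \<zero> \<zero>] cl[of \<zero>] add.l_cancel_one[of "h \<zero>" "h \<zero>"] by simp
  show "h (?p x) \<ominus> h (?q x) = h x" if "x \<in> carrier G" "\<zero> \<preceq> x" for x
    using that cl h0 by (simp add: excess_nonneg_zero excess_zero minus_eq)
  fix x y assume c: "x \<in> carrier G" "y \<in> carrier G"
  have pq: "u \<oplus> ?q u = ?p u" if "u \<in> carrier G" for u
    using add_excess_commute[of u \<zero>] that by simp
  have "(x \<oplus> y) \<oplus> (?q (x \<oplus> y) \<oplus> (?q x \<oplus> ?q y)) = ((x \<oplus> y) \<oplus> ?q (x \<oplus> y)) \<oplus> (?q x \<oplus> ?q y)"
    using c by (simp add: a_assoc)
  moreover have "(x \<oplus> y) \<oplus> (?q (x \<oplus> y) \<oplus> (?q x \<oplus> ?q y)) = (x \<oplus> ?q x) \<oplus> (y \<oplus> ?q y) \<oplus> ?q (x \<oplus> y)"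
    using c by (simp add: a_ac)
  ultimately have "?p (x \<oplus> y) \<oplus> (?q x \<oplus> ?q y) = (?p x \<oplus> ?p y) \<oplus> ?q (x \<oplus> y)"
    using c by (simp add: pq)
  then have "h (?p (x \<oplus> y) \<oplus> (?q x \<oplus> ?q y)) = h ((?p x \<oplus> ?p y) \<oplus> ?q (x \<oplus> y))" by simp
  then have "h (?p (x \<oplus> y)) \<oplus> (h (?q x) \<oplus> h (?q y)) = (h (?p x) \<oplus> h (?p y)) \<oplus> h (?q (x \<oplus> y))"
    using c by (simp add: add)
  then have "h (?p (x \<oplus> y)) \<ominus> h (?q (x \<oplus> y)) = (h (?p x) \<oplus> h (?p y)) \<ominus> (h (?q x) \<oplus> h (?q y))"
    using c cl by (subst minus_eq_minus_iff) auto
  then show "h (?p (x \<oplus> y)) \<ominus> h (?q (x \<oplus> y)) = (h (?p x) \<ominus> h (?q x)) \<oplus> (h (?p y) \<ominus> h (?q y))"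
    using c cl by (simp add: minus_minus_minus)
qed (use cl in auto)

lemma orth_group_simps:
  "\<zero>\<^bsub>orth_group G\<^esub> = (\<lambda>x\<in>carrier G. \<zero>)"
  "f \<oplus>\<^bsub>orth_group G\<^esub> g = (\<lambda>x\<in>carrier G. f x \<oplus> g x)"
  "f \<preceq>\<^bsub>orth_group G\<^esub> g \<longleftrightarrow> (\<forall>x\<in>carrier G. \<zero> \<preceq> x \<longrightarrow> f x \<preceq> g x)"
  by (simp_all add: orth_group_def)

lemma orth_groupI:
  assumes "f \<in> extensional (carrier G)" "pos_orth G P" "pos_orth G Q"
    and "\<And>x. x \<in> carrier G \<Longrightarrow> f x = P x \<ominus> Q x"
  shows "f \<in> carrier (orth_group G)"
  using assms by (auto simp: orth_group_def)

lemma orth_groupE: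
  assumes "f \<in> carrier (orth_group G)"
  obtains P Q where "f \<in> extensional (carrier G)" "pos_orth G P" "pos_orth G Q"
    "\<And>x. x \<in> carrier G \<Longrightarrow> f x = P x \<ominus> Q x"
  using assms by (auto simp: orth_group_def)

lemma pos_orth_closed: "\<lbrakk> pos_orth G P; x \<in> carrier G \<rbrakk> \<Longrightarrow> P x \<in> carrier G"
  and pos_orth_additive: "\<lbrakk> pos_orth G P; x \<in> carrier G; y \<in> carrier G \<rbrakk> \<Longrightarrow> P (x \<oplus> y) = P x \<oplus> P y"
  and pos_orth_nonneg: "\<lbrakk> pos_orth G P; x \<in> carrier G; \<zero> \<preceq> x \<rbrakk> \<Longrightarrow> \<zero> \<preceq> P x"
  by (auto simp: pos_orth_def)

lemma orth_closed: "\<lbrakk> f \<in> carrier (orth_group G); x \<in> carrier G \<rbrakk> \<Longrightarrow> f x \<in> carrier G"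
  by (erule orth_groupE) (simp add: pos_orth_closed)

lemma orth_additive:
  "\<lbrakk> f \<in> carrier (orth_group G); x \<in> carrier G; y \<in> carrier G \<rbrakk> \<Longrightarrow> f (x \<oplus> y) = f x \<oplus> f y"
  by (erule orth_groupE) (simp add: pos_orth_closed pos_orth_additive minus_minus_minus)

lemma orth_eqI:
  assumes f: "f \<in> carrier (orth_group G)" and g: "g \<in> carrier (orth_group G)"
    and "\<And>x. \<lbrakk> x \<in> carrier G; \<zero> \<preceq> x \<rbrakk> \<Longrightarrow> f x = g x"
  shows "f = g"
proof (rule extensionalityI[of _ "carrier G"])
  fix x assume "x \<in> carrier G"
  then show "f x = g x"
    using assms(3) by (intro additive_eqI[of f g x]) (auto simp: orth_closed orth_additive f g)
qed (use f g in \<open>auto simp: orth_group_def\<close>)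

lemma pos_orth_mem_orth_group:
  assumes "pos_orth G P" shows "restrict P (carrier G) \<in> carrier (orth_group G)"
  by (rule orth_groupI[OF _ assms pos_orth_zero]) (use assms in \<open>simp_all add: minus_eq pos_orth_closed\<close>)

lemma orth_nonneg_pos_orth:
  assumes f: "f \<in> carrier (orth_group G)" and pos: "\<zero>\<^bsub>orth_group G\<^esub> \<preceq>\<^bsub>orth_group G\<^esub> f"
  shows "pos_orth G f"
proof -
  obtain P Q where P: "pos_orth G P" and Q: "pos_orth G Q" and eq: "\<And>x. x \<in> carrier G \<Longrightarrow> f x = P x \<ominus> Q x"
    using f by (rule orth_groupE) blast
  show ?thesis
  proof (rule pos_orth_dominated[OF P])
    fix x assume "x \<in> carrier G" "\<zero> \<preceq> x"
    then show "\<zero> \<preceq> f x \<and> f x \<preceq> P x"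
      using pos P Q by (simp add: orth_group_simps eq minus_le_iff pos_orth_closed pos_orth_nonneg)
  qed (use f in \<open>auto simp: orth_closed orth_additive\<close>)
qed

lemma orth_abelian_group: "abelian_group (orth_group G)"
proof (rule abelian_groupI)
  let ?O = "orth_group G"
  fix f assume f: "f \<in> carrier ?O"
  then obtain P Q where PQ: "f \<in> extensional (carrier G)" "pos_orth G P" "pos_orth G Q" "\<And>x. x \<in> carrier G \<Longrightarrow> f x = P x \<ominus> Q x"
    by (rule orth_groupE) blast
  then have "(\<lambda>x\<in>carrier G. Q x \<ominus> P x) \<in> carrier ?O"
    by (intro orth_groupI[of _ Q P]) auto
  moreover have "(Q x \<ominus> P x) \<oplus> f x = \<zero>" if "x \<in> carrier G" for x
    using PQ that by (simp add: minus_minus_minus pos_orth_closed) (simp add: minus_eq a_comm r_neg pos_orth_closed)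
  ultimately show "\<exists>g\<in>carrier ?O. g \<oplus>\<^bsub>?O\<^esub> f = \<zero>\<^bsub>?O\<^esub>"
    by (intro bexI[of _ "\<lambda>x\<in>carrier G. Q x \<ominus> P x"]) (auto simp: orth_group_simps)
  show "\<zero>\<^bsub>?O\<^esub> \<oplus>\<^bsub>?O\<^esub> f = f"
    using PQ f by (intro extensionalityI[of _ "carrier G"]) (auto simp: orth_group_simps pos_orth_closed)
  fix g assume g: "g \<in> carrier ?O"
  then obtain P' Q' where PQ': "pos_orth G P'" "pos_orth G Q'" "\<And>x. x \<in> carrier G \<Longrightarrow> g x = P' x \<ominus> Q' x"
    by (rule orth_groupE) blast
  show "f \<oplus>\<^bsub>?O\<^esub> g \<in> carrier ?O"
    using PQ PQ' by (intro orth_groupI[of _ "\<lambda>x. P x \<oplus> P' x" "\<lambda>x. Q x \<oplus> Q' x"])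
      (auto simp: orth_group_simps pos_orth_add pos_orth_closed minus_minus_minus)
  show "f \<oplus>\<^bsub>?O\<^esub> g = g \<oplus>\<^bsub>?O\<^esub> f"
    using f g unfolding orth_group_simps by (intro restrict_ext a_comm) (auto simp: orth_closed)
  fix h assume h: "h \<in> carrier ?O"
  show "f \<oplus>\<^bsub>?O\<^esub> g \<oplus>\<^bsub>?O\<^esub> h = f \<oplus>\<^bsub>?O\<^esub> (g \<oplus>\<^bsub>?O\<^esub> h)"
    using f g h by (intro ext) (simp add: orth_group_simps orth_closed a_assoc restrict_def)
next
  show "\<zero>\<^bsub>orth_group G\<^esub> \<in> carrier (orth_group G)"
    by (rule orth_groupI[OF _ pos_orth_zero pos_orth_zero]) (auto simp: orth_group_simps eq_minus_iff)
qed

end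

context arch_l_group
begin

text \<open>
  Write \<open>f - g = U - W\<close> with positive orthomorphisms \<open>U\<close> and \<open>W\<close>. The map \<open>x \<mapsto> (U x - W x)\<^sup>+\<close> on the
  positive cone is additive by \<open>pos_orth_excess_add\<close> and lies below \<open>U\<close>, so it extends to a positive
  orthomorphism \<open>s\<close>. Then \<open>g + s\<close> is the join and \<open>f - s\<close> the meet, pointwise on the cone.
\<close>

lemma orth_join_meet_ex:
  assumes f: "f \<in> carrier (orth_group G)" and g: "g \<in> carrier (orth_group G)"
  shows "\<exists>m\<in>carrier (orth_group G). \<forall>x\<in>carrier G. \<zero> \<preceq> x \<longrightarrow> m x = f x \<squnion>\<^bsub>ord_of G\<^esub> g x"
    and "\<exists>m\<in>carrier (orth_group G). \<forall>x\<in>carrier G. \<zero> \<preceq> x \<longrightarrow> m x = f x \<sqinter>\<^bsub>ord_of G\<^esub> g x"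
proof -
  obtain P Q where P: "pos_orth G P" and Q: "pos_orth G Q" and fx: "\<And>x. x \<in> carrier G \<Longrightarrow> f x = P x \<ominus> Q x"
    using f by (rule orth_groupE) blast
  obtain P' Q' where P': "pos_orth G P'" and Q': "pos_orth G Q'" and gx: "\<And>x. x \<in> carrier G \<Longrightarrow> g x = P' x \<ominus> Q' x"
    using g by (rule orth_groupE) blast
  define U W where "U x = P x \<oplus> Q' x" and "W x = Q x \<oplus> P' x" for x
  have U: "pos_orth G U" and W: "pos_orth G W"
    unfolding U_def W_def by (intro pos_orth_add P Q P' Q')+
  note cl = pos_orth_closed[OF P] pos_orth_closed[OF Q] pos_orth_closed[OF P'] pos_orth_closed[OF Q']
    pos_orth_closed[OF U] pos_orth_closed[OF W]
  have ex: "excess G (U x) (W x) = excess G (f x) (g x)" if "x \<in> carrier G" for x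
  proof -
    have "U x \<ominus> W x = f x \<ominus> g x" using that cl by (simp add: U_def W_def fx gx minus_minus_minus minus_eq minus_add a_ac)
    then show ?thesis by (simp add: excess_def)
  qed
  obtain s where s: "\<And>x. x \<in> carrier G \<Longrightarrow> s x \<in> carrier G"
    "\<And>x y. \<lbrakk> x \<in> carrier G; y \<in> carrier G \<rbrakk> \<Longrightarrow> s (x \<oplus> y) = s x \<oplus> s y"
    "\<And>x. \<lbrakk> x \<in> carrier G; \<zero> \<preceq> x \<rbrakk> \<Longrightarrow> s x = excess G (U x) (W x)"
    by (rule additive_extension[of "\<lambda>x. excess G (U x) (W x)"])
      (use cl pos_orth_excess_add[OF U W] in auto)
  have so: "pos_orth G s"
  proof (rule pos_orth_dominated[OF U s(1,2)])
    fix x assume x: "x \<in> carrier G" "\<zero> \<preceq> x"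
    then have "excess G (U x) (W x) \<preceq> U x"
      using cl pos_orth_nonneg[OF U] pos_orth_nonneg[OF W] by (intro excess_least) auto
    then show "\<zero> \<preceq> s x \<and> s x \<preceq> U x" using x cl s(3) by simp
  qed
  have "(\<lambda>x\<in>carrier G. g x \<oplus> s x) \<in> carrier (orth_group G)"
  proof (rule orth_groupI[OF _ pos_orth_add[OF P' so] Q'])
    fix x assume x: "x \<in> carrier G"
    have "(P' x \<ominus> Q' x) \<oplus> s x = (P' x \<oplus> s x) \<ominus> Q' x" using x cl s(1) by (simp add: minus_eq a_ac)
    then show "(\<lambda>x\<in>carrier G. g x \<oplus> s x) x = (P' x \<oplus> s x) \<ominus> Q' x" using x by (simp add: gx)
  qed simp
  then show "\<exists>m\<in>carrier (orth_group G). \<forall>x\<in>carrier G. \<zero> \<preceq> x \<longrightarrow> m x = f x \<squnion>\<^bsub>ord_of G\<^esub> g x"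
    by (rule bexI[rotated]) (use f g s(3) ex in \<open>simp add: join_eq orth_closed\<close>)
  have "(\<lambda>x\<in>carrier G. f x \<ominus> s x) \<in> carrier (orth_group G)"
  proof (rule orth_groupI[OF _ P pos_orth_add[OF Q so]])
    fix x assume x: "x \<in> carrier G"
    have "(P x \<ominus> Q x) \<ominus> s x = P x \<ominus> (Q x \<oplus> s x)" using x cl s(1) by (simp add: minus_eq minus_add a_ac)
    then show "(\<lambda>x\<in>carrier G. f x \<ominus> s x) x = P x \<ominus> (Q x \<oplus> s x)" using x by (simp add: fx)
  qed simp
  then show "\<exists>m\<in>carrier (orth_group G). \<forall>x\<in>carrier G. \<zero> \<preceq> x \<longrightarrow> m x = f x \<sqinter>\<^bsub>ord_of G\<^esub> g x"
    by (rule bexI[rotated]) (use f g s(3) ex in \<open>simp add: meet_eq orth_closed\<close>)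
qed

lemma orth_l_group: "l_group (orth_group G)"
proof (intro l_group.intro l_group_axioms.intro orth_abelian_group)
  let ?O = "orth_group G"
  show "lattice (ord_of ?O)"
  proof (rule lattice_ord_ofI)
    fix f g assume f: "f \<in> carrier ?O" and g: "g \<in> carrier ?O"
    note c = orth_closed[OF f] orth_closed[OF g]
    obtain m where m: "m \<in> carrier ?O" "\<And>x. \<lbrakk> x \<in> carrier G; \<zero> \<preceq> x \<rbrakk> \<Longrightarrow> m x = f x \<sqinter>\<^bsub>ord_of G\<^esub> g x"
      using orth_join_meet_ex(2)[OF f g] by blast
    show "\<exists>m\<in>carrier ?O. m \<preceq>\<^bsub>?O\<^esub> f \<and> m \<preceq>\<^bsub>?O\<^esub> g \<and> (\<forall>w\<in>carrier ?O. w \<preceq>\<^bsub>?O\<^esub> f \<and> w \<preceq>\<^bsub>?O\<^esub> g \<longrightarrow> w \<preceq>\<^bsub>?O\<^esub> m)"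
      by (rule bexI[OF _ m(1)])
        (use c m(2) in \<open>auto simp: orth_group_simps(3) lat.meet_left lat.meet_right orth_closed intro!: lat.meet_le\<close>)
    obtain m where m: "m \<in> carrier ?O" "\<And>x. \<lbrakk> x \<in> carrier G; \<zero> \<preceq> x \<rbrakk> \<Longrightarrow> m x = f x \<squnion>\<^bsub>ord_of G\<^esub> g x"
      using orth_join_meet_ex(1)[OF f g] by blast
    show "\<exists>m\<in>carrier ?O. f \<preceq>\<^bsub>?O\<^esub> m \<and> g \<preceq>\<^bsub>?O\<^esub> m \<and> (\<forall>w\<in>carrier ?O. f \<preceq>\<^bsub>?O\<^esub> w \<and> g \<preceq>\<^bsub>?O\<^esub> w \<longrightarrow> m \<preceq>\<^bsub>?O\<^esub> w)"
      by (rule bexI[OF _ m(1)])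
        (use c m(2) in \<open>auto simp: orth_group_simps(3) lat.join_left lat.join_right orth_closed intro!: lat.join_le\<close>)
  next
    fix f g assume fg: "f \<in> carrier ?O" "g \<in> carrier ?O" "f \<preceq>\<^bsub>?O\<^esub> g" "g \<preceq>\<^bsub>?O\<^esub> f"
    then show "f = g" by (intro orth_eqI lat.le_antisym) (auto simp: orth_group_simps(3) orth_closed)
  next
    fix f g h assume fgh: "f \<in> carrier ?O" "g \<in> carrier ?O" "h \<in> carrier ?O" "f \<preceq>\<^bsub>?O\<^esub> g" "g \<preceq>\<^bsub>?O\<^esub> h"
    then have "f x \<preceq> h x" if "x \<in> carrier G" "\<zero> \<preceq> x" for x
      using le_trans[of "f x" "g x" "h x"] that by (simp add: orth_group_simps(3) orth_closed)
    then show "f \<preceq>\<^bsub>?O\<^esub> h" by (simp add: orth_group_simps(3))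
  qed (simp add: orth_group_simps(3) orth_closed)
qed (auto simp: orth_group_simps orth_closed)

lemma orth_join_meet:
  assumes f: "f \<in> carrier (orth_group G)" and g: "g \<in> carrier (orth_group G)"
    and x: "x \<in> carrier G" "\<zero> \<preceq> x"
  shows "(f \<squnion>\<^bsub>ord_of (orth_group G)\<^esub> g) x = f x \<squnion>\<^bsub>ord_of G\<^esub> g x"
    and "(f \<sqinter>\<^bsub>ord_of (orth_group G)\<^esub> g) x = f x \<sqinter>\<^bsub>ord_of G\<^esub> g x"
proof -
  let ?O = "orth_group G"
  note c = orth_closed[OF f] orth_closed[OF g]
  obtain m where m: "m \<in> carrier ?O" "\<And>x. \<lbrakk> x \<in> carrier G; \<zero> \<preceq> x \<rbrakk> \<Longrightarrow> m x = f x \<sqinter>\<^bsub>ord_of G\<^esub> g x"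
    using orth_join_meet_ex(2)[OF f g] by blast
  have "f \<sqinter>\<^bsub>ord_of ?O\<^esub> g = m"
    by (rule l_group_meet_eqI[OF orth_l_group])
      (use c m f g in \<open>auto simp: orth_group_simps(3) lat.meet_left lat.meet_right orth_closed intro!: lat.meet_le\<close>)
  then show "(f \<sqinter>\<^bsub>ord_of ?O\<^esub> g) x = f x \<sqinter>\<^bsub>ord_of G\<^esub> g x" using m(2) x by simp
  obtain m where m: "m \<in> carrier ?O" "\<And>x. \<lbrakk> x \<in> carrier G; \<zero> \<preceq> x \<rbrakk> \<Longrightarrow> m x = f x \<squnion>\<^bsub>ord_of G\<^esub> g x"
    using orth_join_meet_ex(1)[OF f g] by blast
  have "f \<squnion>\<^bsub>ord_of ?O\<^esub> g = m"
    by (rule l_group_join_eqI[OF orth_l_group])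
      (use c m f g in \<open>auto simp: orth_group_simps(3) lat.join_left lat.join_right orth_closed intro!: lat.join_le\<close>)
  then show "(f \<squnion>\<^bsub>ord_of ?O\<^esub> g) x = f x \<squnion>\<^bsub>ord_of G\<^esub> g x" using m(2) x by simp
qed

lemma orth_arch_l_group: "arch_l_group (orth_group G)"
proof (intro arch_l_group.intro arch_l_group_axioms.intro orth_l_group)
  let ?O = "orth_group G"
  interpret O: l_group ?O by (rule orth_l_group)
  fix f g assume f: "f \<in> carrier ?O" and g: "g \<in> carrier ?O"
    and pos: "\<zero>\<^bsub>?O\<^esub> \<preceq>\<^bsub>?O\<^esub> f" "\<zero>\<^bsub>?O\<^esub> \<preceq>\<^bsub>?O\<^esub> g" and le: "\<And>n::nat. [n] \<cdot>\<^bsub>?O\<^esub> f \<preceq>\<^bsub>?O\<^esub> g"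
  have smult: "([n] \<cdot>\<^bsub>?O\<^esub> f) x = [n] \<cdot> f x" if "x \<in> carrier G" for n :: nat and x
  proof (induction n)
    case (Suc n)
    then show ?case using that f by (simp add: O.smult_Suc smult_Suc orth_closed) (simp add: orth_group_simps)
  qed (use that in \<open>simp add: orth_group_simps\<close>)
  have "f x = \<zero>" if x: "x \<in> carrier G" "\<zero> \<preceq> x" for x
    by (rule archimedean[of "f x" "g x"])
      (use pos le x f g in \<open>auto simp: orth_closed orth_group_simps(1,3) simp flip: smult\<close>)
  then show "f = \<zero>\<^bsub>?O\<^esub>"
    using f O.zero_closed by (intro orth_eqI) (auto simp: orth_group_simps)
qed

lemma orth_eval_l_hom:
  assumes "x \<in> carrier G" "\<zero> \<preceq> x"
  shows "(\<lambda>f. f x) \<in> l_hom (orth_group G) G"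
  using assms by (auto simp: l_hom_iff orth_l_group l_group_axioms orth_closed orth_join_meet)
    (simp add: orth_group_simps)

lemma orth_disjI:
  assumes f: "f \<in> carrier (orth_group G)" and g: "g \<in> carrier (orth_group G)"
    and disj: "\<And>x. \<lbrakk> x \<in> carrier G; \<zero> \<preceq> x \<rbrakk> \<Longrightarrow> f x \<perp> g x"
  shows "f \<perp>\<^bsub>orth_group G\<^esub> g"
proof -
  interpret O: l_group "orth_group G" by (rule orth_l_group)
  show ?thesis
    unfolding disj_def
    using disj f g O.zero_closed by (intro orth_eqI) (auto simp: orth_join_meet disj_def orth_group_simps)
qed

end

section \<open>The multiplication on the tensor product\<close>

lemma l_bimorphismI:
  assumes "l_group G" "l_group H" "l_group K"
    and left: "\<And>a b b'. \<lbrakk> a \<in> carrier G; b \<in> carrier H; b' \<in> carrier H \<rbrakk> \<Longrightarrow> \<phi> a (b \<oplus>\<^bsub>H\<^esub> b') = \<phi> a b \<oplus>\<^bsub>K\<^esub> \<phi> a b'"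
    and right: "\<And>a a' b. \<lbrakk> a \<in> carrier G; a' \<in> carrier G; b \<in> carrier H \<rbrakk> \<Longrightarrow> \<phi> (a \<oplus>\<^bsub>G\<^esub> a') b = \<phi> a b \<oplus>\<^bsub>K\<^esub> \<phi> a' b"
    and cl: "\<And>a b. \<lbrakk> a \<in> carrier G; b \<in> carrier H \<rbrakk> \<Longrightarrow> \<phi> a b \<in> carrier K"
    and disj_left: "\<And>a b b'. \<lbrakk> a \<in> carrier G; \<zero>\<^bsub>G\<^esub> \<preceq>\<^bsub>G\<^esub> a; b \<in> carrier H; b' \<in> carrier H; b \<perp>\<^bsub>H\<^esub> b' \<rbrakk> \<Longrightarrow> \<phi> a b \<perp>\<^bsub>K\<^esub> \<phi> a b'"
    and disj_right: "\<And>a a' b. \<lbrakk> b \<in> carrier H; \<zero>\<^bsub>H\<^esub> \<preceq>\<^bsub>H\<^esub> b; a \<in> carrier G; a' \<in> carrier G; a \<perp>\<^bsub>G\<^esub> a' \<rbrakk> \<Longrightarrow> \<phi> a b \<perp>\<^bsub>K\<^esub> \<phi> a' b"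
  shows "l_bimorphism G H K \<phi>"
proof -
  have "(\<lambda>b. \<phi> a b) \<in> l_hom H K" if "a \<in> carrier G" "\<zero>\<^bsub>G\<^esub> \<preceq>\<^bsub>G\<^esub> a" for a
    using assms that by (intro l_hom_of_disjoint_preserving) auto
  moreover have "(\<lambda>a. \<phi> a b) \<in> l_hom G K" if "b \<in> carrier H" "\<zero>\<^bsub>H\<^esub> \<preceq>\<^bsub>H\<^esub> b" for b
    using assms that by (intro l_hom_of_disjoint_preserving) auto
  moreover have "(\<lambda>b. \<phi> a b) \<in> hom (add_monoid H) (add_monoid K)" if "a \<in> carrier G" for a
    using that left cl by (simp add: hom_def)
  moreover have "(\<lambda>a. \<phi> a b) \<in> hom (add_monoid G) (add_monoid K)" if "b \<in> carrier H" for b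
    using that right cl by (simp add: hom_def)
  ultimately show ?thesis unfolding l_bimorphism_def l_hom_def by blast
qed

context f_ring
begin

lemma pos_orth_mult:
  assumes "c \<in> carrier R" "\<zero> \<preceq> c"
  shows "pos_orth R (\<lambda>a. a \<otimes> c)" "pos_orth R (\<lambda>a. c \<otimes> a)"
  using assms
  by (auto simp: pos_orth_def disj_def mult_closed distr_right distr_left mult_nonneg disjoint_mult_right disjoint_mult_left)

end

text \<open>
  Only the existence part of the universal property is recorded, for groups on the type of \<open>T\<close>;
  uniqueness is \<open>l_hom_eqI\<close>.
\<close>

locale l_tensor_universal = l_tensor G H T t
  for G :: "'a lo_ring" and H :: "'b lo_ring" and T :: "'t lo_ring" and t +
  assumes tensor_product: "\<And>K :: 't lo_ring. \<And>\<phi>. \<lbrakk> arch_l_group K; l_bimorphism G H K \<phi> \<rbrakk>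
      \<Longrightarrow> \<exists>\<Phi>. \<Phi> \<in> l_hom T K \<and> (\<forall>a\<in>carrier G. \<forall>b\<in>carrier H. \<phi> a b = \<Phi> (t a b))"
begin

lemma pos_orth_tensor_ex:
  assumes \<pi>: "pos_orth G \<pi>"
  shows "\<exists>S. pos_orth T S \<and> (\<forall>a\<in>carrier G. \<forall>b\<in>carrier H. S (t a b) = t (\<pi> a) b)"
proof -
  interpret \<pi>: l_homomorphism G G \<pi> using \<pi> by (rule G.pos_orth_l_homomorphism)
  have "l_bimorphism G H T (\<lambda>a b. t (\<pi> a) b)"
  proof (rule l_bimorphismI)
    fix a b b' assume "a \<in> carrier G" "\<zero>\<^bsub>G\<^esub> \<preceq>\<^bsub>G\<^esub> a" "b \<in> carrier H" "b' \<in> carrier H" "b \<perp>\<^bsub>H\<^esub> b'"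
    then show "t (\<pi> a) b \<perp>\<^bsub>T\<^esub> t (\<pi> a) b'"
      using l_homomorphism.disj[OF hom_right, of "\<pi> a" b b'] \<pi>.nonneg by simp
  next
    fix a a' b assume "b \<in> carrier H" "\<zero>\<^bsub>H\<^esub> \<preceq>\<^bsub>H\<^esub> b" "a \<in> carrier G" "a' \<in> carrier G" "a \<perp>\<^bsub>G\<^esub> a'"
    then show "t (\<pi> a) b \<perp>\<^bsub>T\<^esub> t (\<pi> a') b"
      using t_disj[of "\<pi> a" "\<pi> a'" b b] \<pi>.disj by simp
  qed (simp_all add: t_add \<pi>.add G.l_group_axioms H.l_group_axioms T.l_group_axioms)
  then obtain S where S: "S \<in> l_hom T T" "\<forall>a\<in>carrier G. \<forall>b\<in>carrier H. t (\<pi> a) b = S (t a b)"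
    using tensor_product[OF T.arch_l_group_axioms] by blast
  then show ?thesis using pos_orth_tensor[OF \<pi> S(1)] by (intro exI[of _ S]) simp
qed

text \<open>
  The construction is symmetric in the two factors, so that orthomorphisms of \<open>H\<close> are treated by those
  of \<open>G\<close>.
\<close>

lemma swap: "l_tensor_universal H G T (\<lambda>b a. t a b)"
proof (intro l_tensor_universal.intro l_tensor.intro l_tensor_axioms.intro l_tensor_universal_axioms.intro
    G.arch_l_group_axioms H.arch_l_group_axioms T.arch_l_group_axioms)
  show "l_bimorphism H G T (\<lambda>b a. t a b)"
    using bimorphism unfolding l_bimorphism_def by blast
  have "(\<lambda>(b, a). t a b) ` (carrier H \<times> carrier G) = (\<lambda>(a, b). t a b) ` (carrier G \<times> carrier H)"
    by (auto simp: image_iff)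
  then show "carrier T \<subseteq> l_gen T ((\<lambda>(b, a). t a b) ` (carrier H \<times> carrier G))"
    using generated by simp
  fix K :: "'t lo_ring" and \<phi> assume K: "arch_l_group K" "l_bimorphism H G K \<phi>"
  then have "l_bimorphism G H K (\<lambda>a b. \<phi> b a)" unfolding l_bimorphism_def by blast
  then show "\<exists>\<Phi>. \<Phi> \<in> l_hom T K \<and> (\<forall>b\<in>carrier H. \<forall>a\<in>carrier G. \<phi> b a = \<Phi> (t a b))"
    using tensor_product[OF K(1), of "\<lambda>a b. \<phi> b a"] by blast
qed

lemma pos_orth_tensor_both:
  assumes "pos_orth G \<pi>" "pos_orth H \<rho>"
  shows "\<exists>S. pos_orth T S \<and> (\<forall>a\<in>carrier G. \<forall>b\<in>carrier H. S (t a b) = t (\<pi> a) (\<rho> b))"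
proof -
  obtain P where P: "pos_orth T P" "\<forall>a\<in>carrier G. \<forall>b\<in>carrier H. P (t a b) = t (\<pi> a) b"
    using pos_orth_tensor_ex[OF assms(1)] by blast
  obtain Q where Q: "pos_orth T Q" "\<forall>b\<in>carrier H. \<forall>a\<in>carrier G. Q (t a b) = t a (\<rho> b)"
    using l_tensor_universal.pos_orth_tensor_ex[OF swap assms(2)] by (elim exE conjE)
  show ?thesis
    using T.pos_orth_compose[OF P(1) Q(1)] P(2) Q(2) H.pos_orth_closed[OF assms(2)]
    by (intro exI[of _ "\<lambda>x. P (Q x)"]) simp
qed

end

text \<open>
  The additional instance of the universal property has targets on the type of maps on \<open>T\<close>; it is needed
  for the group of orthomorphisms of \<open>T\<close>.
\<close>

locale f_ring_tensor = l_tensor_universal G H T t + G: f_ring G + H: f_ring H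
  for G :: "'a lo_ring" and H :: "'b lo_ring" and T :: "'t lo_ring" and t +
  assumes orth_tensor_product: "\<And>K :: ('t \<Rightarrow> 't) lo_ring. \<And>\<phi>. \<lbrakk> arch_l_group K; l_bimorphism G H K \<phi> \<rbrakk>
      \<Longrightarrow> \<exists>\<Phi>. \<Phi> \<in> l_hom T K \<and> (\<forall>a\<in>carrier G. \<forall>b\<in>carrier H. \<phi> a b = \<Phi> (t a b))"
begin

abbreviation Orth where "Orth \<equiv> orth_group T"

sublocale O: arch_l_group Orth
  by (rule T.orth_arch_l_group)

text \<open>
  The orthomorphism \<open>f\<close> is right multiplication by \<open>c \<otimes> d\<close> on pure tensors. This determines \<open>f\<close>, so
  additivity in \<open>c\<close> and \<open>d\<close> of the representing map holds automatically, also for elements that are not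
  positive.
\<close>

definition represents :: "('t \<Rightarrow> 't) \<Rightarrow> 'a \<Rightarrow> 'b \<Rightarrow> bool" where
  "represents f c d \<longleftrightarrow> f \<in> carrier Orth \<and>
     (\<forall>a\<in>carrier G. \<forall>b\<in>carrier H. f (t a b) = t (a \<otimes>\<^bsub>G\<^esub> c) (b \<otimes>\<^bsub>H\<^esub> d))"

text \<open>
  A difference of \<open>\<ell>\<close>-homomorphisms is not determined by generators in an obvious way; but
  \<open>P - Q = P' - Q'\<close> amounts to \<open>P + Q' = P' + Q\<close>, where both sides are positive orthomorphisms and
  hence \<open>\<ell>\<close>-homomorphisms.
\<close>

lemma represents_unique:
  assumes "represents f c d" "represents g c d"
  shows "f = g"
proof -
  have f: "f \<in> carrier Orth" and g: "g \<in> carrier Orth" using assms by (auto simp: represents_def)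
  obtain P Q where PQ: "pos_orth T P" "pos_orth T Q" "\<And>x. x \<in> carrier T \<Longrightarrow> f x = P x \<ominus>\<^bsub>T\<^esub> Q x"
    using f by (rule T.orth_groupE) blast
  obtain P' Q' where PQ': "pos_orth T P'" "pos_orth T Q'" "\<And>x. x \<in> carrier T \<Longrightarrow> g x = P' x \<ominus>\<^bsub>T\<^esub> Q' x"
    using g by (rule T.orth_groupE) blast
  note cl = T.pos_orth_closed[OF PQ(1)] T.pos_orth_closed[OF PQ(2)] T.pos_orth_closed[OF PQ'(1)] T.pos_orth_closed[OF PQ'(2)]
  have eq: "f x = g x \<longleftrightarrow> P x \<oplus>\<^bsub>T\<^esub> Q' x = P' x \<oplus>\<^bsub>T\<^esub> Q x" if "x \<in> carrier T" for x
    using that cl by (simp add: PQ(3) PQ'(3) T.minus_eq_minus_iff)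
  have "P x \<oplus>\<^bsub>T\<^esub> Q' x = P' x \<oplus>\<^bsub>T\<^esub> Q x" if "x \<in> carrier T" for x
  proof (rule l_hom_eqI[OF T.l_group_axioms _ _ _ that])
    show "(\<lambda>x. P x \<oplus>\<^bsub>T\<^esub> Q' x) \<in> l_hom T T" "(\<lambda>x. P' x \<oplus>\<^bsub>T\<^esub> Q x) \<in> l_hom T T"
      by (intro T.pos_orth_l_hom T.pos_orth_add PQ PQ')+
    show "P (t a b) \<oplus>\<^bsub>T\<^esub> Q' (t a b) = P' (t a b) \<oplus>\<^bsub>T\<^esub> Q (t a b)" if "a \<in> pos_G" "b \<in> pos_H" for a b
      using assms that by (simp add: represents_def flip: eq)
  qed
  then have "f x = g x" if "x \<in> carrier T" for x using eq that by simp
  then show ?thesis using f g by (intro T.orth_eqI) auto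
qed

lemma represents_add:
  assumes f: "represents f c d" and g: "represents g c' d'"
    and c: "c \<in> carrier G" "c' \<in> carrier G" and d: "d \<in> carrier H" "d' \<in> carrier H"
  shows "d = d' \<Longrightarrow> represents (f \<oplus>\<^bsub>Orth\<^esub> g) (c \<oplus>\<^bsub>G\<^esub> c') d" "c = c' \<Longrightarrow> represents (f \<oplus>\<^bsub>Orth\<^esub> g) c (d \<oplus>\<^bsub>H\<^esub> d')"
proof -
  have fg: "f \<in> carrier Orth" "g \<in> carrier Orth" using f g by (auto simp: represents_def)
  have "f \<oplus>\<^bsub>Orth\<^esub> g \<in> carrier Orth" using fg by simp
  then show "d = d' \<Longrightarrow> represents (f \<oplus>\<^bsub>Orth\<^esub> g) (c \<oplus>\<^bsub>G\<^esub> c') d" "c = c' \<Longrightarrow> represents (f \<oplus>\<^bsub>Orth\<^esub> g) c (d \<oplus>\<^bsub>H\<^esub> d')"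
    using f g c d
    by (simp_all add: represents_def T.orth_group_simps(2) G.distr_left H.distr_left t_add G.mult_closed H.mult_closed)
qed

lemma t_neg:
  "\<lbrakk> a \<in> carrier G; b \<in> carrier H \<rbrakk> \<Longrightarrow> t (\<ominus>\<^bsub>G\<^esub> a) b = \<ominus>\<^bsub>T\<^esub> t a b"
  "\<lbrakk> a \<in> carrier G; b \<in> carrier H \<rbrakk> \<Longrightarrow> t a (\<ominus>\<^bsub>H\<^esub> b) = \<ominus>\<^bsub>T\<^esub> t a b"
proof -
  assume a: "a \<in> carrier G" and b: "b \<in> carrier H"
  interpret l: group_hom "add_monoid G" "add_monoid T" "\<lambda>a. t a b"
    using t_hom(2)[OF b] G.a_group T.a_group by (simp add: group_hom_def group_hom_axioms_def)
  interpret r: group_hom "add_monoid H" "add_monoid T" "\<lambda>b. t a b"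
    using t_hom(1)[OF a] H.a_group T.a_group by (simp add: group_hom_def group_hom_axioms_def)
  show "t (\<ominus>\<^bsub>G\<^esub> a) b = \<ominus>\<^bsub>T\<^esub> t a b" "t a (\<ominus>\<^bsub>H\<^esub> b) = \<ominus>\<^bsub>T\<^esub> t a b"
    using l.hom_inv[of a] r.hom_inv[of b] a b by (simp_all add: a_inv_def)
qed

lemma orth_neg: "\<lbrakk> f \<in> carrier Orth; x \<in> carrier T \<rbrakk> \<Longrightarrow> (\<ominus>\<^bsub>Orth\<^esub> f) x = \<ominus>\<^bsub>T\<^esub> f x"
proof -
  assume f: "f \<in> carrier Orth" and x: "x \<in> carrier T"
  have "(f \<oplus>\<^bsub>Orth\<^esub> \<ominus>\<^bsub>Orth\<^esub> f) x = \<zero>\<^bsub>Orth\<^esub> x" using f by (simp add: O.r_neg)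
  then have "(\<ominus>\<^bsub>Orth\<^esub> f) x \<oplus>\<^bsub>T\<^esub> f x = \<zero>\<^bsub>T\<^esub>"
    using x f by (simp add: T.orth_group_simps T.orth_closed T.a_comm)
  then show ?thesis using f x T.minus_equality[of "(\<ominus>\<^bsub>Orth\<^esub> f) x" "f x"] by (simp add: T.orth_closed)
qed

lemma represents_neg:
  assumes f: "represents f c d" and c: "c \<in> carrier G" "d \<in> carrier H"
  shows "represents (\<ominus>\<^bsub>Orth\<^esub> f) (\<ominus>\<^bsub>G\<^esub> c) d" "represents (\<ominus>\<^bsub>Orth\<^esub> f) c (\<ominus>\<^bsub>H\<^esub> d)"
proof -
  have G: "a \<otimes>\<^bsub>G\<^esub> \<ominus>\<^bsub>G\<^esub> c = \<ominus>\<^bsub>G\<^esub> (a \<otimes>\<^bsub>G\<^esub> c)" if "a \<in> carrier G" for a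
  proof -
    interpret group_hom "add_monoid G" "add_monoid G" "\<lambda>c. a \<otimes>\<^bsub>G\<^esub> c"
      using that G.a_group by (auto simp: group_hom_def group_hom_axioms_def hom_def G.mult_closed G.distr_left)
    show ?thesis using hom_inv[of c] c by (simp add: a_inv_def)
  qed
  have H: "b \<otimes>\<^bsub>H\<^esub> \<ominus>\<^bsub>H\<^esub> d = \<ominus>\<^bsub>H\<^esub> (b \<otimes>\<^bsub>H\<^esub> d)" if "b \<in> carrier H" for b
  proof -
    interpret group_hom "add_monoid H" "add_monoid H" "\<lambda>d. b \<otimes>\<^bsub>H\<^esub> d"
      using that H.a_group by (auto simp: group_hom_def group_hom_axioms_def hom_def H.mult_closed H.distr_left)
    show ?thesis using hom_inv[of d] c by (simp add: a_inv_def)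
  qed
  show "represents (\<ominus>\<^bsub>Orth\<^esub> f) (\<ominus>\<^bsub>G\<^esub> c) d" "represents (\<ominus>\<^bsub>Orth\<^esub> f) c (\<ominus>\<^bsub>H\<^esub> d)"
    using f c by (simp_all add: represents_def orth_neg G H t_neg G.mult_closed H.mult_closed)
qed

lemma represents_pos:
  assumes "c \<in> pos_G" "d \<in> pos_H"
  shows "\<exists>f. represents f c d \<and> \<zero>\<^bsub>Orth\<^esub> \<preceq>\<^bsub>Orth\<^esub> f"
proof -
  obtain S where S: "pos_orth T S"
    "\<forall>a\<in>carrier G. \<forall>b\<in>carrier H. S (t a b) = t (a \<otimes>\<^bsub>G\<^esub> c) (b \<otimes>\<^bsub>H\<^esub> d)"
    using pos_orth_tensor_both[OF G.pos_orth_mult(1) H.pos_orth_mult(1), of c d] assms by auto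
  then have "represents (restrict S (carrier T)) c d \<and> \<zero>\<^bsub>Orth\<^esub> \<preceq>\<^bsub>Orth\<^esub> restrict S (carrier T)"
    by (simp add: represents_def T.pos_orth_mem_orth_group T.orth_group_simps T.pos_orth_nonneg)
  then show ?thesis by blast
qed

lemma represents_ex:
  assumes c: "c \<in> carrier G" and d: "d \<in> carrier H"
  shows "\<exists>f. represents f c d"
proof -
  have *: "\<exists>f. represents f c d" if d: "d \<in> pos_H" for d
  proof -
    let ?p = "excess G c \<zero>\<^bsub>G\<^esub>" and ?q = "excess G \<zero>\<^bsub>G\<^esub> c"
    obtain f g where "represents f ?p d" "represents g ?q d"
      using represents_pos[of ?p d] represents_pos[of ?q d] c d by auto
    then have "represents (f \<oplus>\<^bsub>Orth\<^esub> \<ominus>\<^bsub>Orth\<^esub> g) (?p \<oplus>\<^bsub>G\<^esub> \<ominus>\<^bsub>G\<^esub> ?q) d"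
      using c d by (intro represents_add(1)[where d' = d] represents_neg) auto
    then show ?thesis using G.decompose[OF c] by (auto simp: G.minus_eq)
  qed
  let ?p = "excess H d \<zero>\<^bsub>H\<^esub>" and ?q = "excess H \<zero>\<^bsub>H\<^esub> d"
  obtain f g where "represents f c ?p" "represents g c ?q"
    using *[of ?p] *[of ?q] d by auto
  then have "represents (f \<oplus>\<^bsub>Orth\<^esub> \<ominus>\<^bsub>Orth\<^esub> g) c (?p \<oplus>\<^bsub>H\<^esub> \<ominus>\<^bsub>H\<^esub> ?q)"
    using c d by (intro represents_add(2)[where c' = c] represents_neg) auto
  then show ?thesis using H.decompose[OF d] by (auto simp: H.minus_eq)
qed

definition \<rho> :: "'a \<Rightarrow> 'b \<Rightarrow> 't \<Rightarrow> 't" where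
  "\<rho> c d = (SOME f. represents f c d)"

lemma represents_\<rho>: "\<lbrakk> c \<in> carrier G; d \<in> carrier H \<rbrakk> \<Longrightarrow> represents (\<rho> c d) c d"
  unfolding \<rho>_def using represents_ex by (rule someI_ex)

lemma \<rho>_eqI: "\<lbrakk> represents f c d; c \<in> carrier G; d \<in> carrier H \<rbrakk> \<Longrightarrow> \<rho> c d = f"
  using represents_unique represents_\<rho> by blast

lemma \<rho>_closed: "\<lbrakk> c \<in> carrier G; d \<in> carrier H \<rbrakk> \<Longrightarrow> \<rho> c d \<in> carrier Orth"
  using represents_\<rho> by (simp add: represents_def)

lemma \<rho>_t:
  "\<lbrakk> a \<in> carrier G; b \<in> carrier H; c \<in> carrier G; d \<in> carrier H \<rbrakk> \<Longrightarrow> \<rho> c d (t a b) = t (a \<otimes>\<^bsub>G\<^esub> c) (b \<otimes>\<^bsub>H\<^esub> d)"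
  using represents_\<rho> by (simp add: represents_def)

lemma \<rho>_pos_orth:
  assumes "c \<in> pos_G" "d \<in> pos_H" shows "pos_orth T (\<rho> c d)"
proof -
  obtain f where "represents f c d" "\<zero>\<^bsub>Orth\<^esub> \<preceq>\<^bsub>Orth\<^esub> f" using represents_pos[OF assms] by blast
  then show ?thesis
    using \<rho>_eqI[of f c d] assms \<rho>_closed[of c d] by (intro T.orth_nonneg_pos_orth) auto
qed

text \<open>
  An element \<open>x \<ge> \<zero>\<close> lies below some \<open>A \<otimes> B\<close>, and the values there bound the values at \<open>x\<close>.
\<close>

lemma \<rho>_disj:
  assumes c: "c \<in> pos_G" "c' \<in> pos_G" and d: "d \<in> pos_H" "d' \<in> pos_H" and x: "x \<in> carrier T" "\<zero>\<^bsub>T\<^esub> \<preceq>\<^bsub>T\<^esub> x"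
    and disj: "\<And>A B. \<lbrakk> A \<in> pos_G; B \<in> pos_H \<rbrakk>
      \<Longrightarrow> t (A \<otimes>\<^bsub>G\<^esub> c) (B \<otimes>\<^bsub>H\<^esub> d) \<perp>\<^bsub>T\<^esub> t (A \<otimes>\<^bsub>G\<^esub> c') (B \<otimes>\<^bsub>H\<^esub> d')"
  shows "\<rho> c d x \<perp>\<^bsub>T\<^esub> \<rho> c' d' x"
proof -
  obtain A B where AB: "A \<in> pos_G" "B \<in> pos_H" "x \<preceq>\<^bsub>T\<^esub> t A B" using le_t[OF x(1)] by blast
  interpret f: l_homomorphism T T "\<rho> c d" using c d by (intro T.pos_orth_l_homomorphism \<rho>_pos_orth)
  interpret g: l_homomorphism T T "\<rho> c' d'" using c d by (intro T.pos_orth_l_homomorphism \<rho>_pos_orth)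
  have le: "\<rho> c d x \<preceq>\<^bsub>T\<^esub> \<rho> c d (t A B)" "\<rho> c' d' x \<preceq>\<^bsub>T\<^esub> \<rho> c' d' (t A B)"
    using AB x f.mono g.mono by simp_all
  have "\<rho> c d (t A B) \<perp>\<^bsub>T\<^esub> \<rho> c' d' (t A B)" using disj[OF AB(1,2)] AB c d by (simp add: \<rho>_t)
  then have "\<rho> c d x \<perp>\<^bsub>T\<^esub> \<rho> c' d' (t A B)"
    by (rule T.disj_mono[OF _ _ le(1)]) (use AB x f.nonneg in auto)
  then show ?thesis
    by (rule T.disj_mono_right[OF _ _ le(2)]) (use AB x g.nonneg in auto)
qed

lemma \<rho>_bimorphism: "l_bimorphism G H Orth \<rho>"
proof (rule l_bimorphismI[OF G.l_group_axioms H.l_group_axioms O.l_group_axioms])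
  fix a b b' assume *: "a \<in> carrier G" "\<zero>\<^bsub>G\<^esub> \<preceq>\<^bsub>G\<^esub> a" "b \<in> carrier H" "b' \<in> carrier H" "b \<perp>\<^bsub>H\<^esub> b'"
  have pos: "\<zero>\<^bsub>H\<^esub> \<preceq>\<^bsub>H\<^esub> b" "\<zero>\<^bsub>H\<^esub> \<preceq>\<^bsub>H\<^esub> b'" using H.disj_nonneg[OF *(5)] * by auto
  show "\<rho> a b \<perp>\<^bsub>Orth\<^esub> \<rho> a b'"
  proof (rule T.orth_disjI)
    fix x assume x: "x \<in> carrier T" "\<zero>\<^bsub>T\<^esub> \<preceq>\<^bsub>T\<^esub> x"
    show "\<rho> a b x \<perp>\<^bsub>T\<^esub> \<rho> a b' x"
    proof (rule \<rho>_disj[OF _ _ _ _ x])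
      fix A B assume AB: "A \<in> pos_G" "B \<in> pos_H"
      have "B \<otimes>\<^bsub>H\<^esub> b \<perp>\<^bsub>H\<^esub> B \<otimes>\<^bsub>H\<^esub> b'"
        using l_homomorphism.disj[OF H.pos_orth_l_homomorphism[OF H.pos_orth_mult(2)], of B b b'] AB * by simp
      then show "t (A \<otimes>\<^bsub>G\<^esub> a) (B \<otimes>\<^bsub>H\<^esub> b) \<perp>\<^bsub>T\<^esub> t (A \<otimes>\<^bsub>G\<^esub> a) (B \<otimes>\<^bsub>H\<^esub> b')"
        using l_homomorphism.disj[OF hom_right, of "A \<otimes>\<^bsub>G\<^esub> a" "B \<otimes>\<^bsub>H\<^esub> b" "B \<otimes>\<^bsub>H\<^esub> b'"] AB *
        by (simp add: G.mult_closed H.mult_closed G.mult_nonneg)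
    qed (use * pos in auto)
  qed (use * in \<open>auto simp: \<rho>_closed\<close>)
next
  fix a a' b assume *: "b \<in> carrier H" "\<zero>\<^bsub>H\<^esub> \<preceq>\<^bsub>H\<^esub> b" "a \<in> carrier G" "a' \<in> carrier G" "a \<perp>\<^bsub>G\<^esub> a'"
  have pos: "\<zero>\<^bsub>G\<^esub> \<preceq>\<^bsub>G\<^esub> a" "\<zero>\<^bsub>G\<^esub> \<preceq>\<^bsub>G\<^esub> a'" using G.disj_nonneg[OF *(5)] * by auto
  show "\<rho> a b \<perp>\<^bsub>Orth\<^esub> \<rho> a' b"
  proof (rule T.orth_disjI)
    fix x assume x: "x \<in> carrier T" "\<zero>\<^bsub>T\<^esub> \<preceq>\<^bsub>T\<^esub> x"
    show "\<rho> a b x \<perp>\<^bsub>T\<^esub> \<rho> a' b x"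
    proof (rule \<rho>_disj[OF _ _ _ _ x])
      fix A B assume AB: "A \<in> pos_G" "B \<in> pos_H"
      have "A \<otimes>\<^bsub>G\<^esub> a \<perp>\<^bsub>G\<^esub> A \<otimes>\<^bsub>G\<^esub> a'"
        using l_homomorphism.disj[OF G.pos_orth_l_homomorphism[OF G.pos_orth_mult(2)], of A a a'] AB * by simp
      then show "t (A \<otimes>\<^bsub>G\<^esub> a) (B \<otimes>\<^bsub>H\<^esub> b) \<perp>\<^bsub>T\<^esub> t (A \<otimes>\<^bsub>G\<^esub> a') (B \<otimes>\<^bsub>H\<^esub> b)"
        using AB * by (intro t_disj) (auto simp: G.mult_closed H.mult_closed H.mult_nonneg)
    qed (use * pos in auto)
  qed (use * in \<open>auto simp: \<rho>_closed\<close>)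
next
  fix a b b' assume *: "a \<in> carrier G" "b \<in> carrier H" "b' \<in> carrier H"
  show "\<rho> a (b \<oplus>\<^bsub>H\<^esub> b') = \<rho> a b \<oplus>\<^bsub>Orth\<^esub> \<rho> a b'"
    by (rule \<rho>_eqI, rule represents_add(2)[where c' = a]) (use * in \<open>auto simp: represents_\<rho>\<close>)
next
  fix a a' b assume *: "a \<in> carrier G" "a' \<in> carrier G" "b \<in> carrier H"
  show "\<rho> (a \<oplus>\<^bsub>G\<^esub> a') b = \<rho> a b \<oplus>\<^bsub>Orth\<^esub> \<rho> a' b"
    by (rule \<rho>_eqI, rule represents_add(1)[where d' = b]) (use * in \<open>auto simp: represents_\<rho>\<close>)
qed (simp_all add: \<rho>_closed)

lemma \<Theta>_ex: "\<exists>\<Theta>. \<Theta> \<in> l_hom T Orth \<and> (\<forall>c\<in>carrier G. \<forall>d\<in>carrier H. \<rho> c d = \<Theta> (t c d))"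
  using orth_tensor_product[OF O.arch_l_group_axioms \<rho>_bimorphism] .

text \<open>
  The extension of \<open>\<rho>\<close> to \<open>T\<close>; \<open>\<Theta> y\<close> is right multiplication by \<open>y\<close>.
\<close>

definition \<Theta> where
  "\<Theta> = (SOME \<Theta>. \<Theta> \<in> l_hom T Orth \<and> (\<forall>c\<in>carrier G. \<forall>d\<in>carrier H. \<rho> c d = \<Theta> (t c d)))"

lemma \<Theta>_l_hom: "\<Theta> \<in> l_hom T Orth"
  and \<Theta>_t: "\<lbrakk> c \<in> carrier G; d \<in> carrier H \<rbrakk> \<Longrightarrow> \<Theta> (t c d) = \<rho> c d"
  using someI_ex[OF \<Theta>_ex] by (simp_all flip: \<Theta>_def)

sublocale \<Theta>: l_homomorphism T Orth \<Theta>
  by (rule l_homomorphismI[OF T.l_group_axioms O.l_group_axioms \<Theta>_l_hom])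

definition tensor_mult :: "'t \<Rightarrow> 't \<Rightarrow> 't" (infixl "\<star>" 70) where
  "x \<star> y = \<Theta> y x"

lemma star_closed [simp]: "\<lbrakk> x \<in> carrier T; y \<in> carrier T \<rbrakk> \<Longrightarrow> x \<star> y \<in> carrier T"
  by (simp add: tensor_mult_def T.orth_closed)

lemma star_add:
  "\<lbrakk> x \<in> carrier T; y \<in> carrier T; z \<in> carrier T \<rbrakk> \<Longrightarrow> (x \<oplus>\<^bsub>T\<^esub> y) \<star> z = x \<star> z \<oplus>\<^bsub>T\<^esub> y \<star> z"
  "\<lbrakk> x \<in> carrier T; y \<in> carrier T; z \<in> carrier T \<rbrakk> \<Longrightarrow> z \<star> (x \<oplus>\<^bsub>T\<^esub> y) = z \<star> x \<oplus>\<^bsub>T\<^esub> z \<star> y"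
  by (simp_all add: tensor_mult_def T.orth_additive \<Theta>.add T.orth_group_simps(2))

lemma star_t:
  "\<lbrakk> a \<in> carrier G; c \<in> carrier G; b \<in> carrier H; d \<in> carrier H \<rbrakk>
    \<Longrightarrow> t a b \<star> t c d = t (a \<otimes>\<^bsub>G\<^esub> c) (b \<otimes>\<^bsub>H\<^esub> d)"
  by (simp add: tensor_mult_def \<Theta>_t \<rho>_t)

lemma pos_orth_star: "\<lbrakk> y \<in> carrier T; \<zero>\<^bsub>T\<^esub> \<preceq>\<^bsub>T\<^esub> y \<rbrakk> \<Longrightarrow> pos_orth T (\<lambda>x. x \<star> y)"
  unfolding tensor_mult_def by (rule T.orth_nonneg_pos_orth) (simp_all add: \<Theta>.nonneg)

lemma star_nonneg:
  "\<lbrakk> x \<in> carrier T; y \<in> carrier T; \<zero>\<^bsub>T\<^esub> \<preceq>\<^bsub>T\<^esub> x; \<zero>\<^bsub>T\<^esub> \<preceq>\<^bsub>T\<^esub> y \<rbrakk> \<Longrightarrow> \<zero>\<^bsub>T\<^esub> \<preceq>\<^bsub>T\<^esub> x \<star> y"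
  using T.pos_orth_nonneg[OF pos_orth_star] by simp

lemma star_right_l_hom: "\<lbrakk> y \<in> carrier T; \<zero>\<^bsub>T\<^esub> \<preceq>\<^bsub>T\<^esub> y \<rbrakk> \<Longrightarrow> (\<lambda>x. x \<star> y) \<in> l_hom T T"
  using pos_orth_star T.pos_orth_l_hom by blast

text \<open>
  Evaluation of orthomorphisms at a positive point is an \<open>\<ell>\<close>-homomorphism, because the lattice
  operations of \<open>Orth\<close> are pointwise on the cone.
\<close>

lemma star_left_l_hom: "\<lbrakk> x \<in> carrier T; \<zero>\<^bsub>T\<^esub> \<preceq>\<^bsub>T\<^esub> x \<rbrakk> \<Longrightarrow> (\<lambda>y. x \<star> y) \<in> l_hom T T"
  unfolding tensor_mult_def
  by (rule l_hom_compose[OF T.l_group_axioms O.l_group_axioms T.l_group_axioms \<Theta>_l_hom T.orth_eval_l_hom])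

text \<open>
  Right multiplications are orthomorphisms by construction; left multiplications need an argument. Left
  multiplication by a pure tensor \<open>A \<otimes> B\<close> agrees on generators, hence everywhere, with the orthomorphism
  induced by the left multiplications with \<open>A\<close> and \<open>B\<close>; and every \<open>c\<close> lies below some \<open>A \<otimes> B\<close>.
\<close>

lemma disj_star_left:
  assumes ab: "a \<in> carrier T" "b \<in> carrier T" "a \<perp>\<^bsub>T\<^esub> b" and c: "c \<in> carrier T" "\<zero>\<^bsub>T\<^esub> \<preceq>\<^bsub>T\<^esub> c"
  shows "c \<star> a \<perp>\<^bsub>T\<^esub> b"
proof -
  have a: "\<zero>\<^bsub>T\<^esub> \<preceq>\<^bsub>T\<^esub> a" using T.disj_nonneg[OF ab(3)] ab by simp
  obtain A B where AB: "A \<in> pos_G" "B \<in> pos_H" "c \<preceq>\<^bsub>T\<^esub> t A B" using le_t[OF c(1)] by blast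
  obtain L where L: "pos_orth T L"
    "\<forall>a\<in>carrier G. \<forall>b\<in>carrier H. L (t a b) = t (A \<otimes>\<^bsub>G\<^esub> a) (B \<otimes>\<^bsub>H\<^esub> b)"
    using pos_orth_tensor_both[OF G.pos_orth_mult(2) H.pos_orth_mult(2), of A B] AB by auto
  have eq: "t A B \<star> a = L a"
    by (rule l_hom_eqI[OF T.l_group_axioms star_left_l_hom T.pos_orth_l_hom[OF L(1)] _ ab(1)])
      (use AB L(2) in \<open>auto simp: star_t\<close>)
  have "L a \<perp>\<^bsub>T\<^esub> b" by (rule T.pos_orth_disj[OF L(1) ab(3,1,2)])
  moreover have "c \<star> a \<preceq>\<^bsub>T\<^esub> L a"
    using l_homomorphism.mono[OF l_homomorphismI[OF T.l_group_axioms T.l_group_axioms star_right_l_hom] AB(3)]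
      ab a c AB by (simp flip: eq)
  ultimately show ?thesis
    using ab a c star_nonneg[OF c(1) ab(1) c(2) a] T.pos_orth_closed[OF L(1)]
    by (intro T.disj_mono[of "L a" b "c \<star> a"]) auto
qed

text \<open>
  Both sides are \<open>\<ell>\<close>-homomorphisms in each variable as long as the other two are positive. So the
  identity passes from pure tensors to arbitrary \<open>z\<close>, then \<open>x\<close>, then \<open>y\<close>, and finally, by additivity,
  to \<open>x\<close> and \<open>z\<close> of any sign.
\<close>

lemma star_assoc:
  assumes "x \<in> carrier T" "y \<in> carrier T" "z \<in> carrier T"
  shows "(x \<star> y) \<star> z = x \<star> (y \<star> z)"
proof -
  note TT = T.l_group_axioms and hom_comp = l_hom_compose[OF T.l_group_axioms T.l_group_axioms T.l_group_axioms]
  have 1: "(t a b \<star> t c d) \<star> z = t a b \<star> (t c d \<star> z)"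
    if "a \<in> pos_G" "b \<in> pos_H" "c \<in> pos_G" "d \<in> pos_H" "z \<in> carrier T" for a b c d z
  proof (rule l_hom_eqI[OF TT _ _ _ that(5)])
    show "(\<lambda>z. (t a b \<star> t c d) \<star> z) \<in> l_hom T T"
      using that by (intro star_left_l_hom star_nonneg) auto
    show "(\<lambda>z. t a b \<star> (t c d \<star> z)) \<in> l_hom T T"
      using that by (intro hom_comp[of "\<lambda>z. t c d \<star> z" "\<lambda>y. t a b \<star> y"] star_left_l_hom) auto
    show "(t a b \<star> t c d) \<star> t e f = t a b \<star> (t c d \<star> t e f)" if "e \<in> pos_G" "f \<in> pos_H" for e f
      using that \<open>a \<in> pos_G\<close> \<open>b \<in> pos_H\<close> \<open>c \<in> pos_G\<close> \<open>d \<in> pos_H\<close>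
      by (simp add: star_t G.mult_closed H.mult_closed G.mult_assoc H.mult_assoc)
  qed
  have 2: "(x \<star> t c d) \<star> z = x \<star> (t c d \<star> z)"
    if "c \<in> pos_G" "d \<in> pos_H" "z \<in> carrier T" "\<zero>\<^bsub>T\<^esub> \<preceq>\<^bsub>T\<^esub> z" "x \<in> carrier T" for c d z x
  proof (rule l_hom_eqI[OF TT _ _ _ that(5)])
    show "(\<lambda>x. (x \<star> t c d) \<star> z) \<in> l_hom T T"
      using that by (intro hom_comp[of "\<lambda>x. x \<star> t c d" "\<lambda>x. x \<star> z"] star_right_l_hom) auto
    show "(\<lambda>x. x \<star> (t c d \<star> z)) \<in> l_hom T T"
      using that by (intro star_right_l_hom star_nonneg) auto
  qed (use 1 that in auto)
  have 3: "(x \<star> y) \<star> z = x \<star> (y \<star> z)"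
    if "x \<in> carrier T" "\<zero>\<^bsub>T\<^esub> \<preceq>\<^bsub>T\<^esub> x" "z \<in> carrier T" "\<zero>\<^bsub>T\<^esub> \<preceq>\<^bsub>T\<^esub> z" "y \<in> carrier T" for x y z
  proof (rule l_hom_eqI[OF TT _ _ _ that(5)])
    show "(\<lambda>y. (x \<star> y) \<star> z) \<in> l_hom T T"
      using that by (intro hom_comp[of "\<lambda>y. x \<star> y" "\<lambda>x. x \<star> z"] star_left_l_hom star_right_l_hom) auto
    show "(\<lambda>y. x \<star> (y \<star> z)) \<in> l_hom T T"
      using that by (intro hom_comp[of "\<lambda>y. y \<star> z" "\<lambda>y. x \<star> y"] star_left_l_hom star_right_l_hom) auto
  qed (use 2 that in auto)
  have 4: "(x \<star> y) \<star> z = x \<star> (y \<star> z)"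
    if "x \<in> carrier T" "z \<in> carrier T" "\<zero>\<^bsub>T\<^esub> \<preceq>\<^bsub>T\<^esub> z" "y \<in> carrier T" for x y z
    by (rule T.additive_eqI[of "\<lambda>x. (x \<star> y) \<star> z" "\<lambda>x. x \<star> (y \<star> z)"]) (use 3 that in \<open>auto simp: star_add\<close>)
  show ?thesis
    by (rule T.additive_eqI[of "\<lambda>z. (x \<star> y) \<star> z" "\<lambda>z. x \<star> (y \<star> z)"]) (use 4 assms in \<open>auto simp: star_add\<close>)
qed

lemma f_ring_tensor_mult: "f_ring (T\<lparr>mult := tensor_mult\<rparr>)"
proof -
  let ?T = "T\<lparr>mult := tensor_mult\<rparr>"
  have o: "ord_of ?T = ord_of T" by (simp add: ord_of_def)
  have "abelian_group ?T"
    using T.abelian_group_axioms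
    by (simp add: abelian_group_def abelian_group_axioms_def abelian_monoid_def)
  then have "l_group ?T"
    using T.lattice_ord by (intro l_group.intro l_group_axioms.intro) (simp_all add: o)
  then show ?thesis
    using T.pos_orth_disj[OF pos_orth_star] disj_star_left
    by (intro f_ring.intro l_ring.intro l_ring_axioms.intro f_ring_axioms.intro)
      (simp_all add: o star_assoc star_add star_nonneg disj_def)
qed

end

theorem theorem2:
  fixes G :: "'a lo_ring" and H :: "'b lo_ring" and T :: "'t lo_ring"
    and t :: "'a \<Rightarrow> 'b \<Rightarrow> 't"
  assumes "arch_f_ring G" and "arch_f_ring H"
    and "is_arch_tensor_product G H T t"
  shows "\<exists>m. f_ring (T\<lparr>mult := m\<rparr>) \<and>
    (\<forall>a\<in>carrier G. \<forall>c\<in>carrier G. \<forall>b\<in>carrier H. \<forall>d\<in>carrier H.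
       m (t a b) (t c d) = t (a \<otimes>\<^bsub>G\<^esub> c) (b \<otimes>\<^bsub>H\<^esub> d))"
proof -
  interpret f_ring_tensor G H T t
  proof (intro f_ring_tensor.intro l_tensor_universal.intro l_tensor.intro l_tensor_axioms.intro
      l_tensor_universal_axioms.intro f_ring_tensor_axioms.intro)
    show "arch_l_group G" "f_ring G" "arch_l_group H" "f_ring H"
      using assms(1,2) by (simp_all add: arch_f_ring_def)
    show "arch_l_group T" "l_bimorphism G H T t"
      using assms(3) by (simp_all add: is_arch_tensor_product_def)
    show "carrier T \<subseteq> l_gen T ((\<lambda>(a, b). t a b) ` (carrier G \<times> carrier H))"
      using is_arch_tensor_product_gen[OF assms(3)] by simp
  qed (rule tensor_universalD(2)[OF tensor_universal_all_types[OF assms(3)]]; assumption)+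
  show ?thesis
    using f_ring_tensor_mult star_t by blast
qed

end
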